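(* Let $A$ be a separable $C^*$-algebra, $n\ge1$, and $J$ a real skew-symmetric $n\times n$ matrix. Assume that the map $\mathcal{O}:CB^\infty(\mathbb{R}^{2n},A)\to\mathcal{H}$, $a\mapsto a(x,D)$, is a bijection, where $\mathcal{H}\subseteq\mathcal{B}^*(E)$ is the set of Heisenberg-smooth operators. Let $T\in\mathcal{B}^*(E)$ be translation-smooth and such that $TR_\varphi=R_\varphi T$ for all $\varphi\in S^A(\mathbb{R}^n)$. Then there exists $F\in CB^\infty(\mathbb{R}^n,A)$ such that $T=L_F$.
   Context: $A$ is a separable $C^*$-algebra. $S^A(\mathbb{R}^n)$ is the space of Schwartz functions $\mathbb{R}^n\to A$, with $A$-valued inner product $\langle f,g\rangle=\int f(x)^*g(x)\,dx$ and norm $\|f\|_2=\|\langle f,f\rangle\|_A^{1/2}$. $E$ is its completion, a (right) Hilbert $A$-module; $\mathcal{B}^*(E)$ is the set of adjointable operators on $E$. $CB^\infty(\mathbb{R}^m,A)$ is the set of $C^\infty$ functions $\mathbb{R}^m\to A$ bounded together with all their derivatives. For $a\in CB^\infty(\mathbb{R}^{2n},A)$, $\mathcal{O}(a)=a(x,D)$ is the operator given on $\varphi\in S^A(\mathbb{R}^n)$ by $$a(x,D)\varphi(x)=(2\pi)^{-n}\int\!\!\int e^{i(x-y)\cdot\xi}a(x,\xi)\varphi(y)\,dy\,d\xi=(2\pi)^{-n/2}\int e^{ix\cdot\xi}a(x,\xi)\hat\varphi(\xi)\,d\xi,$$ with $\hat\varphi(\xi)=(2\pi)^{-n/2}\int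 e^{-i\xi\cdot y}\varphi(y)\,dy$. It extends to an element of $\mathcal{B}^*(E)$ that is Heisenberg-smooth, and $\mathcal{O}:CB^\infty(\mathbb{R}^{2n},A)\to\mathcal{H}$ is always well defined and injective. For $z,\zeta\in\mathbb{R}^n$ let $E_{z,\zeta}f(x)=e^{i\zeta\cdot x}f(x-z)$, $f\in S^A(\mathbb{R}^n)$ (extended to $E$). For $V\in\mathcal{B}^*(E)$ put $V_{z,\zeta}=E_{z,\zeta}^{-1}VE_{z,\zeta}$. $V$ is Heisenberg-smooth if $(z,\zeta)\mapsto V_{z,\zeta}$ is $C^\infty$ from $\mathbb{R}^{2n}$ to $\mathcal{B}^*(E)$ with the operator norm, and translation-smooth if $z\mapsto V_{z,0}$ is $C^\infty$ on $\mathbb{R}^n$. Rieffel's deformed product (oscillatory integral): $F\times_JG(x)=(2\pi)^{-n}\int\!\int e^{iu\cdot v}F(x+Ju)G(x+v)\,du\,dv$. For $F\in CB^\infty(\mathbb{R}^n,A)$, $L_F\varphi=F\times_J\varphi$ for $\varphi\in S^A(\mathbb{R}^n)$; equivalently $L_F$ is the pseudodifferential operator with symbol $(x,\xi)\mapsto F(x-J\xi)$, which extends to an element of $\mathcal{B}^*(E)$. For $\varphi\in S^A(\mathbb{R}^n)$, $R_\varphi f=f\times_J\varphi$ for $f\in S^A(\mathbb{R}^n)$, extended by continuity to a bounded operator on $E$. *)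

theory Defs
  imports "HOL-Analysis.Analysis"
begin

section \<open>\<open>C\<close>*-algebras and Hilbert modules\<close>

class complex_normed_vector = real_normed_vector +
  fixes scaleC :: "complex \<Rightarrow> 'a \<Rightarrow> 'a"  (infixr \<open>*\<^sub>C\<close> 75)
  assumes scaleC_add_right: "c *\<^sub>C (x + y) = c *\<^sub>C x + c *\<^sub>C y"
    and scaleC_add_left: "(c + d) *\<^sub>C x = c *\<^sub>C x + d *\<^sub>C x"
    and scaleC_scaleC: "c *\<^sub>C (d *\<^sub>C x) = (c * d) *\<^sub>C x"
    and scaleC_of_real: "complex_of_real r *\<^sub>C x = r *\<^sub>R x"
    and norm_scaleC: "norm (c *\<^sub>C x) = cmod c * norm x"

text \<open>No unit is required. Separability is imposed where it is needed through the class
  \<^class>\<open>second_countable_topology\<close>, to which it is equivalent for metric spaces.\<close>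

class cstar_algebra = complex_normed_vector + real_normed_algebra + banach +
  fixes star :: "'a \<Rightarrow> 'a"
  assumes mult_scaleC_left: "(c *\<^sub>C a) * b = c *\<^sub>C (a * b)"
    and mult_scaleC_right: "a * (c *\<^sub>C b) = c *\<^sub>C (a * b)"
    and star_add: "star (a + b) = star a + star b"
    and star_scaleC: "star (c *\<^sub>C a) = cnj c *\<^sub>C star a"
    and star_mult: "star (a * b) = star b * star a"
    and star_star: "star (star a) = a"
    and cstar_identity: "norm (star a * a) = (norm a)\<^sup>2"

text \<open>Completeness of \<open>E\<close> is part of the sort \<^class>\<open>banach\<close>; the last axiom makes the norm of
  the type the one induced by the \<open>A\<close>-valued inner product. An element of \<open>A\<close> is positive
  when it has the form \<open>star b * b\<close>.\<close>

locale hilbert_module =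
  fixes ip :: "'e::{complex_normed_vector,banach} \<Rightarrow> 'e \<Rightarrow> 'a::cstar_algebra"
    and act :: "'e \<Rightarrow> 'a \<Rightarrow> 'e"
  assumes act_add_left: "act (x + y) a = act x a + act y a"
    and act_add_right: "act x (a + b) = act x a + act x b"
    and act_mult: "act x (a * b) = act (act x a) b"
    and act_scaleC_left: "act (c *\<^sub>C x) a = c *\<^sub>C act x a"
    and act_scaleC_right: "act x (c *\<^sub>C a) = c *\<^sub>C act x a"
    and ip_add_right: "ip x (y + z) = ip x y + ip x z"
    and ip_scaleC_right: "ip x (c *\<^sub>C y) = c *\<^sub>C ip x y"
    and ip_act_right: "ip x (act y a) = ip x y * a"
    and ip_star: "star (ip x y) = ip y x"
    and ip_positive: "\<exists>b. ip x x = star b * b"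
    and norm_ip: "norm x = sqrt (norm (ip x x))"

text \<open>The adjoint is not asked to be linear or bounded: both follow.\<close>

definition adjointable ::
    "('e::{complex_normed_vector,banach} \<Rightarrow> 'e \<Rightarrow> 'a::cstar_algebra) \<Rightarrow> ('e \<Rightarrow>\<^sub>L 'e) set" where
  "adjointable ip = {V. \<exists>W :: 'e \<Rightarrow> 'e. \<forall>x y. ip (blinfun_apply V x) y = ip x (W y)}"


section \<open>Smooth functions\<close>

fun iter_deriv :: "'v::euclidean_space list \<Rightarrow> ('v \<Rightarrow> 'b::real_normed_vector) \<Rightarrow> 'v \<Rightarrow> 'b" where
  "iter_deriv [] f = f"
| "iter_deriv (v # vs) f = (\<lambda>x. frechet_derivative (iter_deriv vs f) (at x) v)"

text \<open>The partial derivatives are the \<^const>\<open>iter_deriv\<close> along lists of basis vectors. If those of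
  every order are (totally) differentiable, they are all continuous, so this is \<open>C\<^sup>\<infinity>\<close>.\<close>

definition smooth :: "('v::euclidean_space \<Rightarrow> 'b::real_normed_vector) \<Rightarrow> bool" where
  "smooth f \<longleftrightarrow> (\<forall>vs x. set vs \<subseteq> Basis \<longrightarrow> iter_deriv vs f differentiable (at x))"

definition CB_infinity :: "('v::euclidean_space \<Rightarrow> 'b::real_normed_vector) set" where
  "CB_infinity = {f. smooth f \<and> (\<forall>vs. set vs \<subseteq> Basis \<longrightarrow> bounded (range (iter_deriv vs f)))}"

definition schwartz :: "('v::euclidean_space \<Rightarrow> 'b::real_normed_vector) set" where
  "schwartz = {f. smooth f \<and>
     (\<forall>vs k. set vs \<subseteq> Basis \<longrightarrow> bounded (range (\<lambda>x. norm x ^ k *\<^sub>R iter_deriv vs f x)))}"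


section \<open>The completion of the Schwartz space\<close>

text \<open>\<open>E\<close> is a Hilbert module into which the \<open>A\<close>-valued Schwartz functions embed densely,
  preserving all the structure; this determines it up to unique isomorphism. The values of \<open>\<iota>\<close> off
  \<^const>\<open>schwartz\<close> are irrelevant.\<close>

locale schwartz_completion = hilbert_module ip act
  for ip :: "'e::{complex_normed_vector,banach} \<Rightarrow> 'e \<Rightarrow>
        'a::{cstar_algebra,second_countable_topology}"
    and act :: "'e \<Rightarrow> 'a \<Rightarrow> 'e" +
  fixes \<iota> :: "(real^'n \<Rightarrow> 'a) \<Rightarrow> 'e"
  assumes \<iota>_add: "\<lbrakk>f \<in> schwartz; g \<in> schwartz\<rbrakk> \<Longrightarrow> \<iota> (\<lambda>x. f x + g x) = \<iota> f + \<iota> g"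
    and \<iota>_scaleC: "f \<in> schwartz \<Longrightarrow> \<iota> (\<lambda>x. c *\<^sub>C f x) = c *\<^sub>C \<iota> f"
    and \<iota>_act: "f \<in> schwartz \<Longrightarrow> \<iota> (\<lambda>x. f x * a) = act (\<iota> f) a"
    and \<iota>_ip: "\<lbrakk>f \<in> schwartz; g \<in> schwartz\<rbrakk> \<Longrightarrow>
      ip (\<iota> f) (\<iota> g) = (\<integral>x. star (f x) * g x \<partial>lborel)"
    and \<iota>_dense: "closure (\<iota> ` schwartz) = UNIV"

definition extends_to ::
    "((real^'n \<Rightarrow> 'a::cstar_algebra) \<Rightarrow> 'e::{complex_normed_vector,banach}) \<Rightarrow>
     ((real^'n \<Rightarrow> 'a) \<Rightarrow> (real^'n \<Rightarrow> 'a)) \<Rightarrow> ('e \<Rightarrow>\<^sub>L 'e) \<Rightarrow> bool" where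
  "extends_to \<iota> P V \<longleftrightarrow> (\<forall>f\<in>schwartz. P f \<in> schwartz \<and> V (\<iota> f) = \<iota> (P f))"

definition op_extension ::
    "((real^'n \<Rightarrow> 'a::cstar_algebra) \<Rightarrow> 'e::{complex_normed_vector,banach}) \<Rightarrow>
     ((real^'n \<Rightarrow> 'a) \<Rightarrow> (real^'n \<Rightarrow> 'a)) \<Rightarrow> 'e \<Rightarrow>\<^sub>L 'e" where
  "op_extension \<iota> P = (THE V. extends_to \<iota> P V)"

lemma (in schwartz_completion) op_extension_eq:
  assumes V: "extends_to \<iota> P V"
  shows "op_extension \<iota> P = V"
  unfolding op_extension_def
proof (rule the_equality)
  show "extends_to \<iota> P V" by (rule V)
next
  fix W assume W: "extends_to \<iota> P W"
  have "closed {x. W x = V x}"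
    by (intro closed_Collect_eq linear_continuous_on blinfun.bounded_linear_right)
  moreover have "\<iota> ` schwartz \<subseteq> {x. W x = V x}"
    using V W by (auto simp: extends_to_def)
  ultimately have "closure (\<iota> ` schwartz) \<subseteq> {x. W x = V x}"
    by (rule closure_minimal[rotated])
  then show "W = V"
    using \<iota>_dense by (intro blinfun_eqI) auto
qed


section \<open>Pseudodifferential operators\<close>

definition fourier :: "(real^'n \<Rightarrow> 'a) \<Rightarrow> real^'n \<Rightarrow> 'a::{cstar_algebra,second_countable_topology}" where
  "fourier \<phi> \<xi> = (2 * pi) powr (- real CARD('n) / 2) *\<^sub>R
     (\<integral>y. cis (- (\<xi> \<bullet> y)) *\<^sub>C \<phi> y \<partial>lborel)"

definition pseudodiff ::
    "((real^'n) \<times> (real^'n) \<Rightarrow> 'a) \<Rightarrow> (real^'n \<Rightarrow> 'a) \<Rightarrow>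
     real^'n \<Rightarrow> 'a::{cstar_algebra,second_countable_topology}" where
  "pseudodiff a \<phi> x = (2 * pi) powr (- real CARD('n) / 2) *\<^sub>R
     (\<integral>\<xi>. cis (x \<bullet> \<xi>) *\<^sub>C (a (x, \<xi>) * fourier \<phi> \<xi>) \<partial>lborel)"

definition quantization ::
    "((real^'n \<Rightarrow> 'a::{cstar_algebra,second_countable_topology}) \<Rightarrow> 'e) \<Rightarrow> ((real^'n) \<times> (real^'n) \<Rightarrow> 'a) \<Rightarrow>
     'e::{complex_normed_vector,banach} \<Rightarrow>\<^sub>L 'e" where
  "quantization \<iota> a = op_extension \<iota> (pseudodiff a)"


section \<open>Heisenberg-smooth and translation-smooth operators\<close>

definition heisenberg ::
    "((real^'n \<Rightarrow> 'a::cstar_algebra) \<Rightarrow> 'e::{complex_normed_vector,banach}) \<Rightarrow>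
     real^'n \<Rightarrow> real^'n \<Rightarrow> 'e \<Rightarrow>\<^sub>L 'e" where
  "heisenberg \<iota> z \<zeta> = op_extension \<iota> (\<lambda>f x. cis (\<zeta> \<bullet> x) *\<^sub>C f (x - z))"

definition op_inverse :: "('e::real_normed_vector \<Rightarrow>\<^sub>L 'e) \<Rightarrow> 'e \<Rightarrow>\<^sub>L 'e" where
  "op_inverse U = (THE W. W o\<^sub>L U = id_blinfun \<and> U o\<^sub>L W = id_blinfun)"

definition heisenberg_conj ::
    "((real^'n \<Rightarrow> 'a::cstar_algebra) \<Rightarrow> 'e::{complex_normed_vector,banach}) \<Rightarrow>
     ('e \<Rightarrow>\<^sub>L 'e) \<Rightarrow> real^'n \<Rightarrow> real^'n \<Rightarrow> 'e \<Rightarrow>\<^sub>L 'e" where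
  "heisenberg_conj \<iota> V z \<zeta> =
     op_inverse (heisenberg \<iota> z \<zeta>) o\<^sub>L V o\<^sub>L heisenberg \<iota> z \<zeta>"

text \<open>The norm of \<open>'e \<Rightarrow>\<^sub>L 'e\<close> is the operator norm, so these are smoothness in operator norm.\<close>

definition heisenberg_smooth ::
    "((real^'n \<Rightarrow> 'a::cstar_algebra) \<Rightarrow> 'e::{complex_normed_vector,banach}) \<Rightarrow>
     ('e \<Rightarrow>\<^sub>L 'e) \<Rightarrow> bool" where
  "heisenberg_smooth \<iota> V \<longleftrightarrow> smooth (\<lambda>(z, \<zeta>). heisenberg_conj \<iota> V z \<zeta>)"

definition translation_smooth ::
    "((real^'n \<Rightarrow> 'a::cstar_algebra) \<Rightarrow> 'e::{complex_normed_vector,banach}) \<Rightarrow>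
     ('e \<Rightarrow>\<^sub>L 'e) \<Rightarrow> bool" where
  "translation_smooth \<iota> V \<longleftrightarrow> smooth (\<lambda>z. heisenberg_conj \<iota> V z 0)"


section \<open>Rieffel's deformed product\<close>

text \<open>\<open>osc_integral g\<close> is the oscillatory integral of an integrand \<open>g\<close> (oscillating factor
  included): the limit, independent of the cutoff \<open>\<kappa>\<close>, of the regularized integrals.\<close>

definition has_osc_integral ::
    "('v::euclidean_space \<Rightarrow> 'a) \<Rightarrow> 'a::{cstar_algebra,second_countable_topology} \<Rightarrow> bool" where
  "has_osc_integral g I \<longleftrightarrow> (\<forall>\<kappa>::'v \<Rightarrow> complex. \<kappa> \<in> schwartz \<and> \<kappa> 0 = 1 \<longrightarrow>
     ((\<lambda>\<epsilon>. \<integral>w. \<kappa> (\<epsilon> *\<^sub>R w) *\<^sub>C g w \<partial>lborel) \<longlongrightarrow> I) (at_right 0))"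

definition osc_integral ::
    "('v::euclidean_space \<Rightarrow> 'a) \<Rightarrow> 'a::{cstar_algebra,second_countable_topology}" where
  "osc_integral g = (THE I. has_osc_integral g I)"

definition deformed_product ::
    "real^'n^'n \<Rightarrow> (real^'n \<Rightarrow> 'a) \<Rightarrow> (real^'n \<Rightarrow> 'a) \<Rightarrow>
     real^'n \<Rightarrow> 'a::{cstar_algebra,second_countable_topology}" where
  "deformed_product J F G x = (2 * pi) powr (- real CARD('n)) *\<^sub>R
     osc_integral (\<lambda>(u, v). cis (u \<bullet> v) *\<^sub>C (F (x + J *v u) * G (x + v)))"

definition left_mult_op ::
    "((real^'n \<Rightarrow> 'a::{cstar_algebra,second_countable_topology}) \<Rightarrow> 'e) \<Rightarrow> real^'n^'n \<Rightarrow> (real^'n \<Rightarrow> 'a) \<Rightarrow>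
     'e::{complex_normed_vector,banach} \<Rightarrow>\<^sub>L 'e" where
  "left_mult_op \<iota> J F = op_extension \<iota> (deformed_product J F)"

definition right_mult_op ::
    "((real^'n \<Rightarrow> 'a::{cstar_algebra,second_countable_topology}) \<Rightarrow> 'e) \<Rightarrow> real^'n^'n \<Rightarrow> (real^'n \<Rightarrow> 'a) \<Rightarrow>
     'e::{complex_normed_vector,banach} \<Rightarrow>\<^sub>L 'e" where
  "right_mult_op \<iota> J \<phi> = op_extension \<iota> (\<lambda>f. deformed_product J f \<phi>)"

end

theory Submission
  imports Defs "HOL-Probability.Characteristic_Functions" "HOL-Probability.Sinc_Integral"
    "HOL-Real_Asymp.Real_Asymp"
begin

text \<open>Carrying out the \<open>v\<close>-integration in \<open>f \<times>\<^sub>J \<phi>\<close> shows that \<open>R\<^sub>\<phi>\<close> is, up to a constant, the weak integral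
  of \<open>U(u) f \<cdot> \<phi>'(u)\<close> over \<open>u\<close>, where \<open>\<phi>'\<close> is the Fourier transform of \<open>\<phi>\<close> and
  \<open>U(u) = E\<^bsub>Ju,u\<^esub>\<close>. Letting \<open>\<phi>'\<close> run through Gaussians (times elements of \<open>A\<close>) that concentrate at a
  point, one sees that \<open>T\<close> commutes with every \<open>U(u)\<close>. Since \<open>E\<^bsub>z,\<zeta>\<^esub> = U(\<zeta>) E\<^bsub>z-J\<zeta>,0\<^esub>\<close>, this gives
  \<open>T\<^bsub>z,\<zeta>\<^esub> = T\<^bsub>z-J\<zeta>,0\<^esub>\<close>, so \<open>T\<close> is Heisenberg-smooth and \<open>T = a(x,D)\<close>. Conjugation by \<open>U(\<zeta>)\<close> translates
  the symbol by \<open>(J\<zeta>,\<zeta>)\<close>; hence \<open>a\<close> is invariant under these translations, i.e.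
  \<open>a(x,\<xi>) = F(x - J\<xi>)\<close> with \<open>F = a(\<cdot>,0)\<close>.\<close>

section \<open>Calculus of smooth functions\<close>

text \<open>Elements of the completion E have no pointwise values, so an integral formula for the
  right multiplications makes sense only after pairing with a second vector, as an A-valued integral
  of matrix elements. T passes through such a weak integral because its adjoint moves it to the
  other argument of the inner product. Since A may lack a unit, letting the Gaussians concentrate at
  u yields only D(u) a = 0 for the matrix element D of the commutator; the coefficient a = star (D
  u) then forces D(u) = 0 by the C*-identity.

  Two features of the definitions shape the rest. Operators on E are named by definite descriptions,
  so a bounded extension has to be produced before the name says anything. The oscillatory integral
  is a limit over arbitrary cutoffs, so the decay of its inner integral has to be uniform in the
  cutoff parameter; integration by parts in v supplies it.\<close>

definition partial :: "'v::euclidean_space \<Rightarrow> ('v \<Rightarrow> 'b::real_normed_vector) \<Rightarrow> 'v \<Rightarrow> 'b" where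
  "partial b f = (\<lambda>x. frechet_derivative f (at x) b)"

text \<open>The head of the list is the derivative taken last. Splitting at the other end exposes
  the one taken first, which is what shows that a class defined by all iterated derivatives is
  stable under \<open>partial\<close>.\<close>

lemma iter_deriv_snoc: "iter_deriv (vs @ [b]) f = iter_deriv vs (partial b f)"
  by (induction vs) (auto simp: partial_def)

text \<open>Weights \<open>W = {}\<close>, \<open>W = {1}\<close> and \<open>W = {(1 + |x|)\<^sup>k | k}\<close> give the smooth, the
  \<open>CB\<^sup>\<infinity>\<close> and the Schwartz functions.\<close>

definition weighted_smooth :: "('v \<Rightarrow> real) set \<Rightarrow> ('v::euclidean_space \<Rightarrow> 'b::real_normed_vector) set" where
  "weighted_smooth W = {f. smooth f \<and>
     (\<forall>vs. \<forall>w\<in>W. set vs \<subseteq> Basis \<longrightarrow> bounded (range (\<lambda>x. w x *\<^sub>R iter_deriv vs f x)))}"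

lemma smooth_eq_weighted: "smooth f \<longleftrightarrow> f \<in> weighted_smooth {}"
  by (simp add: weighted_smooth_def)

lemma CB_infinity_eq_weighted: "CB_infinity = weighted_smooth {\<lambda>x. 1}"
  by (auto simp: weighted_smooth_def CB_infinity_def)

definition schwartz_weights :: "('v::euclidean_space \<Rightarrow> real) set" where
  "schwartz_weights = range (\<lambda>k x. (1 + norm x) ^ k)"

lemma one_plus_power_le: "(1 + r) ^ k \<le> 2 ^ k * (1 + r ^ k)" if "r \<ge> (0::real)"
proof -
  have "(1 + r) ^ k \<le> (2 * max 1 r) ^ k"
    using that by (intro power_mono) auto
  also have "\<dots> = 2 ^ k * (max 1 r) ^ k" by (simp add: power_mult_distrib)
  also have "(max 1 r) ^ k \<le> 1 + r ^ k"
    using that by (auto simp: max_def)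
  finally show ?thesis by simp
qed

text \<open>The weights \<open>(1 + norm x) ^ k\<close> are bounded below by 1 and compare well
  under translations, unlike \<open>norm x ^ k\<close>. The two families give the same class because
  \<open>(1 + r) ^ k\<close> is at most a multiple of \<open>1 + r ^ k\<close>.\<close>

lemma schwartz_eq_weighted: "schwartz = weighted_smooth schwartz_weights"
proof -
  have "(\<forall>k. bounded (range (\<lambda>x. norm x ^ k *\<^sub>R g x))) \<longleftrightarrow>
        (\<forall>k. bounded (range (\<lambda>x. (1 + norm x) ^ k *\<^sub>R g x)))" for g :: "'v::euclidean_space \<Rightarrow> 'b::real_normed_vector"
  proof (intro iffI allI)
    fix k assume *: "\<forall>k. bounded (range (\<lambda>x. norm x ^ k *\<^sub>R g x))"
    obtain c0 where c0: "\<And>x. norm (g x) \<le> c0"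
      using *[rule_format, of 0] by (auto simp: bounded_iff)
    obtain c1 where c1: "\<And>x. norm x ^ k * norm (g x) \<le> c1"
      using *[rule_format, of k] by (auto simp: bounded_iff)
    have "norm ((1 + norm x) ^ k *\<^sub>R g x) \<le> 2 ^ k * (c0 + c1)" for x
    proof -
      have "norm ((1 + norm x) ^ k *\<^sub>R g x) = (1 + norm x) ^ k * norm (g x)" by simp
      also have "\<dots> \<le> (2 ^ k * (1 + norm x ^ k)) * norm (g x)"
        by (intro mult_right_mono one_plus_power_le) auto
      also have "\<dots> = 2 ^ k * (norm (g x) + norm x ^ k * norm (g x))" by (simp add: algebra_simps)
      also have "\<dots> \<le> 2 ^ k * (c0 + c1)"
        by (intro mult_left_mono add_mono c0 c1) auto
      finally show ?thesis .
    qed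
    then show "bounded (range (\<lambda>x. (1 + norm x) ^ k *\<^sub>R g x))"
      by (auto simp: bounded_iff)
  next
    fix k assume *: "\<forall>k. bounded (range (\<lambda>x. (1 + norm x) ^ k *\<^sub>R g x))"
    obtain c1 where c1: "\<And>x. (1 + norm x) ^ k * norm (g x) \<le> c1"
      using *[rule_format, of k] by (auto simp: bounded_iff)
    have "norm (norm x ^ k *\<^sub>R g x) \<le> c1" for x
    proof -
      have "norm x ^ k * norm (g x) \<le> (1 + norm x) ^ k * norm (g x)"
        by (intro mult_right_mono power_mono) auto
      then show ?thesis using c1[of x] by simp
    qed
    then show "bounded (range (\<lambda>x. norm x ^ k *\<^sub>R g x))"
      by (auto simp: bounded_iff)
  qed
  then show ?thesis
    unfolding schwartz_def weighted_smooth_def schwartz_weights_def by (simp add: all_conj_distrib) blast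
qed

lemma smooth_has_derivative:
  "smooth f \<Longrightarrow> (f has_derivative frechet_derivative f (at x)) (at x)"
  unfolding smooth_def using frechet_derivative_works[of f "at x"]
  by (metis empty_subsetI iter_deriv.simps(1) list.set(1))

lemma weighted_smooth_imp_smooth: "f \<in> weighted_smooth W \<Longrightarrow> smooth f"
  by (simp add: weighted_smooth_def)

lemma weighted_smooth_bounded:
  "f \<in> weighted_smooth W \<Longrightarrow> w \<in> W \<Longrightarrow> bounded (range (\<lambda>x. w x *\<^sub>R f x))"
  unfolding weighted_smooth_def by (auto dest!: spec[where x="[]"])

lemma weighted_smooth_partial:
  assumes f: "f \<in> weighted_smooth W" and b: "b \<in> Basis"
  shows "partial b f \<in> weighted_smooth W"
proof -
  have *: "set (vs @ [b]) \<subseteq> Basis" if "set vs \<subseteq> Basis" for vs using b that by auto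
  have "smooth (partial b f)"
    unfolding smooth_def iter_deriv_snoc[symmetric]
    using f * by (auto simp only: weighted_smooth_def smooth_def mem_Collect_eq)
  moreover have "bounded (range (\<lambda>x. w x *\<^sub>R iter_deriv vs (partial b f) x))"
    if "w \<in> W" "set vs \<subseteq> Basis" for w vs
    unfolding iter_deriv_snoc[symmetric]
    using f *[OF that(2)] that(1) by (auto simp only: weighted_smooth_def mem_Collect_eq)
  ultimately show ?thesis by (simp add: weighted_smooth_def)
qed

text \<open>Product and chain rules turn the derivative of a function of a given shape into a sum of
  functions of that shape. Real linear combinations of a set \<open>B\<close> of shapes are
  therefore the natural invariant for iterated differentiation.\<close>

inductive lincomb :: "('v \<Rightarrow> 'b::real_normed_vector) set \<Rightarrow> ('v \<Rightarrow> 'b) \<Rightarrow> bool"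
  for B where
  zero: "lincomb B (\<lambda>x. 0)"
| base: "g \<in> B \<Longrightarrow> lincomb B g"
| add: "lincomb B g \<Longrightarrow> lincomb B h \<Longrightarrow> lincomb B (\<lambda>x. g x + h x)"
| scale: "lincomb B g \<Longrightarrow> lincomb B (\<lambda>x. r *\<^sub>R g x)"

lemma lincomb_sum:
  "finite I \<Longrightarrow> (\<And>i. i \<in> I \<Longrightarrow> lincomb B (g i)) \<Longrightarrow> lincomb B (\<lambda>x. \<Sum>i\<in>I. g i x)"
  by (induction I rule: finite_induct) (auto intro: lincomb.intros)

lemma lincomb_bounded:
  assumes "\<And>g. g \<in> B \<Longrightarrow> bounded (range (\<lambda>x. w x *\<^sub>R g x))" and "lincomb B h"
  shows "bounded (range (\<lambda>x. (w x :: real) *\<^sub>R h x))"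
  using assms(2)
proof induction
  case zero
  then show ?case by (auto simp: bounded_iff)
next
  case (base g)
  then show ?case using assms(1) by auto
next
  case (add g h)
  then have "bounded (range (\<lambda>x. w x *\<^sub>R g x + w x *\<^sub>R h x))" by (intro bounded_plus_comp)
  then show ?case by (simp add: scaleR_add_right)
next
  case (scale g r)
  then have "bounded ((*\<^sub>R) r ` range (\<lambda>x. w x *\<^sub>R g x))" by (intro bounded_scaling)
  then show ?case by (simp add: image_image mult.commute)
qed

lemma lincomb_deriv:
  assumes B: "\<And>g. g \<in> B \<Longrightarrow> \<exists>D. (\<forall>x. (g has_derivative D x) (at x)) \<and> (\<forall>b\<in>Basis. lincomb B (\<lambda>x. D x b))"
    and "lincomb B h"
  shows "\<exists>D. (\<forall>x. (h has_derivative D x) (at x)) \<and> (\<forall>b\<in>Basis. lincomb B (\<lambda>x. D x b))"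
  using assms(2)
proof induction
  case zero
  then show ?case by (intro exI[of _ "\<lambda>_ _. 0"]) (auto intro: lincomb.intros)
next
  case (base g)
  then show ?case using B by auto
next
  case (add g h)
  then obtain D D' where "\<forall>x. (g has_derivative D x) (at x)" "\<forall>b\<in>Basis. lincomb B (\<lambda>x. D x b)"
    "\<forall>x. (h has_derivative D' x) (at x)" "\<forall>b\<in>Basis. lincomb B (\<lambda>x. D' x b)" by auto
  then show ?case
    by (intro exI[of _ "\<lambda>x y. D x y + D' x y"]) (auto intro!: lincomb.add has_derivative_add)
next
  case (scale g r)
  then obtain D where "\<forall>x. (g has_derivative D x) (at x)" "\<forall>b\<in>Basis. lincomb B (\<lambda>x. D x b)" by auto
  then show ?case
    by (intro exI[of _ "\<lambda>x y. r *\<^sub>R D x y"]) (auto intro!: lincomb.scale has_derivative_scaleR_right)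
qed

text \<open>Induction on the order of differentiation keeps every iterated derivative in the span of
  \<open>B\<close>, so differentiability and the weight bounds have to be checked on
  \<open>B\<close> alone. Each later membership proof amounts to choosing \<open>B\<close>.\<close>

lemma weighted_smoothI:
  assumes B: "\<And>g. g \<in> B \<Longrightarrow> \<exists>D. (\<forall>x. (g has_derivative D x) (at x)) \<and> (\<forall>b\<in>Basis. lincomb B (\<lambda>x. D x b))"
    and W: "\<And>g w. g \<in> B \<Longrightarrow> w \<in> W \<Longrightarrow> bounded (range (\<lambda>x. w x *\<^sub>R g x))"
    and f: "f \<in> B"
  shows "f \<in> weighted_smooth W"
proof -
  have *: "lincomb B (iter_deriv vs f)" if "set vs \<subseteq> Basis" for vs
    using that
  proof (induction vs)
    case Nil
    then show ?case using f by (auto intro: lincomb.base)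
  next
    case (Cons b vs)
    then obtain D where D: "\<forall>x. (iter_deriv vs f has_derivative D x) (at x)"
      "\<forall>b\<in>Basis. lincomb B (\<lambda>x. D x b)" using lincomb_deriv[OF B, where h="iter_deriv vs f"] by fastforce
    have "frechet_derivative (iter_deriv vs f) (at x) = D x" for x
      using D(1) by (metis frechet_derivative_at)
    then show ?case using D(2) Cons.prems by auto
  qed
  have "smooth f" unfolding smooth_def
    using lincomb_deriv[OF B *] by (blast intro: differentiableI)
  moreover have "bounded (range (\<lambda>x. w x *\<^sub>R iter_deriv vs f x))"
    if "w \<in> W" "set vs \<subseteq> Basis" for w vs
    using lincomb_bounded[OF W *] that by auto
  ultimately show ?thesis by (auto simp: weighted_smooth_def)
qed

section \<open>Closure properties of the weighted classes\<close>

lemma weighted_smooth_add: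
  assumes "f \<in> weighted_smooth W" "g \<in> weighted_smooth W"
  shows "(\<lambda>x. f x + g x) \<in> weighted_smooth W"
proof (rule weighted_smoothI)
  let ?B = "{\<lambda>x. f x + g x | f g. f \<in> weighted_smooth W \<and> g \<in> weighted_smooth W}"
  show "(\<lambda>x. f x + g x) \<in> ?B" using assms by auto
  fix h assume "h \<in> ?B"
  then obtain f g where h: "h = (\<lambda>x. f x + g x)" and fg: "f \<in> weighted_smooth W" "g \<in> weighted_smooth W"
    by auto
  have "lincomb ?B (\<lambda>x. partial b f x + partial b g x)" if "b \<in> Basis" for b
    using weighted_smooth_partial[OF fg(1) that] weighted_smooth_partial[OF fg(2) that]
    by (intro lincomb.base) auto
  then show "\<exists>D. (\<forall>x. (h has_derivative D x) (at x)) \<and> (\<forall>b\<in>Basis. lincomb ?B (\<lambda>x. D x b))"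
    unfolding h partial_def
    by (intro exI[of _ "\<lambda>x y. frechet_derivative f (at x) y + frechet_derivative g (at x) y"])
      (auto intro!: has_derivative_add smooth_has_derivative weighted_smooth_imp_smooth[OF fg(1)]
         weighted_smooth_imp_smooth[OF fg(2)])
  fix w assume "w \<in> W"
  then show "bounded (range (\<lambda>x. w x *\<^sub>R h x))"
    unfolding h scaleR_add_right using fg by (intro bounded_plus_comp weighted_smooth_bounded)
qed

lemma weighted_smooth_bounded_linear:
  assumes M: "bounded_linear M" and "f \<in> weighted_smooth W"
  shows "(\<lambda>x. M (f x)) \<in> weighted_smooth W"
proof (rule weighted_smoothI)
  let ?B = "{\<lambda>x. M (f x) | f. f \<in> weighted_smooth W}"
  show "(\<lambda>x. M (f x)) \<in> ?B" using assms by auto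
  fix h assume "h \<in> ?B"
  then obtain f where h: "h = (\<lambda>x. M (f x))" and f: "f \<in> weighted_smooth W"
    by auto
  have "lincomb ?B (\<lambda>x. M (partial b f x))" if "b \<in> Basis" for b
    using weighted_smooth_partial[OF f that] by (intro lincomb.base) auto
  then show "\<exists>D. (\<forall>x. (h has_derivative D x) (at x)) \<and> (\<forall>b\<in>Basis. lincomb ?B (\<lambda>x. D x b))"
    unfolding h partial_def
    by (intro exI[of _ "\<lambda>x y. M (frechet_derivative f (at x) y)"])
      (auto intro!: bounded_linear.has_derivative[OF M] smooth_has_derivative
         weighted_smooth_imp_smooth[OF f])
  fix w assume "w \<in> W"
  then have "bounded (M ` range (\<lambda>x. w x *\<^sub>R f x))"
    using f by (intro bounded_linear_image[OF _ M] weighted_smooth_bounded)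
  then show "bounded (range (\<lambda>x. w x *\<^sub>R h x))"
    by (simp add: h image_image linear_cmul[OF bounded_linear.linear[OF M]])
qed

text \<open>Two families of weights occur because the substitution changes them: a weight in
  \<open>x\<close> must be dominated by one evaluated at \<open>L x + c\<close>. For the constant
  weight this holds for every \<open>L\<close>, for the Schwartz weights it is applied to
  translations.\<close>

lemma weighted_smooth_affine:
  assumes L: "bounded_linear L" and f: "f \<in> weighted_smooth W'"
    and W: "\<And>w. w \<in> W \<Longrightarrow> \<exists>w'\<in>W'. \<exists>C. \<forall>x. \<bar>w x\<bar> \<le> C * \<bar>w' (L x + c)\<bar>"
  shows "(\<lambda>x. f (L x + c)) \<in> weighted_smooth W"
proof (rule weighted_smoothI)
  let ?B = "{\<lambda>x. f (L x + c) | f. f \<in> weighted_smooth W'}"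
  show "(\<lambda>x. f (L x + c)) \<in> ?B" using assms by auto
  fix h assume "h \<in> ?B"
  then obtain f where h: "h = (\<lambda>x. f (L x + c))" and f: "f \<in> weighted_smooth W'"
    by auto
  note sm = smooth_has_derivative[OF weighted_smooth_imp_smooth[OF f]]
  have "lincomb ?B (\<lambda>x. frechet_derivative f (at (L x + c)) (L b))" for b
  proof -
    \<comment> \<open>The vector \<open>L b\<close> is in general no basis vector, while the class
      controls partial derivatives along the basis only; hence the expansion in coordinates.\<close>
    have "frechet_derivative f (at y) (L b) = (\<Sum>d\<in>Basis. (L b \<bullet> d) *\<^sub>R partial d f y)" for y
    proof -
      have "linear (frechet_derivative f (at y))"
        using has_derivative_linear[OF sm] .
      then show ?thesis unfolding partial_def
        by (subst (1) euclidean_representation[of "L b", symmetric])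
          (simp add: linear_sum linear_cmul)
    qed
    moreover have "lincomb ?B (\<lambda>x. \<Sum>d\<in>Basis. (L b \<bullet> d) *\<^sub>R partial d f (L x + c))"
      using weighted_smooth_partial[OF f]
      by (intro lincomb_sum finite_Basis lincomb.scale lincomb.base) auto
    ultimately show ?thesis by simp
  qed
  moreover have "(h has_derivative (\<lambda>y. frechet_derivative f (at (L x + c)) (L y))) (at x)" for x
  proof -
    have "((\<lambda>x. L x + c) has_derivative L) (at x)"
      using has_derivative_add[OF bounded_linear_imp_has_derivative[OF L] has_derivative_const]
      by (metis (no_types, lifting) add.right_neutral ext)
    then show ?thesis unfolding h by (rule has_derivative_compose[OF _ sm])
  qed
  ultimately show "\<exists>D. (\<forall>x. (h has_derivative D x) (at x)) \<and> (\<forall>b\<in>Basis. lincomb ?B (\<lambda>x. D x b))"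
    by (intro exI[of _ "\<lambda>x y. frechet_derivative f (at (L x + c)) (L y)"]) auto
  fix w assume "w \<in> W"
  then obtain w' C where w': "w' \<in> W'" and C: "\<And>x. \<bar>w x\<bar> \<le> C * \<bar>w' (L x + c)\<bar>" using W by blast
  obtain K where K: "\<And>x. norm (w' x *\<^sub>R f x) \<le> K"
    using weighted_smooth_bounded[OF f w'] by (auto simp: bounded_iff)
  have "norm (w x *\<^sub>R h x) \<le> \<bar>C\<bar> * K" for x
  proof -
    have "norm (w x *\<^sub>R h x) = \<bar>w x\<bar> * norm (h x)" by simp
    also have "\<dots> \<le> (\<bar>C\<bar> * \<bar>w' (L x + c)\<bar>) * norm (h x)"
      using C[of x] by (intro mult_right_mono order_trans[OF C]) (auto intro: mult_right_mono)
    also have "\<dots> = \<bar>C\<bar> * norm (w' (L x + c) *\<^sub>R f (L x + c))" by (simp add: h)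
    also have "\<dots> \<le> \<bar>C\<bar> * K" by (intro mult_left_mono K) auto
    finally show ?thesis .
  qed
  then show "bounded (range (\<lambda>x. w x *\<^sub>R h x))" by (auto simp: bounded_iff)
qed

text \<open>By the product rule the shape \<open>P (k x) (f x)\<close> reproduces itself, and the
  weight can be moved onto \<open>f\<close> by linearity. This covers products with plane waves and
  complex scalars alike.\<close>

lemma weighted_smooth_bilinear:
  assumes P: "bounded_bilinear P" and "k \<in> CB_infinity" "f \<in> weighted_smooth W"
  shows "(\<lambda>x. P (k x) (f x)) \<in> weighted_smooth W"
proof (rule weighted_smoothI)
  interpret P: bounded_bilinear P by fact
  let ?B = "{\<lambda>x. P (k x) (f x) | k f. k \<in> CB_infinity \<and> f \<in> weighted_smooth W}"
  show "(\<lambda>x. P (k x) (f x)) \<in> ?B" using assms by auto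
  fix h assume "h \<in> ?B"
  then obtain k f where h: "h = (\<lambda>x. P (k x) (f x))" and f: "f \<in> weighted_smooth W"
    and k: "k \<in> weighted_smooth {\<lambda>x. 1}"
    by (auto simp: CB_infinity_eq_weighted)
  have "lincomb ?B (\<lambda>x. P (k x) (partial b f x) + P (partial b k x) (f x))" if "b \<in> Basis" for b
    using weighted_smooth_partial[OF f that] weighted_smooth_partial[OF k that] k f
    by (intro lincomb.add lincomb.base) (auto simp: CB_infinity_eq_weighted)
  then show "\<exists>D. (\<forall>x. (h has_derivative D x) (at x)) \<and> (\<forall>b\<in>Basis. lincomb ?B (\<lambda>x. D x b))"
    unfolding h partial_def
    by (intro exI[of _ "\<lambda>x y. P (k x) (frechet_derivative f (at x) y) + P (frechet_derivative k (at x) y) (f x)"])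
      (auto intro!: P.FDERIV smooth_has_derivative weighted_smooth_imp_smooth[OF f] weighted_smooth_imp_smooth[OF k])
  fix w assume w: "w \<in> W"
  obtain c1 where c1: "\<And>x. norm (k x) \<le> c1"
    using weighted_smooth_bounded[OF k] by (auto simp: bounded_iff)
  obtain c2 where c2: "\<And>x. norm (w x *\<^sub>R f x) \<le> c2"
    using weighted_smooth_bounded[OF f w] by (auto simp: bounded_iff)
  obtain K where K: "K \<ge> 0" "\<And>x y. norm (P x y) \<le> norm x * norm y * K"
    using P.nonneg_bounded by blast
  have c1': "c1 \<ge> 0" using order_trans[OF norm_ge_zero c1] by blast
  have "norm (w x *\<^sub>R h x) \<le> c1 * c2 * K" for x
  proof -
    have "norm (w x *\<^sub>R h x) = norm (P (k x) (w x *\<^sub>R f x))" by (simp add: h P.scaleR_right)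
    also have "\<dots> \<le> norm (k x) * norm (w x *\<^sub>R f x) * K" by (rule K)
    also have "\<dots> \<le> c1 * c2 * K"
      using c1' K(1) by (intro mult_right_mono mult_mono c1 c2) auto
    finally show ?thesis .
  qed
  then show "bounded (range (\<lambda>x. w x *\<^sub>R h x))" by (auto simp: bounded_iff)
qed

lemma schwartz_subset_CB_infinity: "schwartz \<subseteq> (CB_infinity :: ('v::euclidean_space \<Rightarrow> 'b::real_normed_vector) set)"
proof
  fix f :: "'v \<Rightarrow> 'b" assume f: "f \<in> schwartz"
  have "bounded (range (iter_deriv vs f))" if "set vs \<subseteq> Basis" for vs
  proof -
    have "bounded (range (\<lambda>x. norm x ^ 0 *\<^sub>R iter_deriv vs f x))"
      using f that unfolding schwartz_def by blast
    then show ?thesis by (simp only: power_0 scaleR_one)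
  qed
  then show "f \<in> CB_infinity" using f by (simp add: schwartz_def CB_infinity_def)
qed

lemma CB_infinity_affine:
  "bounded_linear L \<Longrightarrow> f \<in> CB_infinity \<Longrightarrow> (\<lambda>x. f (L x + c)) \<in> CB_infinity"
  unfolding CB_infinity_eq_weighted by (rule weighted_smooth_affine) auto

lemma smooth_affine: "bounded_linear L \<Longrightarrow> smooth f \<Longrightarrow> smooth (\<lambda>x. f (L x + c))"
  unfolding smooth_eq_weighted by (rule weighted_smooth_affine) auto

lemma schwartz_add: "f \<in> schwartz \<Longrightarrow> g \<in> schwartz \<Longrightarrow> (\<lambda>x. f x + g x) \<in> schwartz"
  unfolding schwartz_eq_weighted by (rule weighted_smooth_add)

lemma schwartz_bounded_linear: "bounded_linear M \<Longrightarrow> f \<in> schwartz \<Longrightarrow> (\<lambda>x. M (f x)) \<in> schwartz"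
  unfolding schwartz_eq_weighted by (rule weighted_smooth_bounded_linear)

lemma schwartz_bilinear:
  "bounded_bilinear P \<Longrightarrow> k \<in> CB_infinity \<Longrightarrow> f \<in> schwartz \<Longrightarrow> (\<lambda>x. P (k x) (f x)) \<in> schwartz"
  unfolding schwartz_eq_weighted by (rule weighted_smooth_bilinear)

text \<open>The weight comparison is the inequality 1 + |x| \<le> (1 + |c|) (1 + |x + c|), raised to
  the power \<open>k\<close>.\<close>

lemma schwartz_translate:
  fixes f :: "'v::euclidean_space \<Rightarrow> 'b::real_normed_vector"
  assumes "f \<in> schwartz"
  shows "(\<lambda>x. f (x + c)) \<in> schwartz"
  unfolding schwartz_eq_weighted
proof (rule weighted_smooth_affine[where L="\<lambda>x. x" and W'=schwartz_weights])
  fix w :: "'v \<Rightarrow> real" assume "w \<in> schwartz_weights"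
  then obtain k where w: "w = (\<lambda>x. (1 + norm x) ^ k)" by (auto simp: schwartz_weights_def)
  have "\<bar>w x\<bar> \<le> (1 + norm c) ^ k * \<bar>w (x + c)\<bar>" for x
  proof -
    have "norm x \<le> norm (x + c) + norm c"
      by (metis add_diff_cancel norm_triangle_ineq4)
    moreover have "0 \<le> norm c * norm (x + c)" by simp
    moreover have "(1 + norm c) * (1 + norm (x + c)) = 1 + norm c + norm (x + c) + norm c * norm (x + c)"
      by (simp add: algebra_simps)
    ultimately have "1 + norm x \<le> (1 + norm c) * (1 + norm (x + c))" by linarith
    then have "(1 + norm x) ^ k \<le> ((1 + norm c) * (1 + norm (x + c))) ^ k"
      by (intro power_mono) auto
    then show ?thesis by (simp add: w power_mult_distrib)
  qed
  then show "\<exists>w'\<in>schwartz_weights. \<exists>C. \<forall>x. \<bar>w x\<bar> \<le> C * \<bar>w' (x + c)\<bar>"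
    using \<open>w \<in> schwartz_weights\<close> by blast
qed (use assms in \<open>auto simp: schwartz_eq_weighted\<close>)

section \<open>Plane waves and Gaussians\<close>

lemma cis_inner_CB_infinity: "(\<lambda>x::'v::euclidean_space. cis (\<zeta> \<bullet> x)) \<in> CB_infinity"
  unfolding CB_infinity_eq_weighted
proof (rule weighted_smoothI)
  \<comment> \<open>The free constant \<open>c\<close> absorbs the factor
    \<open>\<i> * (\<zeta> \<bullet> b)\<close> that each derivative brings out.\<close>
  let ?B = "range (\<lambda>c (x::'v). c * cis (\<zeta> \<bullet> x))"
  show "(\<lambda>x. cis (\<zeta> \<bullet> x)) \<in> ?B" by (intro image_eqI[of _ _ 1]) auto
  fix h assume "h \<in> ?B"
  then obtain c where h: "h = (\<lambda>x. c * cis (\<zeta> \<bullet> x))" by auto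
  have "(h has_derivative (\<lambda>y. (c * \<i> * (\<zeta> \<bullet> y)) * cis (\<zeta> \<bullet> x))) (at x)" for x
  proof -
    have "((\<lambda>x. cis (\<zeta> \<bullet> x)) has_derivative (\<lambda>y. (\<zeta> \<bullet> y) *\<^sub>R (\<i> * cis (\<zeta> \<bullet> x)))) (at x)"
      by (intro has_derivative_cis has_derivative_inner_right has_derivative_ident)
    from has_derivative_mult_right[OF this, of c] show ?thesis
      unfolding h by (simp add: scaleR_conv_of_real algebra_simps)
  qed
  then show "\<exists>D. (\<forall>x. (h has_derivative D x) (at x)) \<and> (\<forall>b\<in>Basis. lincomb ?B (\<lambda>x. D x b))"
    by (intro exI[of _ "\<lambda>x y. (c * \<i> * (\<zeta> \<bullet> y)) * cis (\<zeta> \<bullet> x)"]) (auto intro!: lincomb.base)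
  fix w :: "'v \<Rightarrow> real" assume "w \<in> {\<lambda>x. 1}"
  then show "bounded (range (\<lambda>x. w x *\<^sub>R h x))"
    by (auto simp: bounded_iff h norm_mult)
qed

lemma real_polynomial_function_derivative:
  fixes p :: "'v::euclidean_space \<Rightarrow> real"
  assumes "real_polynomial_function p"
  shows "\<exists>D. (\<forall>x. (p has_derivative D x) (at x)) \<and> (\<forall>b. real_polynomial_function (\<lambda>x. D x b))"
  using assms
proof induction
  case (linear f)
  then show ?case
    by (intro exI[of _ "\<lambda>x. f"]) (auto intro: real_polynomial_function.intros bounded_linear_imp_has_derivative)
next
  case (const c)
  then show ?case by (intro exI[of _ "\<lambda>x y. 0"]) (auto intro: real_polynomial_function.intros)
next
  case (add f g)
  then obtain D E where "\<And>x. (f has_derivative D x) (at x)" "\<And>b. real_polynomial_function (\<lambda>x. D x b)"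
    "\<And>x. (g has_derivative E x) (at x)" "\<And>b. real_polynomial_function (\<lambda>x. E x b)" by blast
  then show ?case
    by (intro exI[of _ "\<lambda>x y. D x y + E x y"])
      (auto intro!: real_polynomial_function.intros(3) has_derivative_add)
next
  case (mult f g)
  then obtain D E where "\<And>x. (f has_derivative D x) (at x)" "\<And>b. real_polynomial_function (\<lambda>x. D x b)"
    "\<And>x. (g has_derivative E x) (at x)" "\<And>b. real_polynomial_function (\<lambda>x. E x b)" by blast
  then show ?case using mult.hyps
    by (intro exI[of _ "\<lambda>x y. f x * E x y + D x y * g x"])
      (auto intro!: real_polynomial_function.intros(3,4) has_derivative_mult)
qed

lemma real_polynomial_function_growth:
  fixes p :: "'v::euclidean_space \<Rightarrow> real"
  assumes "real_polynomial_function p"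
  shows "\<exists>C\<ge>0. \<exists>N. \<forall>x. \<bar>p x\<bar> \<le> C * (1 + norm x) ^ N"
  using assms
proof induction
  case (linear f)
  then obtain K where K: "K > 0" "\<And>x. norm (f x) \<le> norm x * K" using bounded_linear.pos_bounded by blast
  have "\<bar>f x\<bar> \<le> K * (1 + norm x) ^ 1" for x using K(2)[of x] K(1) by (simp add: algebra_simps)
  then show ?case using K(1) less_imp_le by blast
next
  case (const c)
  then show ?case by (intro exI[of _ "\<bar>c\<bar>"] conjI exI[of _ 0]) auto
next
  case (add f g)
  then obtain C N D M where C: "C \<ge> 0" "\<And>x. \<bar>f x\<bar> \<le> C * (1 + norm x) ^ N"
    and D: "D \<ge> 0" "\<And>x. \<bar>g x\<bar> \<le> D * (1 + norm x) ^ M" by blast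
  have "\<bar>f x + g x\<bar> \<le> (C + D) * (1 + norm x) ^ (N + M)" for x
  proof -
    have "\<bar>f x + g x\<bar> \<le> C * (1 + norm x) ^ N + D * (1 + norm x) ^ M"
      using C(2)[of x] D(2)[of x] by linarith
    also have "\<dots> \<le> C * (1 + norm x) ^ (N + M) + D * (1 + norm x) ^ (N + M)"
      by (intro add_mono mult_left_mono power_increasing C D) auto
    finally show ?thesis by (simp add: algebra_simps)
  qed
  then show ?case using C(1) D(1) by (metis add_nonneg_nonneg)
next
  case (mult f g)
  then obtain C N D M where C: "C \<ge> 0" "\<And>x. \<bar>f x\<bar> \<le> C * (1 + norm x) ^ N"
    and D: "D \<ge> 0" "\<And>x. \<bar>g x\<bar> \<le> D * (1 + norm x) ^ M" by blast
  have "\<bar>f x * g x\<bar> \<le> (C * D) * (1 + norm x) ^ (N + M)" for x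
  proof -
    have "\<bar>f x * g x\<bar> \<le> (C * (1 + norm x) ^ N) * (D * (1 + norm x) ^ M)"
      unfolding abs_mult using C D by (intro mult_mono) auto
    then show ?thesis by (simp add: algebra_simps power_add)
  qed
  then show ?case using C(1) D(1) by (metis mult_nonneg_nonneg)
qed

lemma power_exp_bounded:
  fixes s :: real
  assumes "s > 0"
  shows "\<exists>C. \<forall>r\<ge>0. (1 + r) ^ k * exp (- s * r\<^sup>2) \<le> C"
proof -
  let ?f = "\<lambda>r::real. (1 + r) ^ k * exp (- s * r\<^sup>2)"
  have "(?f \<longlongrightarrow> 0) at_top" using assms by real_asymp
  then have "eventually (\<lambda>r. ?f r < 1) at_top"
    by (rule order_tendstoD) auto
  then obtain R where R: "\<And>r. r \<ge> R \<Longrightarrow> ?f r < 1" by (auto simp: eventually_at_top_linorder)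
  have "compact (?f ` {0..R})" by (intro compact_continuous_image continuous_intros) auto
  then obtain M where M: "\<And>r. r \<in> {0..R} \<Longrightarrow> ?f r \<le> M"
    by (metis (mono_tags, lifting) bounded_imp_bdd_above bdd_above.E compact_imp_bounded image_eqI)
  have "?f r \<le> max 1 M" if "r \<ge> 0" for r using R[of r] M[of r] that by (cases "r \<ge> R") auto
  then show ?thesis by blast
qed

text \<open>All derivatives of a Gaussian are polynomials times that Gaussian, so the shapes
  \<open>p x * ?e x\<close> are closed under differentiation. Gaussian decay then beats the growth
  of \<open>p\<close> together with that of the weight.\<close>

lemma gaussian_schwartz:
  assumes s: "s > 0"
  shows "(\<lambda>x::'v::euclidean_space. exp (- s * (norm x)\<^sup>2)) \<in> schwartz"
  unfolding schwartz_eq_weighted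
proof (rule weighted_smoothI)
  let ?e = "\<lambda>x::'v. exp (- s * (norm x)\<^sup>2)"
  let ?B = "{\<lambda>x. p x * ?e x | p. real_polynomial_function p}"
  show "?e \<in> ?B" by (auto intro!: exI[of _ "\<lambda>_. 1"] real_polynomial_function.intros(2))
  fix h assume "h \<in> ?B"
  then obtain p where h: "h = (\<lambda>x. p x * ?e x)" and p: "real_polynomial_function p" by auto
  obtain D where D: "\<And>x. (p has_derivative D x) (at x)" "\<And>b. real_polynomial_function (\<lambda>x. D x b)"
    using real_polynomial_function_derivative[OF p] by blast
  have e: "(?e has_derivative (\<lambda>y. (- 2 * s * (x \<bullet> y)) * ?e x)) (at x)" for x
    unfolding power2_norm_eq_inner
    by (auto intro!: derivative_eq_intros simp: inner_commute algebra_simps)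
  have "(h has_derivative (\<lambda>y. p x * ((- 2 * s * (x \<bullet> y)) * ?e x) + D x y * ?e x)) (at x)" for x
    unfolding h by (rule has_derivative_mult[OF D(1) e])
  moreover have "(\<lambda>y. p x * ((- 2 * s * (x \<bullet> y)) * ?e x) + D x y * ?e x) =
     (\<lambda>y. ((- 2 * s) * (p x * (x \<bullet> y)) + D x y) * ?e x)" for x by (auto simp: algebra_simps)
  moreover have "real_polynomial_function (\<lambda>x. (- 2 * s) * (p x * (x \<bullet> b)) + D x b)" for b
    by (intro real_polynomial_function.intros p D bounded_linear_inner_left)
  ultimately show "\<exists>D. (\<forall>x. (h has_derivative D x) (at x)) \<and> (\<forall>b\<in>Basis. lincomb ?B (\<lambda>x. D x b))"
    by (intro exI[of _ "\<lambda>x y. ((- 2 * s) * (p x * (x \<bullet> y)) + D x y) * ?e x"]) (auto intro!: lincomb.base)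
  fix w :: "'v \<Rightarrow> real" assume "w \<in> schwartz_weights"
  then obtain k where w: "w = (\<lambda>x. (1 + norm x) ^ k)" by (auto simp: schwartz_weights_def)
  obtain C N where C: "C \<ge> 0" "\<And>x. \<bar>p x\<bar> \<le> C * (1 + norm x) ^ N" using real_polynomial_function_growth[OF p] by blast
  obtain K where K: "\<And>r. r \<ge> 0 \<Longrightarrow> (1 + r) ^ (k + N) * exp (- s * r\<^sup>2) \<le> K" using power_exp_bounded[OF s] by blast
  have "norm (w x *\<^sub>R h x) \<le> C * K" for x
  proof -
    have "norm (w x *\<^sub>R h x) = (1 + norm x) ^ k * \<bar>p x\<bar> * ?e x" by (simp add: w h abs_mult)
    also have "\<dots> \<le> (1 + norm x) ^ k * (C * (1 + norm x) ^ N) * ?e x"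
      by (intro mult_right_mono mult_left_mono C) auto
    also have "\<dots> = C * ((1 + norm x) ^ (k + N) * ?e x)" by (simp add: power_add)
    also have "\<dots> \<le> C * K" by (intro mult_left_mono K C) auto
    finally show ?thesis .
  qed
  then show "bounded (range (\<lambda>x. w x *\<^sub>R h x))" by (auto simp: bounded_iff)
qed

section \<open>Integration of rapidly decreasing functions\<close>

lemma integrable_inverse_1_plus_square_lborel: "integrable lborel (\<lambda>x::real. inverse (1 + x\<^sup>2))"
proof -
  have "einterval (-\<infinity>) \<infinity> = UNIV" by (auto simp: einterval_def)
  then show ?thesis
    using integrable_inverse_1_plus_square by (simp add: set_integrable_def)
qed

text \<open>Lebesgue measure on a Euclidean space is the image of the product of one-dimensional
  Lebesgue measures under the coordinate map, which reduces both claims to finite product measures.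
  They serve the majorant \<open>decay_weight\<close> and the Gaussian integral.\<close>

lemma
  fixes f :: "'v::euclidean_space \<Rightarrow> real \<Rightarrow> 'b::{real_normed_field,banach,second_countable_topology}"
  assumes f: "\<And>b. b \<in> Basis \<Longrightarrow> integrable lborel (f b)"
  shows integrable_prod_Basis: "integrable lborel (\<lambda>x::'v. \<Prod>b\<in>Basis. f b (x \<bullet> b))"
    and integral_prod_Basis:
      "(\<integral>x. (\<Prod>b\<in>Basis. f b (x \<bullet> b)) \<partial>lborel) = (\<Prod>b\<in>Basis. \<integral>t. f b t \<partial>lborel)"
proof -
  interpret product_sigma_finite "\<lambda>_::'v. lborel :: real measure" ..
  let ?M = "\<Pi>\<^sub>M b\<in>(Basis::'v set). (lborel :: real measure)"
  let ?T = "\<lambda>f. \<Sum>b\<in>(Basis::'v set). f b *\<^sub>R b"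
  have T[measurable]: "?T \<in> measurable ?M borel" by measurable
  have [measurable]: "f b \<in> borel_measurable borel" if "b \<in> Basis" for b
    using borel_measurable_integrable[OF f[OF that]] by simp
  have meas: "(\<lambda>x::'v. \<Prod>b\<in>Basis. f b (x \<bullet> b)) \<in> borel_measurable borel" by measurable
  have eq: "(\<Prod>b\<in>Basis. f b (?T g \<bullet> b)) = (\<Prod>b\<in>Basis. f b (g b))" for g
    by (intro prod.cong refl) (simp add: inner_sum_left inner_Basis if_distrib cong: if_cong)
  show "integrable lborel (\<lambda>x::'v. \<Prod>b\<in>Basis. f b (x \<bullet> b))"
    using product_integrable_prod[OF finite_Basis f, of "\<lambda>b. b"]
    by (subst lborel_eq, subst integrable_distr_eq[OF T meas]) (simp add: eq)
  show "(\<integral>x. (\<Prod>b\<in>Basis. f b (x \<bullet> b)) \<partial>lborel) = (\<Prod>b\<in>Basis. \<integral>t. f b t \<partial>lborel)"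
    using product_integral_prod[OF finite_Basis f, of "\<lambda>b. b"]
    by (subst lborel_eq[where 'a='v], subst integral_distr[OF T meas]) (simp add: eq)
qed

text \<open>The exponent provides two powers for each coordinate. Since
  \<open>(1 + norm x)\<^sup>2\<close> is at least \<open>1 + (x \<bullet> b)\<^sup>2\<close>, the
  weight lies below a product of integrable functions of one variable.\<close>

definition decay_weight :: "'v::euclidean_space \<Rightarrow> real" where
  "decay_weight x = inverse ((1 + norm x) ^ (2 * DIM('v)))"

lemma decay_weight_integrable: "integrable lborel (decay_weight :: 'v::euclidean_space \<Rightarrow> real)"
  unfolding decay_weight_def[abs_def]
proof (rule Bochner_Integration.integrable_bound)
  show "integrable lborel (\<lambda>x::'v. \<Prod>b\<in>Basis. inverse (1 + (x \<bullet> b)\<^sup>2))"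
    by (intro integrable_prod_Basis integrable_inverse_1_plus_square_lborel)
  have "inverse ((1 + norm x) ^ (2 * DIM('v))) \<le> (\<Prod>b\<in>Basis. inverse (1 + (x \<bullet> b)\<^sup>2))" for x :: 'v
  proof -
    have "inverse ((1 + norm x) ^ (2 * DIM('v))) = (\<Prod>b\<in>(Basis::'v set). inverse ((1 + norm x)\<^sup>2))"
      by (simp add: power_mult power_inverse)
    also have "\<dots> \<le> (\<Prod>b\<in>Basis. inverse (1 + (x \<bullet> b)\<^sup>2))"
    proof (intro prod_mono conjI le_imp_inverse_le)
      fix b :: 'v assume b: "b \<in> Basis"
      have "(x \<bullet> b)\<^sup>2 \<le> (norm x)\<^sup>2"
        using power_mono[OF Basis_le_norm[OF b, of x], of 2] by simp
      moreover have "(1 + norm x)\<^sup>2 = 1 + 2 * norm x + (norm x)\<^sup>2" by (simp add: power2_sum)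
      ultimately show "1 + (x \<bullet> b)\<^sup>2 \<le> (1 + norm x)\<^sup>2"
        using norm_ge_zero[of x] by linarith
    qed (auto intro: add_pos_nonneg)
    finally show ?thesis .
  qed
  then show "AE x::'v in lborel. norm (inverse ((1 + norm x) ^ (2 * DIM('v)))) \<le>
      norm (\<Prod>b\<in>Basis. inverse (1 + (x \<bullet> b)\<^sup>2))"
    by (intro AE_I2) (auto simp: prod_nonneg)
qed simp

lemma decay_weight_pos: "0 < decay_weight x"
  by (simp add: decay_weight_def add_pos_nonneg)

lemma le_decay_weightI:
  assumes "(1 + norm x) ^ (2 * DIM('v)) * r \<le> C"
  shows "r \<le> C * decay_weight (x::'v::euclidean_space)"
proof -
  have "(1 + norm x) ^ (2 * DIM('v)) > 0" by (simp add: add_pos_nonneg)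
  then show ?thesis using assms by (simp add: decay_weight_def field_simps)
qed

lemma integrable_decay:
  fixes f :: "'v::euclidean_space \<Rightarrow> 'b::{banach,second_countable_topology}"
  assumes "f \<in> borel_measurable borel" "\<And>x. norm (f x) \<le> C * decay_weight x"
  shows "integrable lborel f"
proof (rule Bochner_Integration.integrable_bound)
  show "integrable lborel (\<lambda>x::'v. C * decay_weight x)"
    by (intro integrable_mult_right decay_weight_integrable)
  show "AE x in lborel. norm (f x) \<le> norm (C * decay_weight x)"
    using assms(2) by (intro AE_I2) (metis abs_ge_self order_trans real_norm_def)
qed (use assms in auto)

section \<open>Changes of variables and integrability of Schwartz functions\<close>

lemma
  fixes f :: "'v::euclidean_space \<Rightarrow> 'b::{banach,second_countable_topology}"
  assumes f: "f \<in> borel_measurable borel"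
  shows integral_translate: "(\<integral>x. f (x + c) \<partial>lborel) = (\<integral>x. f x \<partial>lborel)"
    and integrable_translate: "integrable lborel (\<lambda>x. f (x + c)) \<longleftrightarrow> integrable lborel f"
proof -
  have T: "(+) c \<in> measurable lborel borel" by simp
  have "f \<in> borel_measurable borel" using f by simp
  then show "(\<integral>x. f (x + c) \<partial>lborel) = (\<integral>x. f x \<partial>lborel)"
    using integral_distr[OF T, of f] by (simp add: lborel_distr_plus add.commute)
  show "integrable lborel (\<lambda>x. f (x + c)) \<longleftrightarrow> integrable lborel f"
    using integrable_distr_eq[OF T, of f] f by (simp add: lborel_distr_plus add.commute)
qed

lemma integral_scale:
  fixes f :: "'v::euclidean_space \<Rightarrow> 'b::{banach,second_countable_topology}"
  assumes f: "f \<in> borel_measurable borel" and c: "c \<noteq> 0"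
  shows "(\<integral>x. f x \<partial>lborel) = \<bar>c\<bar> ^ DIM('v) *\<^sub>R (\<integral>x. f (c *\<^sub>R x) \<partial>lborel)"
proof -
  have [measurable]: "f \<in> borel_measurable borel" by fact
  have "(\<integral>x. f x \<partial>lborel) =
      (\<integral>x. f x \<partial>density (distr lborel borel (\<lambda>x. 0 + c *\<^sub>R x)) (\<lambda>_. ennreal (\<bar>c\<bar> ^ DIM('v))))"
    using lborel_affine[OF c, of "0::'v"] by (simp add: ennreal_power)
  also have "\<dots> = (\<integral>x. \<bar>c\<bar> ^ DIM('v) *\<^sub>R f x \<partial>distr lborel borel (\<lambda>x. 0 + c *\<^sub>R x))"
    by (subst integral_density) auto
  also have "\<dots> = (\<integral>x. \<bar>c\<bar> ^ DIM('v) *\<^sub>R f (c *\<^sub>R x) \<partial>lborel)"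
    by (subst integral_distr) auto
  finally show ?thesis by simp
qed

lemma integral_reflect:
  fixes f :: "'v::euclidean_space \<Rightarrow> 'b::{banach,second_countable_topology}"
  assumes f: "f \<in> borel_measurable borel"
  shows "(\<integral>x. f (- x) \<partial>lborel) = (\<integral>x. f x \<partial>lborel)"
  using integral_scale[OF f, of "-1"] by simp

lemma smooth_continuous: "smooth f \<Longrightarrow> continuous_on UNIV f"
  by (auto intro!: continuous_at_imp_continuous_on has_derivative_continuous smooth_has_derivative)

lemma smooth_measurable: "smooth f \<Longrightarrow> f \<in> borel_measurable borel"
  by (intro borel_measurable_continuous_onI smooth_continuous)

lemma schwartz_smooth: "f \<in> schwartz \<Longrightarrow> smooth f"
  by (simp add: schwartz_def)

lemma CB_infinity_smooth: "f \<in> CB_infinity \<Longrightarrow> smooth f"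
  by (simp add: CB_infinity_def)

lemma schwartz_decay:
  assumes "f \<in> schwartz" shows "\<exists>C. \<forall>x. (1 + norm x) ^ k * norm (f x) \<le> C"
proof -
  have "(\<lambda>x. (1 + norm x) ^ k) \<in> (schwartz_weights :: ('a \<Rightarrow> real) set)" by (auto simp: schwartz_weights_def)
  from weighted_smooth_bounded[OF _ this] assms
  have "bounded (range (\<lambda>x. (1 + norm x) ^ k *\<^sub>R f x))" by (auto simp: schwartz_eq_weighted)
  then show ?thesis by (auto simp: bounded_iff)
qed

lemma schwartz_decay_weight:
  fixes f :: "'v::euclidean_space \<Rightarrow> 'b::real_normed_vector"
  assumes "f \<in> schwartz" shows "\<exists>C\<ge>0. \<forall>x. norm (f x) \<le> C * decay_weight x"
proof -
  obtain C where C: "\<And>x. (1 + norm x) ^ (2 * DIM('v)) * norm (f x) \<le> C"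
    using schwartz_decay[OF assms] by blast
  then have "C \<ge> 0" by (rule order_trans[rotated]) simp
  with C show ?thesis using le_decay_weightI by blast
qed

lemma schwartz_integrable:
  fixes f :: "'v::euclidean_space \<Rightarrow> 'b::{banach,second_countable_topology}"
  shows "f \<in> schwartz \<Longrightarrow> integrable lborel f"
  using schwartz_decay_weight[of f] smooth_measurable[OF schwartz_smooth, of f] integrable_decay by blast

lemma CB_infinity_bounded: "f \<in> CB_infinity \<Longrightarrow> \<exists>C\<ge>0. \<forall>x. norm (f x) \<le> C"
proof -
  assume "f \<in> CB_infinity"
  then have "bounded (range (\<lambda>x. 1 *\<^sub>R f x))"
    unfolding CB_infinity_eq_weighted by (rule weighted_smooth_bounded) auto
  then show ?thesis by (auto simp: bounded_iff intro: order_trans[OF norm_ge_zero])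
qed

lemma schwartz_partial: "f \<in> schwartz \<Longrightarrow> b \<in> Basis \<Longrightarrow> partial b f \<in> schwartz"
  unfolding schwartz_eq_weighted by (rule weighted_smooth_partial)

lemma CB_infinity_partial: "f \<in> CB_infinity \<Longrightarrow> b \<in> Basis \<Longrightarrow> partial b f \<in> CB_infinity"
  unfolding CB_infinity_eq_weighted by (rule weighted_smooth_partial)

lemma one_plus_le_twice: "n \<le> m + 1 \<Longrightarrow> 0 \<le> m \<Longrightarrow> 1 + n \<le> 2 * (1 + m)" for n m :: real
  by simp

text \<open>By translation invariance the difference quotients of \<open>f\<close> have integral \<open>0\<close>; they converge
  dominatedly to the derivative.\<close>

lemma integral_derivative_eq_0:
  fixes f :: "'v::euclidean_space \<Rightarrow> 'b::{banach,second_countable_topology}"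
  assumes D: "\<And>x. (f has_derivative D x) (at x)" and int: "integrable lborel f"
    and b: "norm b \<le> 1"
    and C: "\<And>x. norm (D x b) \<le> C * decay_weight x"
    and meas: "(\<lambda>x. D x b) \<in> borel_measurable borel"
  shows "(\<integral>x. D x b \<partial>lborel) = 0"
proof -
  define t where "t n = inverse (real (Suc n))" for n
  have t: "0 < t n" "t n \<le> 1" for n by (auto simp: t_def field_simps)
  have t0: "t \<longlonglongrightarrow> 0" unfolding t_def by (rule LIMSEQ_inverse_real_of_nat)
  define g where "g n x = inverse (t n) *\<^sub>R (f (x + t n *\<^sub>R b) - f x)" for n x
  have cont: "continuous_on UNIV f"
    using D by (auto intro!: continuous_at_imp_continuous_on has_derivative_continuous)
  note [measurable] = borel_measurable_continuous_onI[OF cont]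
  have C0: "C \<ge> 0" using order_trans[OF norm_ge_zero C] decay_weight_pos[of "0::'v"]
    by (metis zero_le_mult_iff less_imp_le not_less)
  have seg: "((\<lambda>s. f (x + s *\<^sub>R b)) has_vector_derivative D (x + s *\<^sub>R b) b) (at s)" for x s
  proof -
    have "((\<lambda>s. x + s *\<^sub>R b) has_derivative (\<lambda>s. s *\<^sub>R b)) (at s)"
      by (auto intro!: derivative_eq_intros)
    from has_derivative_compose[OF this D] show ?thesis
      using linear_cmul[OF has_derivative_linear[OF D]] by (simp add: has_vector_derivative_def)
  qed
  have lim: "(\<lambda>n. g n x) \<longlonglongrightarrow> D x b" for x
  proof -
    have "((\<lambda>s. inverse s *\<^sub>R (f (x + s *\<^sub>R b) - f x)) \<longlongrightarrow> D x b) (at 0)"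
    proof (rule LIM_zero_cancel, rule tendsto_norm_zero_cancel, rule Lim_transform_eventually)
      show "((\<lambda>s. norm (f (x + s *\<^sub>R b) - f x - s *\<^sub>R D x b) / norm s) \<longlongrightarrow> 0) (at 0)"
        using seg[of x 0] by (simp add: has_vector_derivative_def has_derivative_at)
      have "norm (f (x + s *\<^sub>R b) - f x - s *\<^sub>R D x b) / norm s =
          norm (inverse s *\<^sub>R (f (x + s *\<^sub>R b) - f x) - D x b)" if "s \<noteq> 0" for s
      proof -
        have "inverse s *\<^sub>R (f (x + s *\<^sub>R b) - f x) - D x b =
            inverse s *\<^sub>R (f (x + s *\<^sub>R b) - f x - s *\<^sub>R D x b)"
          using that by (simp add: scaleR_diff_right)
        then show ?thesis by (simp add: divide_inverse mult.commute)
      qed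
      then show "\<forall>\<^sub>F s in at 0. norm (f (x + s *\<^sub>R b) - f x - s *\<^sub>R D x b) / norm s =
          norm (inverse s *\<^sub>R (f (x + s *\<^sub>R b) - f x) - D x b)"
        by (auto simp: eventually_at_filter)
    qed
    moreover have "filterlim t (at 0) sequentially"
      using t0 t(1) by (auto simp: filterlim_at intro!: always_eventually) (metis less_irrefl)
    ultimately show ?thesis unfolding g_def by (rule filterlim_compose)
  qed
  \<comment> \<open>The segment from \<open>x\<close> to \<open>x + t n *\<^sub>R b\<close> has
    length at most 1. Along it \<open>1 + norm\<close> changes by a factor of at most 2, hence
    \<open>decay_weight\<close> by at most \<open>2 ^ (2 * DIM('v))\<close>, and the mean value
    inequality gives one majorant for all difference quotients.\<close>
  have bound: "norm (g n x) \<le> C * 2 ^ (2 * DIM('v)) * decay_weight x" for n x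
  proof -
    let ?B = "C * 2 ^ (2 * DIM('v)) * decay_weight x"
    have "norm (f (x + t n *\<^sub>R b) - f (x + 0 *\<^sub>R b)) \<le> ?B * t n - ?B * 0"
    proof (rule differentiable_bound_general[OF t(1) _ _ seg])
      show "continuous_on {0..t n} (\<lambda>s. f (x + s *\<^sub>R b))"
        by (intro continuous_on_compose2[OF cont] continuous_intros) auto
      show "((*) ?B has_vector_derivative ?B) (at s)" for s
        by (auto intro!: derivative_eq_intros simp: has_vector_derivative_def)
      fix s assume s: "0 < s" "s < t n"
      have "norm x = norm ((x + s *\<^sub>R b) - s *\<^sub>R b)" by simp
      also have "\<dots> \<le> norm (x + s *\<^sub>R b) + norm (s *\<^sub>R b)" by (rule norm_triangle_ineq4)
      finally have "norm x \<le> norm (x + s *\<^sub>R b) + norm (s *\<^sub>R b)" .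
      moreover have "norm (s *\<^sub>R b) \<le> 1" using s t(2)[of n] b by (simp add: mult_le_one)
      ultimately have "norm x \<le> norm (x + s *\<^sub>R b) + 1" by (rule order_trans[OF _ add_left_mono])
      then have "1 + norm x \<le> 2 * (1 + norm (x + s *\<^sub>R b))"
        using norm_ge_zero by (rule one_plus_le_twice)
      then have "(1 + norm x) ^ (2 * DIM('v)) \<le> (2 * (1 + norm (x + s *\<^sub>R b))) ^ (2 * DIM('v))"
        by (intro power_mono) auto
      then have "(1 + norm x) ^ (2 * DIM('v)) \<le> 2 ^ (2 * DIM('v)) * (1 + norm (x + s *\<^sub>R b)) ^ (2 * DIM('v))"
        unfolding power_mult_distrib .
      moreover have "0 < (1 + norm x) ^ (2 * DIM('v))" "0 < (1 + norm (x + s *\<^sub>R b)) ^ (2 * DIM('v))"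
        by (auto intro!: zero_less_power add_pos_nonneg)
      ultimately have "decay_weight (x + s *\<^sub>R b) \<le> 2 ^ (2 * DIM('v)) * decay_weight x"
        by (simp add: decay_weight_def field_simps)
      then have "C * decay_weight (x + s *\<^sub>R b) \<le> C * (2 ^ (2 * DIM('v)) * decay_weight x)"
        using C0 by (intro mult_left_mono)
      then show "norm (D (x + s *\<^sub>R b) b) \<le> ?B"
        using C[of "x + s *\<^sub>R b"] by (simp add: mult.assoc)
    qed (intro continuous_intros)
    then have "norm (f (x + t n *\<^sub>R b) - f x) \<le> ?B * t n" by simp
    then have "inverse (t n) * norm (f (x + t n *\<^sub>R b) - f x) \<le> inverse (t n) * (?B * t n)"
      using t(1)[of n] by (intro mult_left_mono) auto
    moreover have "inverse (t n) * (?B * t n) = ?B" using t(1)[of n] by simp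
    ultimately show ?thesis using t(1)[of n] by (simp add: g_def)
  qed
  have zero: "(\<integral>x. g n x \<partial>lborel) = 0" for n
    unfolding g_def using int integrable_translate[of f "t n *\<^sub>R b"] integral_translate[of f "t n *\<^sub>R b"]
    by simp
  have "(\<lambda>n. \<integral>x. g n x \<partial>lborel) \<longlonglongrightarrow> (\<integral>x. D x b \<partial>lborel)"
  proof (rule integral_dominated_convergence[where w="\<lambda>x. C * 2 ^ (2 * DIM('v)) * decay_weight x"])
    show "integrable lborel (\<lambda>x::'v. C * 2 ^ (2 * DIM('v)) * decay_weight x)"
      by (intro integrable_mult_right decay_weight_integrable)
    show "g n \<in> borel_measurable lborel" for n unfolding g_def by measurable
  qed (use lim bound meas in auto)
  then show ?thesis by (simp add: zero LIMSEQ_const_iff)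
qed

text \<open>With a majorant that splits into a product, the hypotheses of Fubini's theorem reduce to
  one-variable integrals. It justifies the exchanges of integration in \<open>ip_kernel_form\<close>
  and \<open>has_osc_integral_double\<close>.\<close>

lemma integrable_product_bound:
  fixes h :: "'u::euclidean_space \<times> 'v::euclidean_space \<Rightarrow> 'b::{banach,second_countable_topology}"
  assumes h: "h \<in> borel_measurable borel" and a: "integrable lborel a" and b: "integrable lborel b"
    and bound: "\<And>x y. norm (h (x, y)) \<le> a x * b y"
  shows "integrable (lborel \<Otimes>\<^sub>M lborel) h"
proof (rule lborel_pair.Fubini_integrable)
  have [measurable]: "h \<in> borel_measurable (lborel \<Otimes>\<^sub>M lborel)"
    using h by (simp add: lborel_prod)
  then show "h \<in> borel_measurable (lborel \<Otimes>\<^sub>M lborel)" .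
  have [measurable]: "h \<in> borel_measurable (borel \<Otimes>\<^sub>M borel)" using h by (simp add: borel_prod)
  have int: "integrable lborel (\<lambda>y. h (x, y))" for x
  proof (rule Bochner_Integration.integrable_bound)
    show "integrable lborel (\<lambda>y. a x * b y)" using b by simp
    show "AE y in lborel. norm (h (x, y)) \<le> norm (a x * b y)"
      by (intro AE_I2 order_trans[OF bound]) auto
  qed simp
  then show "AE x in lborel. integrable lborel (\<lambda>y. h (x, y))" by simp
  show "integrable lborel (\<lambda>x. \<integral>y. norm (h (x, y)) \<partial>lborel)"
  proof (rule Bochner_Integration.integrable_bound)
    show "integrable lborel (\<lambda>x. a x * (\<integral>y. b y \<partial>lborel))" using a by simp
    have "(\<integral>y. norm (h (x, y)) \<partial>lborel) \<le> (\<integral>y. a x * b y \<partial>lborel)" for x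
      using b int by (intro integral_mono bound) auto
    then have "\<bar>\<integral>y. norm (h (x, y)) \<partial>lborel\<bar> \<le> \<bar>a x * (\<integral>y. b y \<partial>lborel)\<bar>" for x
      by (subst abs_of_nonneg) (auto intro!: order_trans[OF _ abs_ge_self])
    then show "AE x in lborel. norm (\<integral>y. norm (h (x, y)) \<partial>lborel) \<le> norm (a x * (\<integral>y. b y \<partial>lborel))"
      by auto
  qed measurable
qed

section \<open>The Fourier transform of a Gaussian\<close>

text \<open>This is the characteristic function of the standard normal distribution, freed from the
  normalization of its density.\<close>

lemma integral_gaussian_cis_real:
  "(\<integral>x. cis (t * x) * of_real (exp (- x\<^sup>2 / 2)) \<partial>lborel) = sqrt (2 * pi) * exp (- t\<^sup>2 / 2)"
proof -
  have "complex_of_real (exp (- (t^2) / 2)) = char std_normal_distribution t"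
    by (simp add: char_std_normal_distribution)
  also have "\<dots> = (\<integral>x. std_normal_density x *\<^sub>R iexp (t * x) \<partial>lborel)"
    unfolding char_def by (subst integral_density) auto
  also have "\<dots> = (\<integral>x. inverse (complex_of_real (sqrt (2 * pi))) * (cis (t * x) * of_real (exp (- x\<^sup>2 / 2))) \<partial>lborel)"
    by (intro Bochner_Integration.integral_cong)
      (auto simp: std_normal_density_def scaleR_conv_of_real cis_conv_exp field_simps)
  also have "\<dots> = inverse (complex_of_real (sqrt (2 * pi))) * (\<integral>x. cis (t * x) * of_real (exp (- x\<^sup>2 / 2)) \<partial>lborel)"
    by simp
  finally show ?thesis by (simp add: field_simps)
qed

lemma integrable_gaussian_cis_real:
  "integrable lborel (\<lambda>x::real. cis (t * x) * of_real (exp (- x\<^sup>2 / 2)))"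
proof (rule Bochner_Integration.integrable_bound)
  show "integrable lborel (\<lambda>x::real. sqrt (2 * pi) * std_normal_density x)"
    by (intro integrable_mult_right integrable_normal_density) auto
qed (auto simp: norm_mult std_normal_density_def intro!: borel_measurable_continuous_onI continuous_intros)

text \<open>Both the plane wave and the Gaussian are products over the coordinates, so the integral
  is a product of one-dimensional ones.\<close>

lemma integral_gaussian_cis:
  fixes u :: "'v::euclidean_space"
  shows "(\<integral>y. cis (u \<bullet> y) * of_real (exp (- (norm y)\<^sup>2 / 2)) \<partial>lborel) =
    sqrt (2 * pi) ^ DIM('v) * exp (- (norm u)\<^sup>2 / 2)"
proof -
  have nrm: "(norm y)\<^sup>2 = (\<Sum>b\<in>Basis. (y \<bullet> b)\<^sup>2)" for y :: 'v
    by (subst power2_norm_eq_inner, subst euclidean_inner) (simp add: power2_eq_square)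
  have e: "exp (- (norm y)\<^sup>2 / 2) = (\<Prod>b\<in>Basis. exp (- (y \<bullet> b)\<^sup>2 / 2))" for y :: 'v
    unfolding nrm by (simp add: exp_sum[symmetric] sum_negf sum_divide_distrib)
  have c: "cis (u \<bullet> y) = (\<Prod>b\<in>Basis. cis ((u \<bullet> b) * (y \<bullet> b)))" for y :: 'v
    unfolding euclidean_inner[of u y] cis_conv_exp by (simp add: exp_sum[symmetric] sum_distrib_left)
  have "(\<integral>y. cis (u \<bullet> y) * of_real (exp (- (norm y)\<^sup>2 / 2)) \<partial>lborel) =
    (\<integral>y. (\<Prod>b\<in>Basis. cis ((u \<bullet> b) * (y \<bullet> b)) * complex_of_real (exp (- (y \<bullet> b)\<^sup>2 / 2))) \<partial>lborel)"
    unfolding e c by (simp add: prod.distrib)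
  also have "\<dots> = (\<Prod>b\<in>Basis. \<integral>x. cis ((u \<bullet> b) * x) * complex_of_real (exp (- x\<^sup>2 / 2)) \<partial>lborel)"
    using integrable_gaussian_cis_real
    by (intro integral_prod_Basis[where f="\<lambda>b x. cis ((u \<bullet> b) * x) * complex_of_real (exp (- x\<^sup>2 / 2))"])
  also have "\<dots> = (\<Prod>b\<in>(Basis :: 'v set). complex_of_real (sqrt (2 * pi) * exp (- (u \<bullet> b)\<^sup>2 / 2)))"
    unfolding integral_gaussian_cis_real ..
  also have "\<dots> = complex_of_real (sqrt (2 * pi) ^ DIM('v) * exp (- (norm u)\<^sup>2 / 2))"
    unfolding e by (simp add: prod.distrib)
  finally show ?thesis .
qed

section \<open>\<open>C\<close>*-algebras and Hilbert modules\<close>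

lemma scaleR_scaleC: "r *\<^sub>R (c *\<^sub>C x) = (of_real r * c) *\<^sub>C (x::'a::complex_normed_vector)"
  by (metis scaleC_of_real scaleC_scaleC)

lemma bounded_bilinear_scaleC:
  "bounded_bilinear (scaleC :: complex \<Rightarrow> 'a \<Rightarrow> 'a::complex_normed_vector)"
proof
  fix c :: complex and x :: 'a and r :: real
  show "(r *\<^sub>R c) *\<^sub>C x = r *\<^sub>R (c *\<^sub>C x)"
    by (simp add: scaleR_scaleC scaleR_conv_of_real)
  have "c *\<^sub>C (r *\<^sub>R x) = (c * of_real r) *\<^sub>C x"
    by (metis scaleC_of_real scaleC_scaleC)
  then show "c *\<^sub>C (r *\<^sub>R x) = r *\<^sub>R (c *\<^sub>C x)"
    by (simp add: scaleR_scaleC mult.commute)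
  show "\<exists>K. \<forall>(a::complex) b::'a. norm (a *\<^sub>C b) \<le> norm a * norm b * K"
    by (intro exI[of _ 1]) (simp add: norm_scaleC)
qed (auto simp: scaleC_add_left scaleC_add_right)

interpretation scaleC: bounded_bilinear scaleC
  by (rule bounded_bilinear_scaleC)

lemma scaleC_one [simp]: "1 *\<^sub>C x = x"
  using scaleC_of_real[of 1 x] by simp

declare scaleC.zero_left [simp] scaleC.zero_right [simp]

text \<open>No integrability is asked of \<open>f\<close>: for nonzero \<open>c\<close> the scaling
  is invertible, so both integrands are integrable or neither is, and in the latter case both
  integrals take the default value 0.\<close>

lemma integral_scaleC_right:
  fixes f :: "'b \<Rightarrow> 'a::{complex_normed_vector,banach,second_countable_topology}"
  shows "(\<integral>x. c *\<^sub>C f x \<partial>M) = c *\<^sub>C (\<integral>x. f x \<partial>M)"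
proof (cases "c = 0")
  case False
  have *: "f x = inverse c *\<^sub>C (c *\<^sub>C f x)" for x using False by (simp add: scaleC_scaleC)
  have "integrable M f \<longleftrightarrow> integrable M (\<lambda>x. c *\<^sub>C f x)"
    using integrable_bounded_linear[OF scaleC.bounded_linear_right, of M f c]
      integrable_bounded_linear[OF scaleC.bounded_linear_right, of M "\<lambda>x. c *\<^sub>C f x" "inverse c"]
    unfolding *[symmetric] by blast
  then show ?thesis
    using integral_bounded_linear[OF scaleC.bounded_linear_right, of M f c]
    by (cases "integrable M f") (auto simp: not_integrable_integral_eq)
qed simp

lemma integral_scaleC_left:
  fixes a :: "'a::{complex_normed_vector,banach,second_countable_topology}"
  assumes "integrable M f"
  shows "(\<integral>x. f x *\<^sub>C a \<partial>M) = (\<integral>x. f x \<partial>M) *\<^sub>C a"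
  by (rule integral_bounded_linear[OF scaleC.bounded_linear_left assms])

lemma star_scaleR: "star (r *\<^sub>R a) = r *\<^sub>R star (a::'a::cstar_algebra)"
  by (metis complex_cnj_complex_of_real scaleC_of_real star_scaleC)

text \<open>The C*-identity and submultiplicativity bound the norm of \<open>a\<close> by that of
  \<open>star a\<close>; applying this to \<open>star a\<close> as well gives equality.\<close>

lemma norm_star [simp]: "norm (star a) = norm (a::'a::cstar_algebra)"
proof -
  have *: "norm a \<le> norm (star a)" for a :: 'a
  proof (cases "a = 0")
    case False
    have "(norm a)\<^sup>2 \<le> norm (star a) * norm a"
      using norm_mult_ineq[of "star a" a] by (simp add: cstar_identity)
    then show ?thesis using False by (simp add: power2_eq_square)
  qed simp
  from *[of a] *[of "star a"] show ?thesis by (simp add: star_star)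
qed

lemma bounded_linear_star: "bounded_linear (star :: 'a::cstar_algebra \<Rightarrow> 'a)"
  by (rule bounded_linear_intro[where K=1]) (auto simp: star_add star_scaleR)

text \<open>In an algebra that may have no unit, an element is tested by multiplying it with its own
  adjoint. This is how commutator matrix elements will be shown to vanish.\<close>

lemma eq_0_if_mult_star:
  assumes "a * star a = 0" shows "a = (0::'a::cstar_algebra)"
  using assms cstar_identity[of "star a"] by (simp add: star_star)

section \<open>The inner product of a Hilbert module\<close>

context hilbert_module
begin

lemma ip_add_left: "ip (x + y) z = ip x z + ip y z"
  by (metis ip_star ip_add_right star_add)

lemma ip_scaleC_left: "ip (c *\<^sub>C x) y = cnj c *\<^sub>C ip x y"
  by (metis ip_star ip_scaleC_right star_scaleC)

lemma ip_scaleR_right: "ip x (r *\<^sub>R y) = r *\<^sub>R ip x y"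
  by (metis ip_scaleC_right scaleC_of_real)

lemma ip_scaleR_left: "ip (r *\<^sub>R x) y = r *\<^sub>R ip x y"
  by (metis ip_scaleC_left scaleC_of_real complex_cnj_complex_of_real)

lemma norm_ip_self: "norm (ip x x) = (norm x)\<^sup>2"
  by (simp add: norm_ip)

text \<open>A Cauchy-Schwarz inequality with a non-optimal constant, by polarization; this needs only
  the triangle inequality for the norm of \<open>E\<close> and no order on the \<open>C\<close>*-algebra.\<close>

lemma norm_ip_le: "norm (ip x y) \<le> 4 * (norm x * norm y)"
proof -
  have unit: "norm (ip x y) \<le> 4" if "norm x = 1" "norm y = 1" for x y
  proof -
    \<comment> \<open>Polarization over the four fourth roots of unity; the inner product is
      antilinear in its first argument. For unit vectors each of the four terms has norm at most (1
      + 1)^2 = 4, so the whole is at most 16.\<close>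
    have pol: "4 *\<^sub>C ip x y = (ip (x + y) (x + y) + (-1) *\<^sub>C ip (x + (-1) *\<^sub>C y) (x + (-1) *\<^sub>C y))
      + ((- \<i>) *\<^sub>C ip (x + \<i> *\<^sub>C y) (x + \<i> *\<^sub>C y) + \<i> *\<^sub>C ip (x + (-\<i>) *\<^sub>C y) (x + (-\<i>) *\<^sub>C y))"
    proof -
      have 4: "(4::complex) = 1 + 1 + 1 + 1" by simp
      show ?thesis
        unfolding 4
        by (simp only: ip_add_left ip_add_right ip_scaleC_left ip_scaleC_right scaleC_add_right
            scaleC_scaleC scaleC_add_left) (simp add: scaleC.minus_left)
    qed
    have b: "norm (c *\<^sub>C ip (x + d *\<^sub>C y) (x + d *\<^sub>C y)) \<le> 4" if "cmod c = 1" "cmod d = 1" for c d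
    proof -
      have "norm (x + d *\<^sub>C y) \<le> norm x + norm (d *\<^sub>C y)" by (rule norm_triangle_ineq)
      also have "\<dots> = 2" using that \<open>norm x = 1\<close> \<open>norm y = 1\<close> by (simp add: norm_scaleC)
      finally have "(norm (x + d *\<^sub>C y))\<^sup>2 \<le> 2\<^sup>2" by (intro power_mono) auto
      then show ?thesis using that by (simp add: norm_scaleC norm_ip_self)
    qed
    have "4 * norm (ip x y) = norm (4 *\<^sub>C ip x y)" by (simp add: norm_scaleC)
    also have "\<dots> \<le> (4 + 4) + (4 + 4)"
      unfolding pol using b[of 1 1] b[of "-1" "-1"] b[of "-\<i>" \<i>] b[of \<i> "-\<i>"]
      by (intro norm_triangle_mono) (simp_all only: scaleC_one norm_one norm_minus_cancel norm_ii)
    finally show ?thesis by simp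
  qed
  show ?thesis
  proof (cases "x = 0 \<or> y = 0")
    case True
    then show ?thesis using ip_scaleR_left[of 0 x y] ip_scaleR_right[of x 0 y] by auto
  next
    case False
    then have "norm (ip (inverse (norm x) *\<^sub>R x) (inverse (norm y) *\<^sub>R y)) \<le> 4"
      by (intro unit) auto
    then have "inverse (norm x) * (inverse (norm y) * norm (ip x y)) \<le> 4"
      by (simp add: ip_scaleR_left ip_scaleR_right mult_ac)
    then show ?thesis using False by (simp add: field_simps)
  qed
qed

lemma bounded_bilinear_ip: "bounded_bilinear ip"
proof
  show "\<exists>K. \<forall>a b. norm (ip a b) \<le> norm a * norm b * K"
    using norm_ip_le by (intro exI[of _ 4]) (simp add: mult.commute mult.left_commute)
qed (auto simp: ip_add_left ip_add_right ip_scaleR_left ip_scaleR_right)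

sublocale ip: bounded_bilinear ip
  by (rule bounded_bilinear_ip)

lemma eq_if_ip_eq:
  assumes "\<And>y. ip y x = ip y z" shows "x = z"
proof -
  have "ip (x - z) (x - z) = 0" using assms[of "x - z"] by (simp add: ip.diff_right)
  then show ?thesis using norm_ip_self[of "x - z"] by simp
qed

end

text \<open>Bounded operators on a dense subset are indexed by an arbitrary type through \<open>\<iota>\<close>, because
  an element of the completion need not determine its preimage.\<close>

lemma blinfun_extension:
  fixes \<iota> :: "'f \<Rightarrow> 'e::banach" and P :: "'f \<Rightarrow> 'f" and S :: "'f set"
  assumes dense: "closure (\<iota> ` S) = UNIV"
    and add: "\<And>f g. f \<in> S \<Longrightarrow> g \<in> S \<Longrightarrow> \<exists>h\<in>S. \<iota> h = \<iota> f + \<iota> g \<and> \<iota> (P h) = \<iota> (P f) + \<iota> (P g)"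
    and scale: "\<And>f r. f \<in> S \<Longrightarrow> \<exists>h\<in>S. \<iota> h = r *\<^sub>R \<iota> f \<and> \<iota> (P h) = r *\<^sub>R \<iota> (P f)"
    and bound: "\<And>f. f \<in> S \<Longrightarrow> norm (\<iota> (P f)) \<le> C * norm (\<iota> f)"
  shows "\<exists>V :: 'e \<Rightarrow>\<^sub>L 'e. \<forall>f\<in>S. V (\<iota> f) = \<iota> (P f)"
proof -
  \<comment> \<open>This estimate does double duty: it makes the value \<open>\<iota> (P f)\<close>
    depend on \<open>\<iota> f\<close> only, and it makes the induced map Lipschitz on the dense
    image. The absolute value is there because a Lipschitz constant must be nonnegative.\<close>
  have diff: "norm (\<iota> (P f) - \<iota> (P g)) \<le> \<bar>C\<bar> * norm (\<iota> f - \<iota> g)" if fg: "f \<in> S" "g \<in> S" for f g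
  proof -
    obtain g' where g': "g' \<in> S" "\<iota> g' = (-1) *\<^sub>R \<iota> g" "\<iota> (P g') = (-1) *\<^sub>R \<iota> (P g)"
      using scale[OF fg(2)] by blast
    obtain h where h: "h \<in> S" "\<iota> h = \<iota> f + \<iota> g'" "\<iota> (P h) = \<iota> (P f) + \<iota> (P g')"
      using add[OF fg(1) g'(1)] by blast
    have "norm (\<iota> (P h)) \<le> C * norm (\<iota> h)" by (rule bound[OF h(1)])
    also have "\<dots> \<le> \<bar>C\<bar> * norm (\<iota> h)" by (intro mult_right_mono) auto
    finally show ?thesis using g' h by simp
  qed
  define p where "p x = \<iota> (P (SOME f. f \<in> S \<and> \<iota> f = x))" for x
  have p: "p (\<iota> f) = \<iota> (P f)" if "f \<in> S" for f
  proof -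
    let ?g = "SOME g. g \<in> S \<and> \<iota> g = \<iota> f"
    have "?g \<in> S \<and> \<iota> ?g = \<iota> f" by (rule someI[of _ f]) (use that in auto)
    then show ?thesis using diff[of ?g f] that by (simp add: p_def)
  qed
  have "\<bar>C\<bar>-lipschitz_on (\<iota> ` S) p"
    by (rule lipschitz_onI) (auto simp: p dist_norm diff)
  then have "uniformly_continuous_on (\<iota> ` S) p" by (rule lipschitz_on_uniformly_continuous)
  then obtain g where g: "uniformly_continuous_on UNIV g" "\<And>x. x \<in> \<iota> ` S \<Longrightarrow> p x = g x"
    using uniformly_continuous_on_extension_on_closure[of "\<iota> ` S" p] dense by metis
  have cont: "continuous_on UNIV g" by (rule uniformly_continuous_imp_continuous[OF g(1)])
  have g\<iota>: "g (\<iota> f) = \<iota> (P f)" if "f \<in> S" for f using g(2)[of "\<iota> f"] p[OF that] that by auto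
  note contI = continuous_on_compose2[OF cont]
  have dense_all: "Q x" if "closed {x. Q x}" "\<And>f. f \<in> S \<Longrightarrow> Q (\<iota> f)" for Q x
  proof -
    have "closure (\<iota> ` S) \<subseteq> {x. Q x}" using that by (intro closure_minimal) auto
    then show ?thesis using dense by auto
  qed
  \<comment> \<open>Additivity is a closed condition in each variable separately, so density is used
    twice, once for each summand.\<close>
  have gadd: "g (x + y) = g x + g y" for x y
  proof (rule dense_all[where Q="\<lambda>x. g (x + y) = g x + g y"])
    show "closed {x. g (x + y) = g x + g y}"
      by (intro closed_Collect_eq continuous_intros contI) auto
    show "g (\<iota> f + y) = g (\<iota> f) + g y" if f: "f \<in> S" for f
    proof (rule dense_all[where Q="\<lambda>y. g (\<iota> f + y) = g (\<iota> f) + g y"])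
      show "closed {y. g (\<iota> f + y) = g (\<iota> f) + g y}"
        by (intro closed_Collect_eq continuous_intros contI) auto
      show "g (\<iota> f + \<iota> h) = g (\<iota> f) + g (\<iota> h)" if "h \<in> S" for h
        using add[OF f that] g\<iota> f that by metis
    qed
  qed
  have gscale: "g (r *\<^sub>R x) = r *\<^sub>R g x" for r x
  proof (rule dense_all[where Q="\<lambda>x. g (r *\<^sub>R x) = r *\<^sub>R g x"])
    show "closed {x. g (r *\<^sub>R x) = r *\<^sub>R g x}"
      by (intro closed_Collect_eq continuous_intros contI) auto
    show "g (r *\<^sub>R \<iota> f) = r *\<^sub>R g (\<iota> f)" if "f \<in> S" for f
      using scale[OF that, of r] g\<iota> that by metis
  qed
  have gbound: "norm (g x) \<le> norm x * C" for x
  proof (rule dense_all[where Q="\<lambda>x. norm (g x) \<le> norm x * C"])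
    show "closed {x. norm (g x) \<le> norm x * C}"
      by (intro closed_Collect_le continuous_intros contI) auto
    show "norm (g (\<iota> f)) \<le> norm (\<iota> f) * C" if "f \<in> S" for f
      using bound[OF that] g\<iota>[OF that] by (simp add: mult.commute)
  qed
  have "bounded_linear g" by (rule bounded_linear_intro[OF gadd gscale gbound])
  then have "\<forall>f\<in>S. Blinfun g (\<iota> f) = \<iota> (P f)" by (simp add: bounded_linear_Blinfun_apply g\<iota>)
  then show ?thesis by blast
qed

section \<open>Inverses and density arguments\<close>

lemma op_inverse_eq: "W o\<^sub>L U = id_blinfun \<Longrightarrow> U o\<^sub>L W = id_blinfun \<Longrightarrow> op_inverse U = W"
  unfolding op_inverse_def
proof (rule the_equality)
  fix W' assume WU: "W o\<^sub>L U = id_blinfun" "U o\<^sub>L W = id_blinfun" and *: "W' o\<^sub>L U = id_blinfun \<and> U o\<^sub>L W' = id_blinfun"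
  have "W' y = W y" for y
  proof -
    have "W' y = W (U (W' y))" using WU(1) by (metis blinfun_apply_blinfun_compose id_blinfun.rep_eq)
    also have "\<dots> = W y" using * by (metis blinfun_apply_blinfun_compose id_blinfun.rep_eq)
    finally show ?thesis .
  qed
  then show "W' = W" by (rule blinfun_eqI)
qed auto

lemma blinfun_inverse_eq: "W o\<^sub>L U = id_blinfun \<Longrightarrow> W (U x) = x"
  by (metis blinfun_apply_blinfun_compose id_blinfun.rep_eq)

text \<open>Because \<open>K\<close> does not depend on \<open>u\<close>, approximating
  \<open>x\<close> from \<open>S\<close> gives convergence uniform in \<open>u\<close>, and uniform
  limits preserve continuity.\<close>

lemma continuous_on_if_dense:
  fixes B :: "'u::metric_space \<Rightarrow> 'e::real_normed_vector \<Rightarrow> 'b::real_normed_vector"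
  assumes dense: "closure S = UNIV"
    and S: "\<And>s. s \<in> S \<Longrightarrow> continuous_on UNIV (\<lambda>u. B u s)"
    and K: "\<And>u x y. norm (B u x - B u y) \<le> K * norm (x - y)"
  shows "continuous_on UNIV (\<lambda>u. B u x)"
proof -
  have "x \<in> closure S" using dense by simp
  then obtain s where s: "\<And>n. s n \<in> S" "s \<longlonglongrightarrow> x" by (auto simp: closure_sequential)
  have "uniform_limit UNIV (\<lambda>n u. B u (s n)) (\<lambda>u. B u x) sequentially"
    unfolding uniform_limit_iff
  proof (intro allI impI)
    fix e :: real assume e: "e > 0"
    have "(\<lambda>n. K * norm (s n - x)) \<longlonglongrightarrow> 0"
      using tendsto_mult_left[OF tendsto_norm[OF LIM_zero[OF s(2)]], of K] by simp
    then have "\<forall>\<^sub>F n in sequentially. K * norm (s n - x) < e" using e by (rule order_tendstoD)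
    then show "\<forall>\<^sub>F n in sequentially. \<forall>u\<in>UNIV. dist (B u (s n)) (B u x) < e"
      by eventually_elim (auto simp: dist_norm intro: le_less_trans[OF K])
  qed
  then show ?thesis
    by (rule uniform_limit_theorem[rotated]) (use S s in \<open>auto intro!: always_eventually\<close>)
qed

lemma closure_induct:
  assumes "closure S = UNIV" "closed {x. Q x}" "\<And>s. s \<in> S \<Longrightarrow> Q s"
  shows "Q x"
proof -
  have "closure S \<subseteq> {x. Q x}" using assms by (intro closure_minimal) auto
  then show ?thesis using assms by auto
qed

section \<open>The Heisenberg operators\<close>

text \<open>The extra scalar \<open>c\<close> makes the family closed under composition, since
  Heisenberg operators compose only up to a phase. The operators of the theorem are those with
  \<open>c = 1\<close>.\<close>

definition heisenberg_fun ::
    "complex \<Rightarrow> 'v \<Rightarrow> 'v \<Rightarrow> ('v::euclidean_space \<Rightarrow> 'a::complex_normed_vector) \<Rightarrow> 'v \<Rightarrow> 'a" where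
  "heisenberg_fun c z \<zeta> f = (\<lambda>x. c *\<^sub>C (cis (\<zeta> \<bullet> x) *\<^sub>C f (x - z)))"

lemma heisenberg_fun_schwartz: "f \<in> schwartz \<Longrightarrow> heisenberg_fun c z \<zeta> f \<in> schwartz"
  unfolding heisenberg_fun_def
  using schwartz_translate[of f "- z"]
  by (intro schwartz_bounded_linear[OF scaleC.bounded_linear_right]
      schwartz_bilinear[OF bounded_bilinear_scaleC] cis_inner_CB_infinity) auto

text \<open>The phase arises when the inner modulation by \<open>\<zeta>'\<close> is evaluated at
  the translated point \<open>x - z\<close>. It is 1 if the inner operator is a pure
  translation.\<close>

lemma heisenberg_fun_compose:
  "heisenberg_fun c z \<zeta> (heisenberg_fun c' z' \<zeta>' f) =
    heisenberg_fun (c * c' * cis (- (\<zeta>' \<bullet> z))) (z + z') (\<zeta> + \<zeta>') f"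
  unfolding heisenberg_fun_def
  by (auto simp: scaleC_scaleC cis_mult inner_diff_right inner_add_left mult_ac algebra_simps)

section \<open>Heisenberg operators on the completion\<close>

context schwartz_completion
begin

lemma \<iota>_scaleR: "f \<in> schwartz \<Longrightarrow> \<iota> (\<lambda>x. r *\<^sub>R f x) = r *\<^sub>R \<iota> f"
  using \<iota>_scaleC[of f "complex_of_real r"] by (simp add: scaleC_of_real)

lemmas closure_induct_\<iota> = closure_induct[OF \<iota>_dense]

lemma extends_to_exists:
  assumes P: "\<And>f. f \<in> schwartz \<Longrightarrow> P f \<in> schwartz"
    and add: "\<And>f g. f \<in> schwartz \<Longrightarrow> g \<in> schwartz \<Longrightarrow> P (\<lambda>x. f x + g x) = (\<lambda>x. P f x + P g x)"
    and scale: "\<And>f r. f \<in> schwartz \<Longrightarrow> P (\<lambda>x. r *\<^sub>R f x) = (\<lambda>x. r *\<^sub>R P f x)"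
    and bound: "\<And>f. f \<in> schwartz \<Longrightarrow> norm (\<iota> (P f)) \<le> C * norm (\<iota> f)"
  shows "\<exists>V. extends_to \<iota> P V"
proof -
  have "\<exists>V :: 'e \<Rightarrow>\<^sub>L 'e. \<forall>f\<in>schwartz. V (\<iota> f) = \<iota> (P f)"
  proof (rule blinfun_extension[OF \<iota>_dense])
    show "norm (\<iota> (P f)) \<le> C * norm (\<iota> f)" if "f \<in> schwartz" for f by (rule bound[OF that])
    fix f g :: "real^'n \<Rightarrow> 'a" assume "f \<in> schwartz" "g \<in> schwartz"
    then show "\<exists>h\<in>schwartz. \<iota> h = \<iota> f + \<iota> g \<and> \<iota> (P h) = \<iota> (P f) + \<iota> (P g)"
      by (intro bexI[of _ "\<lambda>x. f x + g x"]) (auto simp: add P \<iota>_add schwartz_add)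
  next
    fix f :: "real^'n \<Rightarrow> 'a" and r assume "f \<in> schwartz"
    then show "\<exists>h\<in>schwartz. \<iota> h = r *\<^sub>R \<iota> f \<and> \<iota> (P h) = r *\<^sub>R \<iota> (P f)"
      by (intro bexI[of _ "\<lambda>x. r *\<^sub>R f x"])
        (auto simp: scale P \<iota>_scaleR intro!: schwartz_bounded_linear[OF bounded_linear_scaleR_right])
  qed
  then show ?thesis using P by (auto simp: extends_to_def)
qed

lemma extends_to_eqI:
  assumes "extends_to \<iota> P V" "extends_to \<iota> Q W" "\<And>f. f \<in> schwartz \<Longrightarrow> P f = Q f"
  shows "V = W"
proof -
  have "extends_to \<iota> P W" using assms unfolding extends_to_def by metis
  then show ?thesis using op_extension_eq assms(1) by metis
qed

lemma extends_to_compose: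
  "extends_to \<iota> P V \<Longrightarrow> extends_to \<iota> Q W \<Longrightarrow> extends_to \<iota> (\<lambda>f. P (Q f)) (V o\<^sub>L W)"
  unfolding extends_to_def by simp

text \<open>Unimodular scalars cancel against their conjugates; what remains is the translation
  invariance of Lebesgue measure.\<close>

lemma ip_heisenberg_fun:
  assumes f: "f \<in> schwartz" and c: "cmod c = 1"
  shows "ip (\<iota> (heisenberg_fun c z \<zeta> f)) (\<iota> (heisenberg_fun c z \<zeta> f)) = ip (\<iota> f) (\<iota> f)"
proof -
  have [measurable]: "f \<in> borel_measurable borel" by (intro smooth_measurable schwartz_smooth f)
  have [measurable]: "(\<lambda>x. star (f x) * f x) \<in> borel_measurable borel"
    using smooth_continuous[OF schwartz_smooth[OF f]]
    by (intro borel_measurable_continuous_onI continuous_intros bounded_linear.continuous_on[OF bounded_linear_star])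
  have "c * (cis t * (cnj c * cnj (cis t))) = 1" for t
  proof -
    have "cnj c * c = 1" using c by (metis complex_norm_square mult.commute of_real_1 power_one)
    moreover have "cnj (cis t) * cis t = 1" by (simp add: cis_cnj cis_mult)
    moreover have "c * (cis t * (cnj c * cnj (cis t))) = (cnj c * c) * (cnj (cis t) * cis t)"
      by (simp only: mult_ac)
    ultimately show ?thesis by simp
  qed
  then have "star (heisenberg_fun c z \<zeta> f x) * heisenberg_fun c z \<zeta> f x = star (f (x + - z)) * f (x + - z)" for x
    by (simp add: heisenberg_fun_def star_scaleC mult_scaleC_left mult_scaleC_right scaleC_scaleC mult.assoc)
  then show ?thesis
    using integral_translate[of "\<lambda>x. star (f x) * f x" "- z"]
    by (simp add: \<iota>_ip heisenberg_fun_schwartz f)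
qed

lemma heisenberg_fun_extends:
  assumes c: "cmod c = 1"
  shows "\<exists>V. extends_to \<iota> (heisenberg_fun c z \<zeta>) V"
proof (rule extends_to_exists)
  show "norm (\<iota> (heisenberg_fun c z \<zeta> f)) \<le> 1 * norm (\<iota> f)" if "f \<in> schwartz" for f
    using ip_heisenberg_fun[OF that c] by (simp add: norm_ip)
  show "heisenberg_fun c z \<zeta> f \<in> schwartz" if "f \<in> schwartz" for f
    using that by (rule heisenberg_fun_schwartz)
qed (auto simp: heisenberg_fun_def scaleC_add_right scaleC.scaleR_right)

text \<open>The definite description behind \<open>heisenberg\<close> denotes the intended operator
  once an extension exists, and isometry on Schwartz functions supplies one.\<close>

lemma extends_to_heisenberg: "extends_to \<iota> (heisenberg_fun 1 z \<zeta>) (heisenberg \<iota> z \<zeta>)"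
proof -
  obtain V where "extends_to \<iota> (heisenberg_fun 1 z \<zeta>) V" using heisenberg_fun_extends[of 1] by auto
  moreover have "heisenberg \<iota> z \<zeta> = op_extension \<iota> (heisenberg_fun 1 z \<zeta>)"
    unfolding heisenberg_def heisenberg_fun_def by simp
  ultimately show ?thesis using op_extension_eq by metis
qed

lemma norm_heisenberg: "norm (heisenberg \<iota> z \<zeta> x) = norm x"
proof (rule closure_induct_\<iota>[where Q="\<lambda>x. norm (heisenberg \<iota> z \<zeta> x) = norm x"])
  show "closed {x. norm (heisenberg \<iota> z \<zeta> x) = norm x}"
    by (intro closed_Collect_eq continuous_intros)
  fix s assume "s \<in> \<iota> ` schwartz"
  then obtain f where "f \<in> schwartz" "s = \<iota> f" by auto
  then show "norm (heisenberg \<iota> z \<zeta> s) = norm s"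
    using extends_to_heisenberg[of z \<zeta>] ip_heisenberg_fun[of f 1 z \<zeta>] by (simp add: extends_to_def norm_ip)
qed

lemma extends_to_id: "extends_to \<iota> (heisenberg_fun 1 0 0) id_blinfun"
  unfolding extends_to_def heisenberg_fun_def by simp

lemma heisenberg_invertible:
  "\<exists>W. W o\<^sub>L heisenberg \<iota> z \<zeta> = id_blinfun \<and> heisenberg \<iota> z \<zeta> o\<^sub>L W = id_blinfun"
proof -
  \<comment> \<open>The scalar \<open>cis (- (\<zeta> \<bullet> z))\<close> compensates the phase
    that arises when the opposite translation and modulation are composed with the operator; it is
    the same in both orders.\<close>
  obtain W where W: "extends_to \<iota> (heisenberg_fun (cis (- (\<zeta> \<bullet> z))) (- z) (- \<zeta>)) W"
    using heisenberg_fun_extends[of "cis (- (\<zeta> \<bullet> z))"] by auto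
  have "W o\<^sub>L heisenberg \<iota> z \<zeta> = id_blinfun"
    by (rule extends_to_eqI[OF extends_to_compose[OF W extends_to_heisenberg] extends_to_id])
      (simp add: heisenberg_fun_compose cis_mult)
  moreover have "heisenberg \<iota> z \<zeta> o\<^sub>L W = id_blinfun"
    by (rule extends_to_eqI[OF extends_to_compose[OF extends_to_heisenberg W] extends_to_id])
      (simp add: heisenberg_fun_compose cis_mult)
  ultimately show ?thesis by blast
qed

lemma heisenberg_translate:
  "heisenberg \<iota> z \<zeta> = heisenberg \<iota> w \<zeta> o\<^sub>L heisenberg \<iota> (z - w) 0"
  by (rule extends_to_eqI[OF extends_to_heisenberg extends_to_compose[OF extends_to_heisenberg extends_to_heisenberg]])
    (simp add: heisenberg_fun_compose)

text \<open>In the factorization given by \<open>heisenberg_translate\<close> the operator commuting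
  with \<open>T\<close> stands on the left. Under conjugation it therefore meets \<open>T\<close>
  directly and cancels, which leaves a pure translation by \<open>z - w\<close>.\<close>

lemma heisenberg_conj_translate:
  assumes T: "T o\<^sub>L heisenberg \<iota> w \<zeta> = heisenberg \<iota> w \<zeta> o\<^sub>L T"
  shows "heisenberg_conj \<iota> T z \<zeta> = heisenberg_conj \<iota> T (z - w) 0"
proof -
  let ?A = "heisenberg \<iota> w \<zeta>" and ?B = "heisenberg \<iota> (z - w) 0"
  obtain A' where A: "A' o\<^sub>L ?A = id_blinfun" "?A o\<^sub>L A' = id_blinfun" using heisenberg_invertible by blast
  obtain B' where B: "B' o\<^sub>L ?B = id_blinfun" "?B o\<^sub>L B' = id_blinfun" using heisenberg_invertible by blast
  have AB: "op_inverse (heisenberg \<iota> z \<zeta>) = B' o\<^sub>L A'"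
    unfolding heisenberg_translate[of z \<zeta> w]
    by (rule op_inverse_eq; rule blinfun_eqI) (simp_all add: blinfun_inverse_eq[OF A(1)]
       blinfun_inverse_eq[OF A(2)] blinfun_inverse_eq[OF B(1)] blinfun_inverse_eq[OF B(2)])
  have T': "T (?A x) = ?A (T x)" for x using T by (metis blinfun_apply_blinfun_compose)
  show ?thesis
    unfolding heisenberg_conj_def AB op_inverse_eq[OF B] unfolding heisenberg_translate[of z \<zeta> w]
    by (rule blinfun_eqI) (simp add: T' blinfun_inverse_eq[OF A(1)])
qed

text \<open>For a pair of Schwartz functions this is dominated convergence. Since the Heisenberg
  operators are isometric, the Lipschitz constants in both vectors are independent of
  \<open>u\<close>, so two density steps reach arbitrary vectors.\<close>

lemma continuous_ip_heisenberg:
  assumes L: "bounded_linear L"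
  shows "continuous_on UNIV (\<lambda>u. ip y (heisenberg \<iota> (L u) u x))"
proof (rule continuous_on_if_dense[OF \<iota>_dense, where K="4 * norm y"])
  show "norm (ip y (heisenberg \<iota> (L u) u x) - ip y (heisenberg \<iota> (L u) u x')) \<le> 4 * norm y * norm (x - x')"
    for u x x'
    using norm_ip_le[of y "heisenberg \<iota> (L u) u (x - x')"]
    unfolding norm_heisenberg by (simp add: ip.diff_right blinfun.diff_right mult.assoc)
  fix s assume "s \<in> \<iota> ` schwartz"
  then obtain f where s: "s = \<iota> f" and f: "f \<in> schwartz" by auto
  show "continuous_on UNIV (\<lambda>u. ip y (heisenberg \<iota> (L u) u s))"
  proof (rule continuous_on_if_dense[OF \<iota>_dense, where K="4 * norm s" and B="\<lambda>u y. ip y (heisenberg \<iota> (L u) u s)"])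
    show "norm (ip y (heisenberg \<iota> (L u) u s) - ip y' (heisenberg \<iota> (L u) u s)) \<le> 4 * norm s * norm (y - y')"
      for u y y'
      using norm_ip_le[of "y - y'" "heisenberg \<iota> (L u) u s"]
      by (simp add: ip.diff_left norm_heisenberg mult_ac)
    fix t assume "t \<in> \<iota> ` schwartz"
    then obtain g where t: "t = \<iota> g" and g: "g \<in> schwartz" by auto
    have contf: "continuous_on UNIV f" and contg: "continuous_on UNIV g"
      using f g by (auto intro: smooth_continuous schwartz_smooth)
    obtain C where C: "C \<ge> 0" "\<And>x. norm (f x) \<le> C"
      using CB_infinity_bounded f schwartz_subset_CB_infinity by blast
    have eq: "ip t (heisenberg \<iota> (L u) u s) = (\<integral>x. star (g x) * (cis (u \<bullet> x) *\<^sub>C f (x - L u)) \<partial>lborel)" for u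
      using extends_to_heisenberg[of "L u" u] heisenberg_fun_schwartz[OF f, of 1 "L u" u]
      by (simp add: s t \<iota>_ip f g extends_to_def heisenberg_fun_def)
    have cont: "continuous_on UNIV (\<lambda>x. star (g x) * (cis (u \<bullet> x) *\<^sub>C f (x - L u)))" for u
      by (intro continuous_intros bounded_linear.continuous_on[OF bounded_linear_star] contg
          scaleC.continuous_on continuous_on_compose2[OF contf]) auto
    show "continuous_on UNIV (\<lambda>u. ip t (heisenberg \<iota> (L u) u s))"
      unfolding eq continuous_on_sequentially comp_def
    proof (intro allI ballI impI, elim conjE)
      fix v :: "nat \<Rightarrow> real^'n" and u assume v: "v \<longlonglongrightarrow> u"
      show "(\<lambda>n. \<integral>x. star (g x) * (cis (v n \<bullet> x) *\<^sub>C f (x - L (v n))) \<partial>lborel)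
        \<longlonglongrightarrow> (\<integral>x. star (g x) * (cis (u \<bullet> x) *\<^sub>C f (x - L u)) \<partial>lborel)"
      proof (rule integral_dominated_convergence[where w="\<lambda>x. C * norm (g x)"])
        show "integrable lborel (\<lambda>x. C * norm (g x))"
          using schwartz_integrable[OF g] by simp
        show "AE x in lborel. (\<lambda>n. star (g x) * (cis (v n \<bullet> x) *\<^sub>C f (x - L (v n)))) \<longlonglongrightarrow>
            star (g x) * (cis (u \<bullet> x) *\<^sub>C f (x - L u))"
          using v contf
          by (intro AE_I2 tendsto_intros scaleC.tendsto tendsto_cis
              isCont_tendsto_compose[of _ f] bounded_linear.tendsto[OF L])
            (auto simp: continuous_on_eq_continuous_at)
        show "AE x in lborel. norm (star (g x) * (cis (v n \<bullet> x) *\<^sub>C f (x - L (v n)))) \<le> C * norm (g x)" for n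
        proof (rule AE_I2)
          fix x
          have "norm (star (g x) * (cis (v n \<bullet> x) *\<^sub>C f (x - L (v n)))) \<le> norm (g x) * norm (f (x - L (v n)))"
            using norm_mult_ineq[of "star (g x)" "cis (v n \<bullet> x) *\<^sub>C f (x - L (v n))"] by (simp add: norm_scaleC)
          also have "\<dots> \<le> norm (g x) * C" by (intro mult_left_mono C) auto
          finally show "norm (star (g x) * (cis (v n \<bullet> x) *\<^sub>C f (x - L (v n)))) \<le> C * norm (g x)"
            by (simp add: mult.commute)
        qed
      qed (use cont in \<open>auto intro!: borel_measurable_continuous_onI\<close>)
    qed
  qed
qed

end

section \<open>Operators commuting with right multiplications\<close>

text \<open>After centring at \<open>u\<close> and rescaling, the Gaussian is fixed and
  \<open>D\<close> is evaluated at points tending to \<open>u\<close>. Dominated convergence then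
  yields the mass of the Gaussian times \<open>D u * a\<close>, and this mass is not zero.\<close>

lemma integral_gaussian_approximation:
  fixes D :: "'v::euclidean_space \<Rightarrow> 'a::{real_normed_algebra,banach,second_countable_topology}"
  assumes cont: "continuous_on UNIV D" and bound: "\<And>x. norm (D x) \<le> K"
    and zero: "\<And>m::nat. 0 < m \<Longrightarrow> (\<integral>x. D x * (exp (- (norm (real m *\<^sub>R (x - u)))\<^sup>2 / 2) *\<^sub>R a) \<partial>lborel) = 0"
  shows "D u * a = 0"
proof -
  define e where "e x = exp (- (norm x)\<^sup>2 / 2)" for x :: 'v
  have cont_e: "continuous_on UNIV e" unfolding e_def by (intro continuous_intros) auto
  have e_schwartz: "e \<in> schwartz"
    using gaussian_schwartz[of "1/2", where 'v='v] by (simp add: e_def[abs_def])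
  have int_e: "integrable lborel e" by (rule schwartz_integrable[OF e_schwartz])
  have e_pos: "0 < e x" for x by (simp add: e_def)
  \<comment> \<open>The rescaled integrand; \<open>Suc m\<close> keeps the scale nonzero. The
    Jacobian of the rescaling is a nonzero factor and drops out of an equation with right-hand side
    0.\<close>
  define h where "h m x = e x *\<^sub>R (D (u + inverse (real (Suc m)) *\<^sub>R x) * a)" for m x
  have h0: "(\<integral>x. h m x \<partial>lborel) = 0" for m
  proof -
    let ?m = "real (Suc m)"
    let ?F = "\<lambda>x. D x * (e (?m *\<^sub>R (x - u)) *\<^sub>R a)"
    have F: "continuous_on UNIV ?F"
      by (intro continuous_intros cont continuous_on_compose2[OF cont_e]) auto
    then have F': "continuous_on UNIV (\<lambda>x. ?F (x + u))"
      by (rule continuous_on_compose2) (auto intro!: continuous_intros)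
    have "0 = (\<integral>x. ?F x \<partial>lborel)" using zero[of "Suc m"] by (simp add: e_def)
    also have "\<dots> = (\<integral>x. ?F (x + u) \<partial>lborel)"
      by (rule integral_translate[symmetric, OF borel_measurable_continuous_onI[OF F]])
    also have "\<dots> = \<bar>inverse ?m\<bar> ^ DIM('v) *\<^sub>R (\<integral>x. ?F (inverse ?m *\<^sub>R x + u) \<partial>lborel)"
      by (rule integral_scale[OF borel_measurable_continuous_onI[OF F']]) simp
    also have "(\<lambda>x. ?F (inverse ?m *\<^sub>R x + u)) = h m"
      by (auto simp: h_def add.commute)
    finally show ?thesis by simp
  qed
  have "(\<lambda>m. \<integral>x. h m x \<partial>lborel) \<longlonglongrightarrow> (\<integral>x. e x *\<^sub>R (D u * a) \<partial>lborel)"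
  proof (rule integral_dominated_convergence[where w="\<lambda>x. e x * (K * norm a)"])
    show "integrable lborel (\<lambda>x. e x * (K * norm a))" using int_e by simp
    show "AE x in lborel. (\<lambda>m. h m x) \<longlonglongrightarrow> e x *\<^sub>R (D u * a)"
    proof (rule AE_I2)
      fix x
      have "(\<lambda>m. u + inverse (real (Suc m)) *\<^sub>R x) \<longlonglongrightarrow> u + 0 *\<^sub>R x"
        by (intro tendsto_intros LIMSEQ_inverse_real_of_nat)
      then have "(\<lambda>m. D (u + inverse (real (Suc m)) *\<^sub>R x)) \<longlonglongrightarrow> D u"
        using cont by (intro isCont_tendsto_compose[of u D]) (auto simp: continuous_on_eq_continuous_at)
      then show "(\<lambda>m. h m x) \<longlonglongrightarrow> e x *\<^sub>R (D u * a)"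
        unfolding h_def by (intro tendsto_intros)
    qed
    show "AE x in lborel. norm (h m x) \<le> e x * (K * norm a)" for m
    proof (rule AE_I2)
      fix x
      have "norm (D (u + inverse (real (Suc m)) *\<^sub>R x) * a) \<le> K * norm a"
        by (intro order_trans[OF norm_mult_ineq] mult_right_mono bound) auto
      then show "norm (h m x) \<le> e x * (K * norm a)"
        unfolding h_def using e_pos[of x] by (simp add: mult_left_mono)
    qed
    show "h m \<in> borel_measurable lborel" for m
      unfolding h_def[abs_def] measurable_lborel2
      by (intro borel_measurable_continuous_onI continuous_intros cont_e continuous_on_compose2[OF cont]) auto
    show "(\<lambda>x. e x *\<^sub>R (D u * a)) \<in> borel_measurable lborel"
      unfolding measurable_lborel2 by (intro borel_measurable_continuous_onI continuous_intros cont_e)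
  qed
  then have "(\<integral>x. e x *\<^sub>R (D u * a) \<partial>lborel) = 0" by (simp add: h0 LIMSEQ_const_iff)
  then have "(\<integral>x. e x \<partial>lborel) *\<^sub>R (D u * a) = 0" using int_e by simp
  \<comment> \<open>The mass is read off from the Gaussian Fourier integral at frequency 0, which is
    stated over the complex numbers.\<close>
  moreover have "complex_of_real (\<integral>x. e x \<partial>lborel) \<noteq> 0"
  proof -
    have "complex_of_real (\<integral>x. e x \<partial>lborel) = (\<integral>y. cis ((0::'v) \<bullet> y) * of_real (exp (- (norm y)\<^sup>2 / 2)) \<partial>lborel)"
      by (simp add: e_def)
    then show ?thesis unfolding integral_gaussian_cis by simp
  qed
  ultimately show ?thesis by simp
qed

context schwartz_completion
begin

lemma adjointable_obtains_adjoint: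
  assumes "T \<in> adjointable ip" obtains W where "\<And>x y. ip y (blinfun_apply T x) = ip (W y) x"
proof -
  obtain W where "\<And>x y. ip (blinfun_apply T x) y = ip x (W y)" using assms by (auto simp: adjointable_def)
  then have "ip y (blinfun_apply T x) = ip (W y) x" for x y by (metis ip_star)
  then show ?thesis using that by blast
qed

section \<open>Weak integrals of Heisenberg operators\<close>

context
  fixes L :: "real^'n \<Rightarrow> real^'n" and k :: "real^'n \<Rightarrow> 'a"
  assumes L: "bounded_linear L" and cont_k: "continuous_on UNIV k" and int_k: "integrable lborel k"
begin

text \<open>These are the matrix elements of the formal operator that sends \<open>x\<close> to the
  integral of \<open>act (heisenberg \<iota> (L \<xi>) \<xi> x) (k \<xi>)\<close>. In this form only
  functions with values in the separable algebra are integrated, never functions with values in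
  E.\<close>

definition kernel_form :: "'e \<Rightarrow> 'e \<Rightarrow> 'a" where
  "kernel_form y x = (\<integral>\<xi>. ip y (heisenberg \<iota> (L \<xi>) \<xi> x) * k \<xi> \<partial>lborel)"

lemma norm_ip_heisenberg: "norm (ip y (heisenberg \<iota> z \<zeta> x)) \<le> 4 * (norm y * norm x)"
  using norm_ip_le[of y "heisenberg \<iota> z \<zeta> x"] by (simp add: norm_heisenberg)

lemma kernel_integrable: "integrable lborel (\<lambda>\<xi>. ip y (heisenberg \<iota> (L \<xi>) \<xi> x) * k \<xi>)"
proof (rule Bochner_Integration.integrable_bound)
  show "integrable lborel (\<lambda>\<xi>. 4 * (norm y * norm x) * norm (k \<xi>))" using int_k by simp
  show "(\<lambda>\<xi>. ip y (heisenberg \<iota> (L \<xi>) \<xi> x) * k \<xi>) \<in> borel_measurable lborel"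
    unfolding measurable_lborel2
    by (intro borel_measurable_continuous_onI continuous_on_mult continuous_ip_heisenberg L cont_k)
  show "AE \<xi> in lborel. norm (ip y (heisenberg \<iota> (L \<xi>) \<xi> x) * k \<xi>) \<le> norm (4 * (norm y * norm x) * norm (k \<xi>))"
    by (intro AE_I2 order_trans[OF norm_mult_ineq])
      (auto intro!: mult_right_mono order_trans[OF norm_ip_heisenberg])
qed

lemma bounded_bilinear_kernel_form: "bounded_bilinear kernel_form"
proof
  fix x y z :: 'e and r :: real
  show "kernel_form (x + y) z = kernel_form x z + kernel_form y z"
    unfolding kernel_form_def using kernel_integrable
    by (simp add: ip.add_left distrib_right)
  show "kernel_form x (y + z) = kernel_form x y + kernel_form x z"
    unfolding kernel_form_def using kernel_integrable
    by (simp add: ip.add_right blinfun.add_right distrib_right)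
  show "kernel_form (r *\<^sub>R x) y = r *\<^sub>R kernel_form x y"
    unfolding kernel_form_def by (simp add: ip.scaleR_left)
  show "kernel_form x (r *\<^sub>R y) = r *\<^sub>R kernel_form x y"
    unfolding kernel_form_def by (simp add: ip.scaleR_right blinfun.scaleR_right)
  have "norm (kernel_form y x) \<le> norm y * norm x * (4 * (\<integral>\<xi>. norm (k \<xi>) \<partial>lborel))" for x y
  proof -
    have "norm (kernel_form y x) \<le> (\<integral>\<xi>. norm (ip y (heisenberg \<iota> (L \<xi>) \<xi> x) * k \<xi>) \<partial>lborel)"
      unfolding kernel_form_def by (rule integral_norm_bound)
    also have "\<dots> \<le> (\<integral>\<xi>. 4 * (norm y * norm x) * norm (k \<xi>) \<partial>lborel)"
      using kernel_integrable int_k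
      by (intro integral_mono order_trans[OF norm_mult_ineq] mult_right_mono norm_ip_heisenberg) auto
    finally show ?thesis by (simp add: mult_ac)
  qed
  then show "\<exists>K. \<forall>a b. norm (kernel_form a b) \<le> norm a * norm b * K" by blast
qed

lemma integrable_kernel_integrand:
  assumes f: "f \<in> schwartz"
  shows "integrable lborel (\<lambda>\<xi>. cis (x \<bullet> \<xi>) *\<^sub>C (f (x - L \<xi>) * k \<xi>))"
proof -
  obtain C where C: "C \<ge> 0" "\<And>x. norm (f x) \<le> C"
    using CB_infinity_bounded f schwartz_subset_CB_infinity by blast
  have contf: "continuous_on UNIV f" using f by (auto intro: smooth_continuous schwartz_smooth)
  show ?thesis
  proof (rule Bochner_Integration.integrable_bound)
    show "integrable lborel (\<lambda>\<xi>. C * norm (k \<xi>))" using int_k by simp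
    show "(\<lambda>\<xi>. cis (x \<bullet> \<xi>) *\<^sub>C (f (x - L \<xi>) * k \<xi>)) \<in> borel_measurable lborel"
      unfolding measurable_lborel2
      by (intro borel_measurable_continuous_onI continuous_intros scaleC.continuous_on
        bounded_linear.continuous_on[OF L] continuous_on_compose2[OF contf] cont_k) auto
    show "AE \<xi> in lborel. norm (cis (x \<bullet> \<xi>) *\<^sub>C (f (x - L \<xi>) * k \<xi>)) \<le> norm (C * norm (k \<xi>))"
      using C by (intro AE_I2) (auto simp: norm_scaleC intro!: order_trans[OF norm_mult_ineq] mult_right_mono)
  qed
qed

context
  fixes P :: "(real^'n \<Rightarrow> 'a) \<Rightarrow> real^'n \<Rightarrow> 'a" and c :: real
  assumes P_schwartz: "\<And>f. f \<in> schwartz \<Longrightarrow> P f \<in> schwartz"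
    and P_eq: "\<And>f x. f \<in> schwartz \<Longrightarrow>
      P f x = c *\<^sub>R (\<integral>\<xi>. cis (x \<bullet> \<xi>) *\<^sub>C (f (x - L \<xi>) * k \<xi>) \<partial>lborel)"
begin

text \<open>Fubini's theorem converts the pointwise formula for \<open>P f\<close> into a statement
  about inner products, which survives the passage to the completion. The product majorant comes
  from the bound on \<open>f\<close> and the integrability of \<open>g\<close> and
  \<open>k\<close>.\<close>

lemma ip_kernel_form:
  assumes f: "f \<in> schwartz" and g: "g \<in> schwartz"
  shows "ip (\<iota> g) (\<iota> (P f)) = c *\<^sub>R kernel_form (\<iota> g) (\<iota> f)"
proof -
  obtain C where C: "C \<ge> 0" "\<And>x. norm (f x) \<le> C"
    using CB_infinity_bounded f schwartz_subset_CB_infinity by blast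
  have contf: "continuous_on UNIV f" and contg: "continuous_on UNIV g"
    using f g by (auto intro: smooth_continuous schwartz_smooth)
  define h where "h x \<xi> = star (g x) * (cis (x \<bullet> \<xi>) *\<^sub>C (f (x - L \<xi>) * k \<xi>))" for x \<xi>
  have cont_h: "continuous_on UNIV (case_prod h)"
    unfolding h_def case_prod_beta'
    by (intro continuous_intros bounded_linear.continuous_on[OF bounded_linear_star] scaleC.continuous_on
        bounded_linear.continuous_on[OF L] continuous_on_compose2[OF contf] continuous_on_compose2[OF contg]
        continuous_on_compose2[OF cont_k]) auto
  have int_h: "integrable (lborel \<Otimes>\<^sub>M lborel) (case_prod h)"
  proof (rule integrable_product_bound)
    show "integrable lborel (\<lambda>x. C * norm (g x))" using schwartz_integrable[OF g] by simp
    show "integrable lborel (\<lambda>x. norm (k x))" using int_k by simp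
    show "norm (case_prod h (x, \<xi>)) \<le> C * norm (g x) * norm (k \<xi>)" for x \<xi>
    proof -
      have "norm (h x \<xi>) \<le> norm (star (g x)) * norm (cis (x \<bullet> \<xi>) *\<^sub>C (f (x - L \<xi>) * k \<xi>))"
        unfolding h_def by (rule norm_mult_ineq)
      also have "\<dots> \<le> norm (star (g x)) * (norm (f (x - L \<xi>)) * norm (k \<xi>))"
        by (intro mult_left_mono) (auto simp: norm_scaleC norm_mult_ineq)
      also have "\<dots> \<le> norm (star (g x)) * (C * norm (k \<xi>))"
        by (intro mult_left_mono mult_right_mono C) auto
      finally show ?thesis by (simp add: mult_ac)
    qed
  qed (rule borel_measurable_continuous_onI[OF cont_h])
  have star_int: "star a * (\<integral>\<xi>. u \<xi> \<partial>lborel) = (\<integral>\<xi>. star a * u \<xi> \<partial>lborel)" if "integrable lborel u"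
    for a :: 'a and u :: "real^'n \<Rightarrow> 'a"
    using integral_bounded_linear[OF bounded_linear_mult_right that] by metis
  have ip_U: "ip (\<iota> g) (heisenberg \<iota> (L \<xi>) \<xi> (\<iota> f)) * k \<xi> = (\<integral>x. h x \<xi> \<partial>lborel)" for \<xi>
  proof -
    let ?q = "\<lambda>x. star (g x) * (cis (\<xi> \<bullet> x) *\<^sub>C f (x - L \<xi>))"
    have "ip (\<iota> g) (heisenberg \<iota> (L \<xi>) \<xi> (\<iota> f)) = (\<integral>x. ?q x \<partial>lborel)"
      using extends_to_heisenberg[of "L \<xi>" \<xi>] heisenberg_fun_schwartz[OF f, of 1 "L \<xi>" \<xi>]
      by (simp add: \<iota>_ip f g extends_to_def heisenberg_fun_def)
    moreover have "integrable lborel ?q"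
    proof (rule Bochner_Integration.integrable_bound)
      show "integrable lborel (\<lambda>x. norm (g x) * C)" using schwartz_integrable[OF g] by simp
      show "?q \<in> borel_measurable lborel"
        unfolding measurable_lborel2
        by (intro borel_measurable_continuous_onI continuous_intros scaleC.continuous_on contg
            bounded_linear.continuous_on[OF bounded_linear_star] continuous_on_compose2[OF contf]) auto
      show "AE x in lborel. norm (?q x) \<le> norm (norm (g x) * C)"
        using C by (intro AE_I2 order_trans[OF norm_mult_ineq]) (auto simp: norm_scaleC intro!: mult_left_mono)
    qed
    ultimately have "ip (\<iota> g) (heisenberg \<iota> (L \<xi>) \<xi> (\<iota> f)) * k \<xi> = (\<integral>x. ?q x * k \<xi> \<partial>lborel)"
      using integral_bounded_linear[OF bounded_linear_mult_left, of lborel ?q "k \<xi>"] by simp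
    also have "\<dots> = (\<integral>x. h x \<xi> \<partial>lborel)"
      by (intro Bochner_Integration.integral_cong)
        (auto simp: h_def mult_scaleC_left mult_scaleC_right mult.assoc inner_commute)
    finally show ?thesis .
  qed
  have "ip (\<iota> g) (\<iota> (P f)) = (\<integral>x. star (g x) * P f x \<partial>lborel)"
    by (rule \<iota>_ip[OF g P_schwartz[OF f]])
  also have "\<dots> = (\<integral>x. c *\<^sub>R (\<integral>\<xi>. h x \<xi> \<partial>lborel) \<partial>lborel)"
    unfolding P_eq[OF f] h_def by (simp add: star_int[OF integrable_kernel_integrand[OF f]])
  also have "\<dots> = c *\<^sub>R (\<integral>x. (\<integral>\<xi>. h x \<xi> \<partial>lborel) \<partial>lborel)" by simp
  also have "(\<integral>x. (\<integral>\<xi>. h x \<xi> \<partial>lborel) \<partial>lborel) = (\<integral>\<xi>. (\<integral>x. h x \<xi> \<partial>lborel) \<partial>lborel)"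
    by (rule lborel_pair.Fubini_integral[OF int_h, symmetric])
  also have "\<dots> = kernel_form (\<iota> g) (\<iota> f)" by (simp add: kernel_form_def ip_U)
  finally show ?thesis .
qed

text \<open>Boundedness of \<open>P\<close> comes from the form itself: pairing with
  \<open>g = P f\<close> produces the square of the norm of \<open>\<iota> (P f)\<close> on the
  left, and one factor of that norm cancels. The weak formula then extends by density in each
  argument.\<close>

lemma kernel_operator:
  "\<exists>V. extends_to \<iota> P V \<and> (\<forall>x y. ip y (blinfun_apply V x) = c *\<^sub>R kernel_form y x)"
proof -
  interpret B: bounded_bilinear kernel_form by (rule bounded_bilinear_kernel_form)
  obtain K where K: "K \<ge> 0" "\<And>y x. norm (kernel_form y x) \<le> norm y * norm x * K"
    using B.nonneg_bounded by blast
  have bound: "norm (\<iota> (P f)) \<le> \<bar>c\<bar> * K * norm (\<iota> f)" if f: "f \<in> schwartz" for f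
  proof -
    have "(norm (\<iota> (P f)))\<^sup>2 = \<bar>c\<bar> * norm (kernel_form (\<iota> (P f)) (\<iota> f))"
      using ip_kernel_form[OF f P_schwartz[OF f]] by (simp add: norm_ip_self[symmetric])
    also have "\<dots> \<le> \<bar>c\<bar> * (norm (\<iota> (P f)) * norm (\<iota> f) * K)"
      by (intro mult_left_mono K) auto
    finally have "norm (\<iota> (P f)) * norm (\<iota> (P f)) \<le> norm (\<iota> (P f)) * (\<bar>c\<bar> * K * norm (\<iota> f))"
      by (simp add: power2_eq_square mult_ac)
    then show ?thesis
      using K(1) by (cases "norm (\<iota> (P f)) = 0") (auto simp: mult_le_cancel_left)
  qed
  obtain V where V: "extends_to \<iota> P V"
  proof -
    have "\<exists>V. extends_to \<iota> P V"
    proof (rule extends_to_exists[where C="\<bar>c\<bar> * K"])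
      show "P f \<in> schwartz" if "f \<in> schwartz" for f by (rule P_schwartz[OF that])
      show "norm (\<iota> (P f)) \<le> \<bar>c\<bar> * K * norm (\<iota> f)" if "f \<in> schwartz" for f by (rule bound[OF that])
      show "P (\<lambda>x. f x + g x) = (\<lambda>x. P f x + P g x)" if "f \<in> schwartz" "g \<in> schwartz" for f g
        using that integrable_kernel_integrand by (auto simp: P_eq schwartz_add distrib_right scaleC_add_right scaleR_add_right)
      show "P (\<lambda>x. r *\<^sub>R f x) = (\<lambda>x. r *\<^sub>R P f x)" if "f \<in> schwartz" for f r
        using that
        by (auto simp: P_eq scaleC.scaleR_right schwartz_bounded_linear[OF bounded_linear_scaleR_right])
    qed
    then show ?thesis using that by blast
  qed
  have V': "V (\<iota> f) = \<iota> (P f)" if "f \<in> schwartz" for f using V that by (simp add: extends_to_def)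
  have "ip y (V x) = c *\<^sub>R kernel_form y x" for x y
  proof (rule closure_induct_\<iota>[where Q="\<lambda>x. ip y (V x) = c *\<^sub>R kernel_form y x"])
    show "closed {x. ip y (V x) = c *\<^sub>R kernel_form y x}"
      by (intro closed_Collect_eq continuous_intros ip.continuous_on B.continuous_on)
    fix s assume "s \<in> \<iota> ` schwartz"
    then obtain f where s: "s = \<iota> f" and f: "f \<in> schwartz" by auto
    show "ip y (V s) = c *\<^sub>R kernel_form y s"
    proof (rule closure_induct_\<iota>[where Q="\<lambda>y. ip y (V s) = c *\<^sub>R kernel_form y s"])
      show "closed {y. ip y (V s) = c *\<^sub>R kernel_form y s}"
        by (intro closed_Collect_eq continuous_intros ip.continuous_on B.continuous_on)
    qed (use f in \<open>auto simp: s V' ip_kernel_form\<close>)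
  qed
  with V show ?thesis by blast
qed

text \<open>The commutation relation is tested against \<open>y\<close>. On one side the adjoint
  \<open>W\<close> carries \<open>T\<close> over to \<open>y\<close> before the weak formula is
  applied, on the other the formula is applied to \<open>T x\<close>; inside the integral
  \<open>W\<close> is then turned back into \<open>T\<close>.\<close>

lemma kernel_form_commute:
  assumes T: "\<And>x y. ip y (blinfun_apply T x) = ip (W y) x" and c: "c \<noteq> 0"
    and comm: "T o\<^sub>L op_extension \<iota> P = op_extension \<iota> P o\<^sub>L T"
  shows "(\<integral>\<xi>. (ip y (T (heisenberg \<iota> (L \<xi>) \<xi> x)) - ip y (heisenberg \<iota> (L \<xi>) \<xi> (T x))) * k \<xi> \<partial>lborel) = 0"
proof -
  obtain V where V: "extends_to \<iota> P V" and V': "\<And>x y. ip y (blinfun_apply V x) = c *\<^sub>R kernel_form y x"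
    using kernel_operator by blast
  have "T (V x) = V (T x)" using comm op_extension_eq[OF V] by (metis blinfun_apply_blinfun_compose)
  then have "c *\<^sub>R kernel_form (W y) x = c *\<^sub>R kernel_form y (T x)"
    using T[of y "V x"] V' by metis
  then have "kernel_form (W y) x = kernel_form y (T x)" using c by simp
  then show ?thesis
    using kernel_integrable[of "W y" x] kernel_integrable[of y "T x"]
    by (simp add: T kernel_form_def left_diff_distrib)
qed

end

end

text \<open>As \<open>m\<close> grows, the Gaussian kernels concentrate at \<open>u\<close> and isolate the commutator there.\<close>

lemma heisenberg_commute:
  fixes P :: "'a \<Rightarrow> nat \<Rightarrow> (real^'n \<Rightarrow> 'a) \<Rightarrow> real^'n \<Rightarrow> 'a"
  assumes T: "T \<in> adjointable ip" and L: "bounded_linear L" and c: "\<And>m. 0 < m \<Longrightarrow> c m \<noteq> 0"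
    and P_schwartz: "\<And>a m f. 0 < m \<Longrightarrow> f \<in> schwartz \<Longrightarrow> P a m f \<in> schwartz"
    and P_eq: "\<And>a m f x. 0 < m \<Longrightarrow> f \<in> schwartz \<Longrightarrow> P a m f x =
      c m *\<^sub>R (\<integral>\<xi>. cis (x \<bullet> \<xi>) *\<^sub>C (f (x - L \<xi>) * (exp (- (norm (real m *\<^sub>R (\<xi> - u)))\<^sup>2 / 2) *\<^sub>R a)) \<partial>lborel)"
    and comm: "\<And>a m. 0 < m \<Longrightarrow> T o\<^sub>L op_extension \<iota> (P a m) = op_extension \<iota> (P a m) o\<^sub>L T"
  shows "T o\<^sub>L heisenberg \<iota> (L u) u = heisenberg \<iota> (L u) u o\<^sub>L T"
proof (rule blinfun_eqI, unfold blinfun_apply_blinfun_compose, rule eq_if_ip_eq)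
  fix x y
  obtain W where W: "\<And>x y. ip y (blinfun_apply T x) = ip (W y) x" using adjointable_obtains_adjoint[OF T] by blast
  define D where "D \<xi> = ip y (T (heisenberg \<iota> (L \<xi>) \<xi> x)) - ip y (heisenberg \<iota> (L \<xi>) \<xi> (T x))" for \<xi>
  \<comment> \<open>The kernels may carry any coefficient from the algebra, and it may depend on
    \<open>x\<close> and \<open>y\<close>. This choice turns \<open>D u * a = 0\<close> into
    \<open>D u = 0\<close> in the absence of a unit.\<close>
  define a where "a = star (D u)"
  have "D u * a = 0"
  proof (rule integral_gaussian_approximation)
    show "continuous_on UNIV D"
      unfolding D_def W by (intro continuous_intros continuous_ip_heisenberg L)
    show "norm (D \<xi>) \<le> 4 * (norm (W y) * norm x) + 4 * (norm y * norm (T x))" for \<xi>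
      unfolding D_def W
      by (rule order_trans[OF norm_triangle_ineq4])
        (intro add_mono order_trans[OF norm_ip_le]; simp add: norm_heisenberg)
    fix m :: nat assume m: "0 < m"
    let ?k = "\<lambda>\<xi>. exp (- (norm (real m *\<^sub>R (\<xi> - u)))\<^sup>2 / 2) *\<^sub>R a"
    have cont_k: "continuous_on UNIV ?k" by (intro continuous_intros) auto
    have "(\<lambda>x. exp (- ((real m)\<^sup>2 / 2) * (norm x)\<^sup>2)) \<in> (schwartz :: (real^'n \<Rightarrow> real) set)"
      using m by (intro gaussian_schwartz) simp
    from schwartz_bounded_linear[OF bounded_linear_scaleR_left schwartz_translate[OF this, of "-u"], of a]
    have "?k \<in> schwartz" by (simp add: power_mult_distrib)
    then have int_k: "integrable lborel ?k" by (rule schwartz_integrable)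
    show "(\<integral>\<xi>. D \<xi> * ?k \<xi> \<partial>lborel) = 0"
      unfolding D_def
      by (rule kernel_form_commute[OF L cont_k int_k P_schwartz[OF m] P_eq[OF m] W c[OF m] comm[OF m]])
  qed
  then have "D u = 0" unfolding a_def by (rule eq_0_if_mult_star)
  then show "ip y (T (heisenberg \<iota> (L u) u x)) = ip y (heisenberg \<iota> (L u) u (T x))"
    by (simp add: D_def)
qed

end

section \<open>Oscillatory integrals\<close>

text \<open>The inner integral at cutoff scale \<open>\<epsilon>\<close>. Setting
  \<open>\<epsilon> = 0\<close> with \<open>K 0 = 1\<close> gives the unregularized integral, so
  limit and approximations share one formula. \<open>K\<close> need not be normalized, because
  derivatives of the cutoff will take its place.\<close>

definition osc_inner ::
    "('v::euclidean_space \<times> 'v \<Rightarrow> complex) \<Rightarrow> ('v \<Rightarrow> 'a) \<Rightarrow> real \<Rightarrow> 'v \<Rightarrow> 'a::{cstar_algebra,second_countable_topology}" where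
  "osc_inner K G \<epsilon> u = (\<integral>v. cis (u \<bullet> v) *\<^sub>C (K (\<epsilon> *\<^sub>R (u, v)) *\<^sub>C G v) \<partial>lborel)"

lemma osc_inner_integrand:
  fixes G :: "'v::euclidean_space \<Rightarrow> 'a::{cstar_algebra,second_countable_topology}"
  assumes K: "K \<in> CB_infinity" and G: "G \<in> schwartz"
  shows osc_inner_continuous: "continuous_on UNIV (\<lambda>v. cis (u \<bullet> v) *\<^sub>C (K (\<epsilon> *\<^sub>R (u, v)) *\<^sub>C G v))"
    and osc_inner_integrable: "integrable lborel (\<lambda>v. cis (u \<bullet> v) *\<^sub>C (K (\<epsilon> *\<^sub>R (u, v)) *\<^sub>C G v))"
proof -
  have contK: "continuous_on UNIV K" and contG: "continuous_on UNIV G"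
    using K G by (auto intro: smooth_continuous schwartz_smooth CB_infinity_smooth)
  show cont: "continuous_on UNIV (\<lambda>v. cis (u \<bullet> v) *\<^sub>C (K (\<epsilon> *\<^sub>R (u, v)) *\<^sub>C G v))"
    by (intro continuous_intros scaleC.continuous_on contG continuous_on_compose2[OF contK]) auto
  obtain C where C: "C \<ge> 0" "\<And>x. norm (K x) \<le> C" using CB_infinity_bounded[OF K] by blast
  show "integrable lborel (\<lambda>v. cis (u \<bullet> v) *\<^sub>C (K (\<epsilon> *\<^sub>R (u, v)) *\<^sub>C G v))"
  proof (rule Bochner_Integration.integrable_bound)
    show "integrable lborel (\<lambda>v. C * norm (G v))" using schwartz_integrable[OF G] by simp
    show "AE v in lborel. norm (cis (u \<bullet> v) *\<^sub>C (K (\<epsilon> *\<^sub>R (u, v)) *\<^sub>C G v)) \<le> norm (C * norm (G v))"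
      using C by (intro AE_I2) (auto simp: norm_scaleC intro!: mult_right_mono)
  qed (use borel_measurable_continuous_onI[OF cont] in simp)
qed

text \<open>The \<open>v\<close>-derivative of the whole integrand has integral 0. Its three terms
  come from the phase, which contributes the factor \<open>\<i> * (u \<bullet> b)\<close>, from
  \<open>K\<close>, where the chain rule contributes \<open>\<epsilon>\<close>, and from
  \<open>G\<close>.\<close>

lemma osc_inner_by_parts:
  fixes G :: "'v::euclidean_space \<Rightarrow> 'a::{cstar_algebra,second_countable_topology}"
  assumes K: "K \<in> CB_infinity" and G: "G \<in> schwartz" and b: "b \<in> Basis"
  shows "(\<i> * (u \<bullet> b)) *\<^sub>C osc_inner K G \<epsilon> u =
    - (\<epsilon> *\<^sub>R osc_inner (partial (0, b) K) G \<epsilon> u + osc_inner K (partial b G) \<epsilon> u)"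
proof -
  have b': "(0, b) \<in> (Basis :: ('v \<times> 'v) set)" using b by (simp add: Basis_prod_def)
  note K' = CB_infinity_partial[OF K b'] and G' = schwartz_partial[OF G b]
  let ?c = "\<lambda>v. cis (u \<bullet> v)" and ?K = "\<lambda>v. K (\<epsilon> *\<^sub>R (u, v))"
  let ?f = "\<lambda>v. ?c v *\<^sub>C (?K v *\<^sub>C G v)"
  define D where "D v h = ?c v *\<^sub>C (?K v *\<^sub>C frechet_derivative G (at v) h
      + frechet_derivative K (at (\<epsilon> *\<^sub>R (u, v))) (0, \<epsilon> *\<^sub>R h) *\<^sub>C G v)
      + ((u \<bullet> h) *\<^sub>R (\<i> * ?c v)) *\<^sub>C (?K v *\<^sub>C G v)" for v h
  have der: "(?f has_derivative D v) (at v)" for v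
    unfolding D_def
  proof (intro scaleC.FDERIV)
    show "(?c has_derivative (\<lambda>h. (u \<bullet> h) *\<^sub>R (\<i> * ?c v))) (at v)"
      by (intro has_derivative_cis has_derivative_inner_right has_derivative_ident)
    have "((\<lambda>v. \<epsilon> *\<^sub>R (u, v)) has_derivative (\<lambda>h. (0, \<epsilon> *\<^sub>R h))) (at v)"
      by (auto intro!: derivative_eq_intros)
    then show "(?K has_derivative (\<lambda>h. frechet_derivative K (at (\<epsilon> *\<^sub>R (u, v))) (0, \<epsilon> *\<^sub>R h))) (at v)"
      by (rule has_derivative_compose[OF _ smooth_has_derivative[OF CB_infinity_smooth[OF K]]])
    show "(G has_derivative frechet_derivative G (at v)) (at v)"
      by (rule smooth_has_derivative[OF schwartz_smooth[OF G]])
  qed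
  have K0: "frechet_derivative K (at w) (0, \<epsilon> *\<^sub>R b) = \<epsilon> *\<^sub>R partial (0, b) K w" for w
    using linear_cmul[OF has_derivative_linear[OF smooth_has_derivative[OF CB_infinity_smooth[OF K]]], of w \<epsilon> "(0, b)"]
    by (simp add: partial_def)
  have Db: "D v b = ?c v *\<^sub>C (?K v *\<^sub>C partial b G v)
      + \<epsilon> *\<^sub>R (?c v *\<^sub>C (partial (0, b) K (\<epsilon> *\<^sub>R (u, v)) *\<^sub>C G v))
      + (\<i> * (u \<bullet> b)) *\<^sub>C ?f v" for v
    unfolding D_def K0
    by (simp add: partial_def scaleC_add_right scaleC.scaleR_left scaleC.scaleR_right scaleC_scaleC
        scaleR_scaleC mult_ac scaleR_conv_of_real)
  obtain A where A: "A \<ge> 0" "\<And>w. norm (K w) \<le> A" using CB_infinity_bounded[OF K] by blast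
  obtain A' where A': "A' \<ge> 0" "\<And>w. norm (partial (0, b) K w) \<le> A'" using CB_infinity_bounded[OF K'] by blast
  obtain B where B: "B \<ge> 0" "\<And>w. norm (G w) \<le> B * decay_weight w" using schwartz_decay_weight[OF G] by blast
  obtain B' where B': "B' \<ge> 0" "\<And>w. norm (partial b G w) \<le> B' * decay_weight w"
    using schwartz_decay_weight[OF G'] by blast
  note int1 = osc_inner_integrable[OF K G', of u \<epsilon>] and int2 = osc_inner_integrable[OF K' G, of u \<epsilon>]
    and int3 = osc_inner_integrable[OF K G, of u \<epsilon>]
  have "0 = (\<integral>v. D v b \<partial>lborel)"
  proof (rule integral_derivative_eq_0[symmetric, OF der])
    show "integrable lborel ?f" by (rule int3)
    show "norm b \<le> 1" using b by simp
    show "(\<lambda>v. D v b) \<in> borel_measurable borel"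
      unfolding Db by (intro borel_measurable_continuous_onI continuous_intros osc_inner_continuous
        K G K' G' scaleC.continuous_on)
    show "norm (D v b) \<le> (A * B' + \<bar>\<epsilon>\<bar> * (A' * B) + \<bar>u \<bullet> b\<bar> * (A * B)) * decay_weight v" for v
    proof -
      have bd: "norm (?c v *\<^sub>C (k *\<^sub>C g)) \<le> a * (b * decay_weight v)"
        if "norm k \<le> a" "norm g \<le> b * decay_weight v" "0 \<le> a" for k g a b
        using that by (auto simp: norm_scaleC intro!: mult_mono)
      have "norm (D v b) \<le> A * (B' * decay_weight v) + \<bar>\<epsilon>\<bar> * (A' * (B * decay_weight v))
          + \<bar>u \<bullet> b\<bar> * (A * (B * decay_weight v))"
        unfolding Db
        by (intro order_trans[OF norm_triangle_ineq] add_mono bd A B' )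
          (auto simp: norm_scaleC[of "_ * _"] norm_mult intro!: mult_left_mono bd A B A')
      then show ?thesis by (simp add: algebra_simps)
    qed
  qed
  also have "\<dots> = osc_inner K (partial b G) \<epsilon> u + \<epsilon> *\<^sub>R osc_inner (partial (0, b) K) G \<epsilon> u
      + (\<i> * (u \<bullet> b)) *\<^sub>C osc_inner K G \<epsilon> u"
    unfolding Db osc_inner_def
    using int1 int2 int3 integrable_bounded_linear[OF scaleC.bounded_linear_right int3, of "\<i> * (u \<bullet> b)"]
    by (simp add: integral_scaleC_right)
  finally show ?thesis
    by (simp add: eq_neg_iff_add_eq_0 add_ac del: minus_add_distrib)
qed

text \<open>The bound is uniform in \<open>\<epsilon>\<close>, and each step of the induction trades one power of \<open>u\<close> for a
  derivative of \<open>K\<close> or \<open>G\<close>; a derivative of \<open>K\<close> brings out a harmless factor \<open>\<epsilon>\<close>.\<close>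

lemma osc_inner_decay:
  fixes G :: "'v::euclidean_space \<Rightarrow> 'a::{cstar_algebra,second_countable_topology}"
  assumes "K \<in> CB_infinity" "G \<in> schwartz"
  shows "\<exists>C\<ge>0. \<forall>\<epsilon>\<in>{0..1}. \<forall>u. norm u ^ m * norm (osc_inner K G \<epsilon> u) \<le> C"
  using assms
proof (induction m arbitrary: K G)
  case 0
  obtain A where A: "A \<ge> 0" "\<And>w. norm (K w) \<le> A" using CB_infinity_bounded[OF 0(1)] by blast
  have "norm (osc_inner K G \<epsilon> u) \<le> (\<integral>v. A * norm (G v) \<partial>lborel)" for \<epsilon> u
    unfolding osc_inner_def
  proof (rule order_trans[OF integral_norm_bound], rule integral_mono)
    show "integrable lborel (\<lambda>v. norm (cis (u \<bullet> v) *\<^sub>C (K (\<epsilon> *\<^sub>R (u, v)) *\<^sub>C G v)))"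
      by (intro integrable_norm osc_inner_integrable[OF 0])
    show "integrable lborel (\<lambda>v. A * norm (G v))" using schwartz_integrable[OF 0(2)] by simp
    show "norm (cis (u \<bullet> v) *\<^sub>C (K (\<epsilon> *\<^sub>R (u, v)) *\<^sub>C G v)) \<le> A * norm (G v)" for v
      using A by (auto simp: norm_scaleC intro!: mult_right_mono)
  qed
  then show ?case using A by (intro exI[of _ "\<integral>v. A * norm (G v) \<partial>lborel"]) auto
next
  case (Suc m)
  have "\<exists>C\<ge>0. \<forall>\<epsilon>\<in>{0..1}. \<forall>u. norm u ^ m * (\<bar>u \<bullet> b\<bar> * norm (osc_inner K G \<epsilon> u)) \<le> C" if b: "b \<in> Basis" for b
  proof -
    have b': "(0, b) \<in> (Basis :: ('v \<times> 'v) set)" using b by (simp add: Basis_prod_def)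
    obtain C where C: "C \<ge> 0" "\<And>\<epsilon> u. \<epsilon> \<in> {0..1} \<Longrightarrow> norm u ^ m * norm (osc_inner (partial (0, b) K) G \<epsilon> u) \<le> C"
      using Suc.IH[OF CB_infinity_partial[OF Suc.prems(1) b'] Suc.prems(2)] by blast
    obtain C' where C': "C' \<ge> 0" "\<And>\<epsilon> u. \<epsilon> \<in> {0..1} \<Longrightarrow> norm u ^ m * norm (osc_inner K (partial b G) \<epsilon> u) \<le> C'"
      using Suc.IH[OF Suc.prems(1) schwartz_partial[OF Suc.prems(2) b]] by blast
    have "norm u ^ m * (\<bar>u \<bullet> b\<bar> * norm (osc_inner K G \<epsilon> u)) \<le> C + C'" if e: "\<epsilon> \<in> {0..1}" for \<epsilon> u
    proof -
      have "\<bar>u \<bullet> b\<bar> * norm (osc_inner K G \<epsilon> u) = norm ((\<i> * (u \<bullet> b)) *\<^sub>C osc_inner K G \<epsilon> u)"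
        by (simp add: norm_scaleC norm_mult)
      also have "\<dots> \<le> norm (\<epsilon> *\<^sub>R osc_inner (partial (0, b) K) G \<epsilon> u) + norm (osc_inner K (partial b G) \<epsilon> u)"
        unfolding osc_inner_by_parts[OF Suc.prems b] norm_minus_cancel by (rule norm_triangle_ineq)
      also have "norm (\<epsilon> *\<^sub>R osc_inner (partial (0, b) K) G \<epsilon> u) \<le> norm (osc_inner (partial (0, b) K) G \<epsilon> u)"
        using e by (auto intro!: mult_left_le_one_le)
      finally have "norm u ^ m * (\<bar>u \<bullet> b\<bar> * norm (osc_inner K G \<epsilon> u)) \<le>
         norm u ^ m * (norm (osc_inner (partial (0, b) K) G \<epsilon> u) + norm (osc_inner K (partial b G) \<epsilon> u))"
        by (intro mult_left_mono) auto
      also have "\<dots> \<le> C + C'" using C(2)[OF e, of u] C'(2)[OF e, of u] by (simp add: distrib_left)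
      finally show ?thesis .
    qed
    then show ?thesis using C(1) C'(1) by (intro exI[of _ "C + C'"]) auto
  qed
  then obtain C where C: "\<And>b. b \<in> Basis \<Longrightarrow> C b \<ge> 0" "\<And>b \<epsilon> u. b \<in> Basis \<Longrightarrow> \<epsilon> \<in> {0..1} \<Longrightarrow>
      norm u ^ m * (\<bar>u \<bullet> b\<bar> * norm (osc_inner K G \<epsilon> u)) \<le> C b" by metis
  have "norm u ^ Suc m * norm (osc_inner K G \<epsilon> u) \<le> (\<Sum>b\<in>Basis. C b)" if e: "\<epsilon> \<in> {0..1}" for \<epsilon> u
  proof -
    have "norm u ^ Suc m * norm (osc_inner K G \<epsilon> u) = norm u * (norm u ^ m * norm (osc_inner K G \<epsilon> u))" by simp
    \<comment> \<open>The sum of the absolute coordinates dominates the norm, so one power of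
      \<open>norm u\<close> is spread over the directions in which integration by parts is
      available.\<close>
    also have "\<dots> \<le> (\<Sum>b\<in>Basis. \<bar>u \<bullet> b\<bar>) * (norm u ^ m * norm (osc_inner K G \<epsilon> u))"
      by (intro mult_right_mono norm_le_l1) auto
    also have "\<dots> = (\<Sum>b\<in>Basis. norm u ^ m * (\<bar>u \<bullet> b\<bar> * norm (osc_inner K G \<epsilon> u)))"
      by (simp add: sum_distrib_left sum_distrib_right mult.left_commute mult.commute)
    also have "\<dots> \<le> (\<Sum>b\<in>Basis. C b)" by (intro sum_mono C e)
    finally show ?thesis .
  qed
  then show ?case using C(1) by (intro exI[of _ "\<Sum>b\<in>Basis. C b"]) (auto intro: sum_nonneg)
qed

text \<open>The decay estimates of orders 0 and \<open>2 * DIM('v)\<close> together control the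
  weight. The constant serves all \<open>\<epsilon>\<close> in the unit interval, as dominated
  convergence for \<open>\<epsilon>\<close> tending to 0 requires.\<close>

lemma osc_inner_decay_weight:
  fixes G :: "'v::euclidean_space \<Rightarrow> 'a::{cstar_algebra,second_countable_topology}"
  assumes "K \<in> CB_infinity" "G \<in> schwartz"
  shows "\<exists>C\<ge>0. \<forall>\<epsilon>\<in>{0..1}. \<forall>u. norm (osc_inner K G \<epsilon> u) \<le> C * decay_weight u"
proof -
  obtain C0 where C0: "C0 \<ge> 0" "\<And>\<epsilon> u. \<epsilon> \<in> {0..1} \<Longrightarrow> norm (osc_inner K G \<epsilon> u) \<le> C0"
    using osc_inner_decay[OF assms, of 0] by auto
  obtain C1 where C1: "C1 \<ge> 0" "\<And>\<epsilon> u. \<epsilon> \<in> {0..1} \<Longrightarrow> norm u ^ (2 * DIM('v)) * norm (osc_inner K G \<epsilon> u) \<le> C1"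
    using osc_inner_decay[OF assms, of "2 * DIM('v)"] by blast
  have "norm (osc_inner K G \<epsilon> u) \<le> (2 ^ (2 * DIM('v)) * (C0 + C1)) * decay_weight u" if e: "\<epsilon> \<in> {0..1}" for \<epsilon> u
  proof (rule le_decay_weightI)
    have "(1 + norm u) ^ (2 * DIM('v)) * norm (osc_inner K G \<epsilon> u) \<le>
        (2 ^ (2 * DIM('v)) * (1 + norm u ^ (2 * DIM('v)))) * norm (osc_inner K G \<epsilon> u)"
      by (intro mult_right_mono one_plus_power_le) auto
    also have "\<dots> = 2 ^ (2 * DIM('v)) * (norm (osc_inner K G \<epsilon> u) + norm u ^ (2 * DIM('v)) * norm (osc_inner K G \<epsilon> u))"
      by (simp add: algebra_simps)
    also have "\<dots> \<le> 2 ^ (2 * DIM('v)) * (C0 + C1)"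
      by (intro mult_left_mono add_mono C0 C1 e) auto
    finally show "(1 + norm u) ^ (2 * DIM('v)) * norm (osc_inner K G \<epsilon> u) \<le> 2 ^ (2 * DIM('v)) * (C0 + C1)" .
  qed
  then show ?thesis using C0(1) C1(1) by (intro exI[of _ "2 ^ (2 * DIM('v)) * (C0 + C1)"]) auto
qed

lemma osc_inner_tendsto:
  fixes G :: "'v::euclidean_space \<Rightarrow> 'a::{cstar_algebra,second_countable_topology}"
  assumes K: "K \<in> CB_infinity" and G: "G \<in> schwartz" and e: "e \<longlonglongrightarrow> 0"
  shows "(\<lambda>n. osc_inner K G (e n) u) \<longlonglongrightarrow> osc_inner K G 0 u"
proof -
  obtain A where A: "A \<ge> 0" "\<And>w. norm (K w) \<le> A" using CB_infinity_bounded[OF K] by blast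
  show ?thesis
    unfolding osc_inner_def
  proof (rule integral_dominated_convergence)
    show "integrable lborel (\<lambda>v. A * norm (G v))" using schwartz_integrable[OF G] by simp
    show "AE v in lborel. norm (cis (u \<bullet> v) *\<^sub>C (K (e n *\<^sub>R (u, v)) *\<^sub>C G v)) \<le> A * norm (G v)" for n
      using A by (intro AE_I2) (auto simp: norm_scaleC intro!: mult_right_mono)
    have "isCont K w" for w
      using smooth_continuous[OF CB_infinity_smooth[OF K]]
      by (simp add: continuous_on_eq_continuous_at del: split_paired_All)
    then show "AE v in lborel. (\<lambda>n. cis (u \<bullet> v) *\<^sub>C (K (e n *\<^sub>R (u, v)) *\<^sub>C G v)) \<longlonglongrightarrow>
        cis (u \<bullet> v) *\<^sub>C (K (0 *\<^sub>R (u, v)) *\<^sub>C G v)"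
      by (intro AE_I2 scaleC.tendsto tendsto_const isCont_tendsto_compose[of _ K] tendsto_scaleR e)
    show "(\<lambda>v. cis (u \<bullet> v) *\<^sub>C (K (e n *\<^sub>R (u, v)) *\<^sub>C G v)) \<in> borel_measurable lborel" for n
      using borel_measurable_continuous_onI[OF osc_inner_continuous[OF K G]] by simp
    show "(\<lambda>v. cis (u \<bullet> v) *\<^sub>C (K (0 *\<^sub>R (u, v)) *\<^sub>C G v)) \<in> borel_measurable lborel"
      using borel_measurable_continuous_onI[OF osc_inner_continuous[OF K G]] by (simp only: measurable_lborel2)
  qed
qed

text \<open>At fixed positive \<open>\<epsilon>\<close> the cutoff makes the double integral
  absolutely convergent, so it can be iterated with \<open>v\<close> innermost. All decay in
  \<open>u\<close> that persists in the limit comes from \<open>G\<close>, through integration by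
  parts in \<open>v\<close>; \<open>F\<close> enters through its bound.\<close>

lemma has_osc_integral_double:
  fixes F :: "'v::euclidean_space \<Rightarrow> 'a::{cstar_algebra,second_countable_topology}"
  assumes contF: "continuous_on UNIV F" and bF: "\<And>u. norm (F u) \<le> B" and G: "G \<in> schwartz"
  shows "has_osc_integral (\<lambda>(u, v). cis (u \<bullet> v) *\<^sub>C (F u * G v))
    (\<integral>u. F u * (\<integral>v. cis (u \<bullet> v) *\<^sub>C G v \<partial>lborel) \<partial>lborel)"
  unfolding has_osc_integral_def
proof (intro allI impI, elim conjE)
  fix \<kappa> :: "'v \<times> 'v \<Rightarrow> complex" assume \<kappa>: "\<kappa> \<in> schwartz" and \<kappa>0: "\<kappa> 0 = 1"
  have \<kappa>': "\<kappa> \<in> CB_infinity" using \<kappa> schwartz_subset_CB_infinity by blast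
  have contG: "continuous_on UNIV G" and cont\<kappa>: "continuous_on UNIV \<kappa>"
    using G \<kappa> by (auto intro: smooth_continuous schwartz_smooth)
  have B: "B \<ge> 0" using order_trans[OF norm_ge_zero bF] .
  let ?h = "\<lambda>(u, v). cis (u \<bullet> v) *\<^sub>C (F u * G v)"
  let ?I = "\<lambda>\<epsilon> u. F u * osc_inner \<kappa> G \<epsilon> u"
  obtain C where C: "C \<ge> 0" "\<And>\<epsilon> u. \<epsilon> \<in> {0..1} \<Longrightarrow> norm (osc_inner \<kappa> G \<epsilon> u) \<le> C * decay_weight u"
    using osc_inner_decay_weight[OF \<kappa>' G] by blast
  have fubini: "(\<integral>w. \<kappa> (\<epsilon> *\<^sub>R w) *\<^sub>C ?h w \<partial>lborel) = (\<integral>u. ?I \<epsilon> u \<partial>lborel)"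
    and meas: "?I \<epsilon> \<in> borel_measurable borel"
    if e: "0 < \<epsilon>" "\<epsilon> \<le> 1" for \<epsilon>
  proof -
    let ?H = "\<lambda>w. \<kappa> (\<epsilon> *\<^sub>R w) *\<^sub>C ?h w"
    have contH: "continuous_on UNIV ?H"
      unfolding case_prod_beta'
      by (intro continuous_intros scaleC.continuous_on continuous_on_compose2[OF contG]
        continuous_on_compose2[OF contF] continuous_on_compose2[OF cont\<kappa>]) auto
    obtain K where K: "\<And>w. (1 + norm w) ^ (2 * DIM('v)) * norm (\<kappa> w) \<le> K"
      using schwartz_decay[OF \<kappa>] by blast
    have K0: "K \<ge> 0" using order_trans[OF _ K[of 0]] by simp
    \<comment> \<open>Integrability in \<open>u\<close> is taken from the cutoff, whose argument has
      norm at least \<open>\<epsilon> * norm u\<close>. The constant blows up as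
      \<open>\<epsilon>\<close> tends to 0, which is harmless: it is used only for Fubini's theorem
      at fixed \<open>\<epsilon>\<close>.\<close>
    have \<kappa>_le: "norm (\<kappa> (\<epsilon> *\<^sub>R (u, v))) \<le> (K * inverse (\<epsilon> ^ (2 * DIM('v)))) * decay_weight u" for u v
    proof (rule le_decay_weightI)
      have "\<epsilon> * norm u \<le> norm (\<epsilon> *\<^sub>R (u, v))"
        unfolding norm_scaleR using e norm_fst_le[of u v] by simp
      then have "\<epsilon> * (1 + norm u) \<le> 1 + norm (\<epsilon> *\<^sub>R (u, v))" using e by (simp add: distrib_left)
      then have "(\<epsilon> * (1 + norm u)) ^ (2 * DIM('v)) \<le> (1 + norm (\<epsilon> *\<^sub>R (u, v))) ^ (2 * DIM('v))"
        using e by (intro power_mono) auto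
      then have "(\<epsilon> * (1 + norm u)) ^ (2 * DIM('v)) * norm (\<kappa> (\<epsilon> *\<^sub>R (u, v))) \<le> K"
        by (intro order_trans[OF mult_right_mono K]) auto
      then have "\<epsilon> ^ (2 * DIM('v)) * ((1 + norm u) ^ (2 * DIM('v)) * norm (\<kappa> (\<epsilon> *\<^sub>R (u, v)))) \<le> K"
        unfolding power_mult_distrib mult.assoc .
      then show "(1 + norm u) ^ (2 * DIM('v)) * norm (\<kappa> (\<epsilon> *\<^sub>R (u, v))) \<le> K * inverse (\<epsilon> ^ (2 * DIM('v)))"
        using e unfolding divide_inverse[symmetric] by (subst pos_le_divide_eq) (auto simp: mult.commute)
    qed
    have intH: "integrable (lborel \<Otimes>\<^sub>M lborel) ?H"
    proof (rule integrable_product_bound)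
      show "?H \<in> borel_measurable borel" by (rule borel_measurable_continuous_onI[OF contH])
      show "integrable lborel (\<lambda>u::'v. (K * inverse (\<epsilon> ^ (2 * DIM('v)))) * decay_weight u)"
        by (intro integrable_mult_right decay_weight_integrable)
      show "integrable lborel (\<lambda>v. B * norm (G v))" using schwartz_integrable[OF G] by simp
      fix u v
      have "norm (F u * G v) \<le> B * norm (G v)"
        by (intro order_trans[OF norm_mult_ineq] mult_right_mono bF) auto
      then have "norm (\<kappa> (\<epsilon> *\<^sub>R (u, v))) * norm (F u * G v) \<le>
          (K * inverse (\<epsilon> ^ (2 * DIM('v)))) * decay_weight u * (B * norm (G v))"
        using \<kappa>_le[of u v] by (intro mult_mono) (auto intro: order_trans[OF norm_ge_zero])
      then show "norm (\<kappa> (\<epsilon> *\<^sub>R (u, v)) *\<^sub>C ?h (u, v)) \<le>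
          (K * inverse (\<epsilon> ^ (2 * DIM('v)))) * decay_weight u * (B * norm (G v))"
        by (simp add: norm_scaleC)
    qed
    have inner: "(\<integral>v. ?H (u, v) \<partial>lborel) = ?I \<epsilon> u" for u
    proof -
      have "?I \<epsilon> u = (\<integral>v. F u * (cis (u \<bullet> v) *\<^sub>C (\<kappa> (\<epsilon> *\<^sub>R (u, v)) *\<^sub>C G v)) \<partial>lborel)"
        unfolding osc_inner_def
        by (rule integral_bounded_linear[OF bounded_linear_mult_right osc_inner_integrable[OF \<kappa>' G], symmetric])
      also have "\<dots> = (\<integral>v. ?H (u, v) \<partial>lborel)"
        by (intro Bochner_Integration.integral_cong) (auto simp: mult_scaleC_right scaleC_scaleC mult.commute)
      finally show ?thesis by simp
    qed
    show "(\<integral>w. ?H w \<partial>lborel) = (\<integral>u. ?I \<epsilon> u \<partial>lborel)"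
      using lborel_pair.integral_fst'[OF intH] unfolding inner lborel_prod by simp
    show "?I \<epsilon> \<in> borel_measurable borel"
      using borel_measurable_integrable[OF lborel_pair.integrable_fst'[OF intH]] unfolding inner by simp
  qed
  \<comment> \<open>The normalization \<open>\<kappa> 0 = 1\<close> identifies the claimed value
    with the case \<open>\<epsilon> = 0\<close>.\<close>
  have I0: "(\<integral>u. F u * (\<integral>v. cis (u \<bullet> v) *\<^sub>C G v \<partial>lborel) \<partial>lborel) = (\<integral>u. ?I 0 u \<partial>lborel)"
    unfolding osc_inner_def using \<kappa>0 by (simp add: zero_prod_def)
  show "((\<lambda>\<epsilon>. \<integral>w. \<kappa> (\<epsilon> *\<^sub>R w) *\<^sub>C ?h w \<partial>lborel) \<longlongrightarrow>
      (\<integral>u. F u * (\<integral>v. cis (u \<bullet> v) *\<^sub>C G v \<partial>lborel) \<partial>lborel)) (at_right 0)"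
    unfolding I0
  proof (rule tendsto_at_right_sequentially[of 0 1])
    fix e :: "nat \<Rightarrow> real" assume e: "\<And>n. 0 < e n" "\<And>n. e n < 1" "decseq e" "e \<longlonglongrightarrow> 0"
    have e': "0 < e n" "e n \<le> 1" for n using e(1,2)[of n] by auto
    have lim: "(\<lambda>n. ?I (e n) u) \<longlonglongrightarrow> ?I 0 u" for u
      by (intro tendsto_intros osc_inner_tendsto \<kappa>' G e)
    have "(\<lambda>n. \<integral>u. ?I (e n) u \<partial>lborel) \<longlonglongrightarrow> (\<integral>u. ?I 0 u \<partial>lborel)"
    proof (rule integral_dominated_convergence)
      show "integrable lborel (\<lambda>u::'v. B * (C * decay_weight u))"
        by (intro integrable_mult_right decay_weight_integrable)
      show "?I (e n) \<in> borel_measurable lborel" for n using meas[OF e'] by simp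
      show "?I 0 \<in> borel_measurable lborel"
        using borel_measurable_LIMSEQ_metric[of "\<lambda>n. ?I (e n)" borel "?I 0"] meas[OF e'] lim by simp
      show "AE u in lborel. norm (?I (e n) u) \<le> B * (C * decay_weight u)" for n
        using e'[of n] B by (intro AE_I2 order_trans[OF norm_mult_ineq] mult_mono bF C) auto
    qed (use lim in auto)
    then show "(\<lambda>n. \<integral>w. \<kappa> (e n *\<^sub>R w) *\<^sub>C ?h w \<partial>lborel) \<longlonglongrightarrow> (\<integral>u. ?I 0 u \<partial>lborel)"
      using fubini[OF e'] by simp
  qed simp
qed

text \<open>Uniqueness requires that some admissible cutoff exists, since otherwise the defining
  condition would be vacuous. A Gaussian is one, and limits along it are unique.\<close>

lemma osc_integral_eq:
  assumes "has_osc_integral g I"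
  shows "osc_integral g = I"
  unfolding osc_integral_def
proof (rule the_equality, rule assms)
  fix I' assume I': "has_osc_integral g I'"
  let ?\<kappa> = "\<lambda>x. complex_of_real (exp (- 1 * (norm x)\<^sup>2))"
  have "?\<kappa> \<in> schwartz"
    by (intro schwartz_bounded_linear[OF bounded_linear_of_real] gaussian_schwartz) simp
  then have "((\<lambda>\<epsilon>. \<integral>w. ?\<kappa> (\<epsilon> *\<^sub>R w) *\<^sub>C g w \<partial>lborel) \<longlongrightarrow> I) (at_right 0)"
    "((\<lambda>\<epsilon>. \<integral>w. ?\<kappa> (\<epsilon> *\<^sub>R w) *\<^sub>C g w \<partial>lborel) \<longlongrightarrow> I') (at_right 0)"
    using assms I' unfolding has_osc_integral_def by auto
  then show "I' = I" by (intro tendsto_unique[OF trivial_limit_at_right_real])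
qed

section \<open>The deformed product as a pseudodifferential operator\<close>

lemma continuous_fourier:
  fixes G :: "real^'n \<Rightarrow> 'a::{cstar_algebra,second_countable_topology}"
  assumes G: "G \<in> schwartz"
  shows "continuous_on UNIV (fourier G)"
proof -
  have contG: "continuous_on UNIV G" by (intro smooth_continuous schwartz_smooth G)
  have meas: "(\<lambda>y. cis (- (\<xi> \<bullet> y)) *\<^sub>C G y) \<in> borel_measurable lborel" for \<xi>
    unfolding measurable_lborel2
    by (intro borel_measurable_continuous_onI continuous_intros scaleC.continuous_on contG)
  have "continuous_on UNIV (\<lambda>\<xi>. \<integral>y. cis (- (\<xi> \<bullet> y)) *\<^sub>C G y \<partial>lborel)"
    unfolding continuous_on_sequentially comp_def
  proof (intro allI ballI impI, elim conjE)
    fix v :: "nat \<Rightarrow> real^'n" and u assume v: "v \<longlonglongrightarrow> u"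
    show "(\<lambda>n. \<integral>y. cis (- (v n \<bullet> y)) *\<^sub>C G y \<partial>lborel) \<longlonglongrightarrow> (\<integral>y. cis (- (u \<bullet> y)) *\<^sub>C G y \<partial>lborel)"
      by (rule integral_dominated_convergence[where w="\<lambda>y. norm (G y)"])
        (use meas schwartz_integrable[OF G] v in
          \<open>auto simp: norm_scaleC intro!: tendsto_intros scaleC.tendsto tendsto_cis\<close>)
  qed
  then show ?thesis unfolding fourier_def by (intro continuous_intros)
qed

text \<open>The inner oscillatory integral is the Fourier transform of \<open>G\<close>, at \<open>\<xi> = - u\<close>.\<close>

lemma deformed_product_eq_pseudodiff:
  fixes F :: "real^'n \<Rightarrow> 'a::{cstar_algebra,second_countable_topology}"
  assumes F: "F \<in> CB_infinity" and G: "G \<in> schwartz"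
  shows "deformed_product J F G x = pseudodiff (\<lambda>(x, \<xi>). F (x - J *v \<xi>)) G x"
proof -
  define p where "p = (2 * pi) powr (- real CARD('n) / 2)"
  \<comment> \<open>The constant of the deformed product is split evenly: one factor belongs to the
    Fourier transform, the other to the operator built from it.\<close>
  have pp: "(2 * pi) powr (- real CARD('n)) = p * p" by (simp add: p_def powr_add[symmetric])
  have p0: "p > 0" by (simp add: p_def)
  have contF: "continuous_on UNIV F" by (intro smooth_continuous CB_infinity_smooth F)
  have contJ: "continuous_on UNIV ((*v) J)" by (intro linear_continuous_on matrix_vector_mul_bounded_linear)
  obtain B where B: "\<And>x. norm (F x) \<le> B" using CB_infinity_bounded[OF F] by blast
  have G': "(\<lambda>v. G (x + v)) \<in> schwartz" using schwartz_translate[OF G, of x] by (simp add: add.commute)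
  have contG: "continuous_on UNIV G" by (intro smooth_continuous schwartz_smooth G)
  let ?q = "\<lambda>\<xi>. cis (x \<bullet> \<xi>) *\<^sub>C (F (x - J *v \<xi>) * fourier G \<xi>)"
  \<comment> \<open>The substitution \<open>y = x + v\<close> produces the Fourier transform at
    \<open>- u\<close> and leaves the phase that becomes
    \<open>cis (x \<bullet> \<xi>)\<close>.\<close>
  have inner: "p *\<^sub>R (\<integral>v. cis (u \<bullet> v) *\<^sub>C G (x + v) \<partial>lborel) = cis (- (u \<bullet> x)) *\<^sub>C fourier G (- u)" for u
  proof -
    let ?r = "\<lambda>y. cis (u \<bullet> (y - x)) *\<^sub>C G y"
    have "continuous_on UNIV ?r" by (intro continuous_intros scaleC.continuous_on contG)
    from integral_translate[OF borel_measurable_continuous_onI[OF this], of x]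
    have "(\<integral>v. cis (u \<bullet> v) *\<^sub>C G (x + v) \<partial>lborel) = (\<integral>y. ?r y \<partial>lborel)" by (simp add: add.commute)
    also have "\<dots> = (\<integral>y. cis (- (u \<bullet> x)) *\<^sub>C (cis (u \<bullet> y) *\<^sub>C G y) \<partial>lborel)"
      by (simp add: inner_diff_right scaleC_scaleC cis_mult)
    also have "\<dots> = cis (- (u \<bullet> x)) *\<^sub>C (\<integral>y. cis (u \<bullet> y) *\<^sub>C G y \<partial>lborel)" by (rule integral_scaleC_right)
    finally show ?thesis by (simp add: fourier_def p_def scaleC.scaleR_right)
  qed
  have "has_osc_integral (\<lambda>(u, v). cis (u \<bullet> v) *\<^sub>C (F (x + J *v u) * G (x + v)))
      (\<integral>u. F (x + J *v u) * (\<integral>v. cis (u \<bullet> v) *\<^sub>C G (x + v) \<partial>lborel) \<partial>lborel)"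
    by (intro has_osc_integral_double[where F="\<lambda>u. F (x + J *v u)" and G="\<lambda>v. G (x + v)", OF _ B G']
        continuous_on_compose2[OF contF] continuous_intros contJ) auto
  then have "deformed_product J F G x =
      p *\<^sub>R p *\<^sub>R (\<integral>u. F (x + J *v u) * (\<integral>v. cis (u \<bullet> v) *\<^sub>C G (x + v) \<partial>lborel) \<partial>lborel)"
    unfolding deformed_product_def pp by (simp add: osc_integral_eq)
  also have "\<dots> = p *\<^sub>R (\<integral>u. F (x + J *v u) * (p *\<^sub>R (\<integral>v. cis (u \<bullet> v) *\<^sub>C G (x + v) \<partial>lborel)) \<partial>lborel)"
    by simp
  also have "\<dots> = p *\<^sub>R (\<integral>u. ?q (- u) \<partial>lborel)"
    unfolding inner
    by (simp add: mult_scaleC_right inner_commute linear_neg[OF matrix_vector_mul_linear])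
  \<comment> \<open>The reflection \<open>\<xi> = - u\<close> turns \<open>x + J *v u\<close> into
    \<open>x - J *v \<xi>\<close>; this is the origin of the sign in the symbol.\<close>
  also have "(\<integral>u. ?q (- u) \<partial>lborel) = (\<integral>\<xi>. ?q \<xi> \<partial>lborel)"
  proof (rule integral_reflect)
    show "?q \<in> borel_measurable borel"
      by (intro borel_measurable_continuous_onI continuous_intros scaleC.continuous_on continuous_fourier G
          continuous_on_compose2[OF contF] contJ) auto
  qed
  finally show ?thesis by (simp add: pseudodiff_def p_def)
qed

section \<open>The symbol of an operator commuting with right multiplications\<close>

lemma fourier_heisenberg_fun:
  fixes f :: "real^'n \<Rightarrow> 'a::{cstar_algebra,second_countable_topology}"
  assumes f: "f \<in> schwartz"
  shows "fourier (heisenberg_fun 1 z \<zeta> f) \<xi> = cis (- ((\<xi> - \<zeta>) \<bullet> z)) *\<^sub>C fourier f (\<xi> - \<zeta>)"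
proof -
  have contf: "continuous_on UNIV f" by (intro smooth_continuous schwartz_smooth f)
  let ?g = "\<lambda>y. cis (- (\<xi> \<bullet> y)) *\<^sub>C heisenberg_fun 1 z \<zeta> f y"
  have "continuous_on UNIV ?g"
    by (intro continuous_intros scaleC.continuous_on smooth_continuous schwartz_smooth heisenberg_fun_schwartz f)
  from integral_translate[OF borel_measurable_continuous_onI[OF this], of z]
  have "(\<integral>y. ?g y \<partial>lborel) = (\<integral>y. ?g (y + z) \<partial>lborel)" by simp
  also have "(\<lambda>y. ?g (y + z)) = (\<lambda>y. cis (- ((\<xi> - \<zeta>) \<bullet> z)) *\<^sub>C (cis (- ((\<xi> - \<zeta>) \<bullet> y)) *\<^sub>C f y))"
    by (simp add: heisenberg_fun_def scaleC_scaleC cis_mult inner_diff_left inner_add_right algebra_simps)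
  finally show ?thesis by (simp add: fourier_def integral_scaleC_right scaleC.scaleR_right)
qed

text \<open>Modulation shifts the Fourier transform by \<open>\<zeta>\<close>, which the
  substitution of \<open>\<xi> + \<zeta>\<close> for \<open>\<xi>\<close> undoes at the price of
  shifting the symbol. Translation by \<open>z\<close> leaves a phase that turns evaluation at
  \<open>x\<close> into evaluation at \<open>x - z\<close>, so the first argument of the symbol is
  shifted by \<open>z\<close>.\<close>

lemma pseudodiff_heisenberg_fun:
  fixes f :: "real^'n \<Rightarrow> 'a::{cstar_algebra,second_countable_topology}"
  assumes a: "a \<in> CB_infinity" and f: "f \<in> schwartz"
  shows "pseudodiff a (heisenberg_fun 1 z \<zeta> f) =
    heisenberg_fun 1 z \<zeta> (pseudodiff (\<lambda>w. a (w + (z, \<zeta>))) f)"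
proof
  fix x
  have conta: "continuous_on UNIV a" by (intro smooth_continuous CB_infinity_smooth a)
  let ?g = "\<lambda>\<xi>. cis (x \<bullet> \<xi>) *\<^sub>C (a (x, \<xi>) * fourier (heisenberg_fun 1 z \<zeta> f) \<xi>)"
  have "continuous_on UNIV ?g"
    by (intro continuous_intros scaleC.continuous_on continuous_fourier heisenberg_fun_schwartz f
        continuous_on_compose2[OF conta]) auto
  from integral_translate[OF borel_measurable_continuous_onI[OF this], of \<zeta>]
  have "(\<integral>\<xi>. ?g \<xi> \<partial>lborel) = (\<integral>\<xi>. ?g (\<xi> + \<zeta>) \<partial>lborel)" by simp
  also have "(\<lambda>\<xi>. ?g (\<xi> + \<zeta>)) =
      (\<lambda>\<xi>. cis (\<zeta> \<bullet> x) *\<^sub>C (cis ((x - z) \<bullet> \<xi>) *\<^sub>C (a (x, \<xi> + \<zeta>) * fourier f \<xi>)))"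
    by (simp add: fourier_heisenberg_fun[OF f] mult_scaleC_right scaleC_scaleC cis_mult inner_diff_left
        inner_add_right inner_commute[of \<zeta>] inner_commute[of _ z] algebra_simps)
  finally show "pseudodiff a (heisenberg_fun 1 z \<zeta> f) x =
      heisenberg_fun 1 z \<zeta> (pseudodiff (\<lambda>w. a (w + (z, \<zeta>))) f) x"
    by (simp add: pseudodiff_def heisenberg_fun_def integral_scaleC_right scaleC.scaleR_right)
qed

text \<open>A packet of frequency \<open>u\<close> and width \<open>m\<close> is concentrated at
  \<open>u\<close> with width \<open>1 / m\<close> on the Fourier side. The normalization of the
  transform cancels the mass of the Gaussian exactly, and only the Jacobian
  \<open>m ^ CARD('n)\<close> remains.\<close>

lemma fourier_gaussian:
  fixes u :: "real^'n" and a :: "'a::{cstar_algebra,second_countable_topology}"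
  assumes m: "m > 0"
  shows "fourier (\<lambda>y. cis (u \<bullet> y) *\<^sub>C (exp (- (norm (inverse m *\<^sub>R y))\<^sup>2 / 2) *\<^sub>R a)) \<xi> =
    m ^ CARD('n) *\<^sub>R (exp (- (norm (m *\<^sub>R (\<xi> - u)))\<^sup>2 / 2) *\<^sub>R a)"
proof -
  let ?e = "\<lambda>y::real^'n. exp (- (norm y)\<^sup>2 / 2)"
  let ?g = "\<lambda>y::real^'n. cis ((u - \<xi>) \<bullet> y) * complex_of_real (?e (inverse m *\<^sub>R y))"
  have cont: "continuous_on UNIV ?g" by (intro continuous_intros) auto
  have e: "?e \<in> schwartz" using gaussian_schwartz[of "1/2", where 'v="real^'n"] by simp
  have "(\<lambda>y::real^'n. exp (- (inverse (2 * m\<^sup>2)) * (norm y)\<^sup>2)) \<in> schwartz"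
    using m by (intro gaussian_schwartz) simp
  then have "(\<lambda>y::real^'n. ?e (inverse m *\<^sub>R y)) \<in> schwartz"
    using m by (simp add: power_mult_distrib field_simps)
  from schwartz_integrable[OF schwartz_bilinear[OF bounded_bilinear_mult cis_inner_CB_infinity
      schwartz_bounded_linear[OF bounded_linear_of_real this]], of "u - \<xi>"]
  have int: "integrable lborel ?g" by simp
  have "(\<integral>y. ?g y \<partial>lborel) = \<bar>m\<bar> ^ DIM(real^'n) *\<^sub>R (\<integral>y. ?g (m *\<^sub>R y) \<partial>lborel)"
    using m by (intro integral_scale borel_measurable_continuous_onI[OF cont]) simp
  also have "(\<integral>y. ?g (m *\<^sub>R y) \<partial>lborel) = (\<integral>y. cis ((m *\<^sub>R (u - \<xi>)) \<bullet> y) * complex_of_real (?e y) \<partial>lborel)"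
    using m by simp
  also have "\<dots> = sqrt (2 * pi) ^ DIM(real^'n) * ?e (m *\<^sub>R (u - \<xi>))"
    by (rule integral_gaussian_cis)
  also have "?e (m *\<^sub>R (u - \<xi>)) = ?e (m *\<^sub>R (\<xi> - u))" by (simp add: norm_minus_commute)
  finally have G: "(\<integral>y. ?g y \<partial>lborel) =
      complex_of_real (m ^ CARD('n) * (sqrt (2 * pi) ^ CARD('n) * ?e (m *\<^sub>R (\<xi> - u))))"
    using m by (simp add: scaleR_conv_of_real)
  have p: "(2 * pi) powr (- real CARD('n) / 2) * sqrt (2 * pi) ^ CARD('n) = 1"
  proof -
    have "sqrt (2 * pi) ^ CARD('n) = (2 * pi) powr (real CARD('n) / 2)"
      by (simp add: powr_half_sqrt[symmetric] powr_realpow[symmetric] powr_powr)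
    then show ?thesis by (simp add: powr_add[symmetric])
  qed
  have "fourier (\<lambda>y. cis (u \<bullet> y) *\<^sub>C (?e (inverse m *\<^sub>R y) *\<^sub>R a)) \<xi> =
      (2 * pi) powr (- real CARD('n) / 2) *\<^sub>R (\<integral>y. ?g y *\<^sub>C a \<partial>lborel)"
  proof -
    have "cis (- (\<xi> \<bullet> y)) *\<^sub>C (cis (u \<bullet> y) *\<^sub>C (r *\<^sub>R a)) = (cis ((u - \<xi>) \<bullet> y) * complex_of_real r) *\<^sub>C a" for y r
      by (simp add: scaleC_of_real[symmetric] scaleC_scaleC mult.assoc[symmetric] cis_mult inner_diff_left)
    then show ?thesis unfolding fourier_def by simp
  qed
  also have "(\<integral>y. ?g y *\<^sub>C a \<partial>lborel) = (\<integral>y. ?g y \<partial>lborel) *\<^sub>C a" by (rule integral_scaleC_left[OF int])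
  also have "\<dots> = (sqrt (2 * pi) ^ CARD('n)) *\<^sub>R (m ^ CARD('n) *\<^sub>R (?e (m *\<^sub>R (\<xi> - u)) *\<^sub>R a))"
    unfolding G scaleC_of_real by simp
  finally show ?thesis using p by (simp add: mult.assoc[symmetric])
qed

lemma gaussian_packet_schwartz:
  fixes u :: "real^'n" and a :: "'a::cstar_algebra"
  assumes m: "m > 0"
  shows "(\<lambda>y. cis (u \<bullet> y) *\<^sub>C (exp (- (norm (inverse m *\<^sub>R y))\<^sup>2 / 2) *\<^sub>R a)) \<in> schwartz"
proof -
  have "(\<lambda>y::real^'n. exp (- (inverse (2 * m\<^sup>2)) * (norm y)\<^sup>2)) \<in> schwartz"
    using m by (intro gaussian_schwartz) simp
  then have "(\<lambda>y::real^'n. exp (- (norm (inverse m *\<^sub>R y))\<^sup>2 / 2)) \<in> schwartz"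
    using m by (simp add: power_mult_distrib field_simps)
  then show ?thesis
    by (intro schwartz_bilinear[OF bounded_bilinear_scaleC cis_inner_CB_infinity]
        schwartz_bounded_linear[OF bounded_linear_scaleR_left])
qed

text \<open>The map from \<open>(x, \<xi>)\<close> to \<open>x - J *v \<xi>\<close> is linear but
  not injective. Boundedness of all derivatives survives such a pullback, decay in general does not;
  so even a Schwartz \<open>F\<close> is treated here as an element of
  \<open>CB_infinity\<close>.\<close>

lemma CB_infinity_shear:
  fixes F :: "real^'n \<Rightarrow> 'b::real_normed_vector" and J :: "real^'n^'n"
  assumes "F \<in> CB_infinity"
  shows "(\<lambda>(x, \<xi>). F (x - J *v \<xi>)) \<in> CB_infinity"
proof -
  have "bounded_linear (\<lambda>w::(real^'n) \<times> (real^'n). fst w - J *v snd w)"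
    by (intro bounded_linear_sub bounded_linear_fst bounded_linear_compose[OF matrix_vector_mul_bounded_linear bounded_linear_snd])
  from CB_infinity_affine[OF this assms, of 0] show ?thesis by (simp add: case_prod_beta')
qed

theorem theorem3p1:
  fixes ip :: "'e::{complex_normed_vector,banach} \<Rightarrow> 'e \<Rightarrow>
      'a::{cstar_algebra,second_countable_topology}"
    and act :: "'e \<Rightarrow> 'a \<Rightarrow> 'e"
    and \<iota> :: "(real^'n \<Rightarrow> 'a) \<Rightarrow> 'e"
    and J :: "real^'n^'n"
    and T :: "'e \<Rightarrow>\<^sub>L 'e"
  assumes E: "schwartz_completion ip act \<iota>"
    and skew: "transpose J = - J"
    and O_well_defined: "\<And>a. a \<in> CB_infinity \<Longrightarrow>
      extends_to \<iota> (pseudodiff a) (quantization \<iota> a)"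
    and O_bij: "bij_betw (quantization \<iota>) CB_infinity
      {V \<in> adjointable ip. heisenberg_smooth \<iota> V}"
    and T_adjointable: "T \<in> adjointable ip"
    and T_smooth: "translation_smooth \<iota> T"
    and T_commutes: "\<And>\<phi>. \<phi> \<in> schwartz \<Longrightarrow>
      T o\<^sub>L right_mult_op \<iota> J \<phi> = right_mult_op \<iota> J \<phi> o\<^sub>L T"
  shows "\<exists>F\<in>CB_infinity. T = left_mult_op \<iota> J F"
proof -
  interpret schwartz_completion ip act \<iota> by (rule E)
  have commute: "T o\<^sub>L heisenberg \<iota> (J *v u) u = heisenberg \<iota> (J *v u) u o\<^sub>L T" for u
  proof -
    \<comment> \<open>These packets are chosen so that right multiplication by them is a weak
      integral of Heisenberg operators whose kernel is a Gaussian around \<open>u\<close> with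
      coefficient \<open>a\<close>.\<close>
    define \<phi> where "\<phi> a m = (\<lambda>y. cis (u \<bullet> y) *\<^sub>C (exp (- (norm (inverse (real m) *\<^sub>R y))\<^sup>2 / 2) *\<^sub>R a))"
      for a :: 'a and m :: nat
    have \<phi>: "\<phi> a m \<in> schwartz" if "0 < m" for a m
      unfolding \<phi>_def using that by (intro gaussian_packet_schwartz) simp
    \<comment> \<open>The normalization in \<open>pseudodiff\<close> times the Jacobian from
      \<open>fourier_gaussian\<close>.\<close>
    define c where "c m = (2 * pi) powr (- real CARD('n) / 2) * real m ^ CARD('n)" for m :: nat
    have psd: "deformed_product J f (\<phi> a m) = pseudodiff (\<lambda>(x, \<xi>). f (x - J *v \<xi>)) (\<phi> a m)"
      if "0 < m" "f \<in> schwartz" for a m f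
      using that schwartz_subset_CB_infinity \<phi> by (intro ext deformed_product_eq_pseudodiff) auto
    show ?thesis
    proof (rule heisenberg_commute[where P="\<lambda>a m f. deformed_product J f (\<phi> a m)" and c=c, OF T_adjointable])
      show "bounded_linear ((*v) J)" by (rule matrix_vector_mul_bounded_linear)
      show "c m \<noteq> 0" if "0 < m" for m using that by (simp add: c_def)
      \<comment> \<open>Here \<open>f\<close> is read as the symbol and the packet as the argument:
        the quantization of \<open>f (x - J *v \<xi>)\<close> is assumed to preserve Schwartz
        functions.\<close>
      show "deformed_product J f (\<phi> a m) \<in> schwartz" if "0 < m" "f \<in> schwartz" for a m f
      proof -
        have "(\<lambda>(x, \<xi>). f (x - J *v \<xi>)) \<in> CB_infinity"
          using that schwartz_subset_CB_infinity by (intro CB_infinity_shear) auto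
        from O_well_defined[OF this] show ?thesis
          using \<phi>[OF that(1)] unfolding psd[OF that] extends_to_def by blast
      qed
      show "deformed_product J f (\<phi> a m) x = c m *\<^sub>R (\<integral>\<xi>. cis (x \<bullet> \<xi>) *\<^sub>C
          (f (x - J *v \<xi>) * (exp (- (norm (real m *\<^sub>R (\<xi> - u)))\<^sup>2 / 2) *\<^sub>R a)) \<partial>lborel)"
        if "0 < m" "f \<in> schwartz" for a m f x
      proof -
        have "fourier (\<phi> a m) \<xi> = real m ^ CARD('n) *\<^sub>R (exp (- (norm (real m *\<^sub>R (\<xi> - u)))\<^sup>2 / 2) *\<^sub>R a)" for \<xi>
          unfolding \<phi>_def using that(1) by (intro fourier_gaussian) simp
        then have "pseudodiff (\<lambda>(x, \<xi>). f (x - J *v \<xi>)) (\<phi> a m) x =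
          (2 * pi) powr (- real CARD('n) / 2) *\<^sub>R (\<integral>\<xi>. real m ^ CARD('n) *\<^sub>R (cis (x \<bullet> \<xi>) *\<^sub>C
          (f (x - J *v \<xi>) * (exp (- (norm (real m *\<^sub>R (\<xi> - u)))\<^sup>2 / 2) *\<^sub>R a))) \<partial>lborel)"
          unfolding pseudodiff_def by (simp only: mult_scaleR_right scaleC.scaleR_right prod.case)
        then show ?thesis unfolding psd[OF that] c_def by simp
      qed
      show "T o\<^sub>L op_extension \<iota> (\<lambda>f. deformed_product J f (\<phi> a m)) =
          op_extension \<iota> (\<lambda>f. deformed_product J f (\<phi> a m)) o\<^sub>L T" if "0 < m" for a m
        using T_commutes[OF \<phi>[OF that]] by (simp add: right_mult_op_def)
    qed
  qed

  have "heisenberg_smooth \<iota> T"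
  proof -
    have "bounded_linear (\<lambda>w::(real^'n) \<times> (real^'n). fst w - J *v snd w)"
      by (intro bounded_linear_sub bounded_linear_fst
          bounded_linear_compose[OF matrix_vector_mul_bounded_linear bounded_linear_snd])
    \<comment> \<open>Smoothness in both parameters is obtained by composing the smooth function of
      the translation parameter with the linear map \<open>fst w - J *v snd w\<close>.\<close>
    from smooth_affine[OF this, of "\<lambda>z. heisenberg_conj \<iota> T z 0" 0] T_smooth
    show ?thesis
      using heisenberg_conj_translate[OF commute]
      by (simp add: heisenberg_smooth_def translation_smooth_def case_prod_beta')
  qed
  then obtain a where a: "a \<in> CB_infinity" and Ta: "T = quantization \<iota> a"
    using O_bij T_adjointable by (auto simp: bij_betw_def)

  have shift: "a (w + (J *v \<zeta>, \<zeta>)) = a w" for w \<zeta>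
  proof -
    let ?b = "\<lambda>w. a (w + (J *v \<zeta>, \<zeta>))" and ?U = "heisenberg \<iota> (J *v \<zeta>) \<zeta>"
    have b: "?b \<in> CB_infinity" using CB_infinity_affine[OF bounded_linear_ident a] by blast
    have "quantization \<iota> a o\<^sub>L ?U = ?U o\<^sub>L quantization \<iota> ?b"
      by (rule extends_to_eqI[OF extends_to_compose[OF O_well_defined[OF a] extends_to_heisenberg]
          extends_to_compose[OF extends_to_heisenberg O_well_defined[OF b]]])
        (rule pseudodiff_heisenberg_fun[OF a])
    \<comment> \<open>Covariance and the commutation of \<open>T\<close> with \<open>?U\<close> give
      two expressions for the same product, with \<open>?U\<close> on the left in both.
      Invertibility of \<open>?U\<close> then equates the quantizations, and injectivity equates the
      symbols.\<close>
    then have "?U o\<^sub>L quantization \<iota> a = ?U o\<^sub>L quantization \<iota> ?b"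
      using commute[of \<zeta>] unfolding Ta by simp
    then have U: "?U (quantization \<iota> a x) = ?U (quantization \<iota> ?b x)" for x
      by (simp only: blinfun_apply_blinfun_compose[symmetric])
    obtain W where W: "W o\<^sub>L ?U = id_blinfun" using heisenberg_invertible by blast
    have "quantization \<iota> a = quantization \<iota> ?b"
    proof (rule blinfun_eqI)
      show "quantization \<iota> a x = quantization \<iota> ?b x" for x
        using arg_cong[OF U, of W x] unfolding blinfun_inverse_eq[OF W] .
    qed
    then have "a = ?b" using O_bij a b by (auto simp: bij_betw_def inj_on_def)
    then show ?thesis by metis
  qed

  define F where "F x = a (x, 0)" for x
  have a_eq: "a = (\<lambda>(x, \<xi>). F (x - J *v \<xi>))"
  proof (intro ext, clarify)
    fix x \<xi>
    \<comment> \<open>The point \<open>(x, \<xi>)\<close> is reached from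
      \<open>(x - J *v \<xi>, 0)\<close> by the translation \<open>(J *v \<xi>, \<xi>)\<close>,
      along which the symbol is constant.\<close>
    show "a (x, \<xi>) = F (x - J *v \<xi>)" using shift[of "(x - J *v \<xi>, 0)" \<xi>] by (simp add: F_def)
  qed
  \<comment> \<open>\<open>F\<close> is the pullback of the symbol along the linear embedding that
    sends \<open>x\<close> to \<open>(x, 0)\<close>.\<close>
  have F: "F \<in> CB_infinity"
    using CB_infinity_affine[OF bounded_linear_Pair[OF bounded_linear_ident bounded_linear_zero] a, of 0]
    unfolding F_def[abs_def] by simp
  have "deformed_product J F f = pseudodiff a f" if "f \<in> schwartz" for f
    unfolding a_eq using deformed_product_eq_pseudodiff[OF F that] by (rule ext)
  then have "extends_to \<iota> (deformed_product J F) T"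
    using O_well_defined[OF a] unfolding Ta[symmetric] extends_to_def by simp
  then have "left_mult_op \<iota> J F = T" unfolding left_mult_op_def by (rule op_extension_eq)
  with F show ?thesis by blast
qed

end
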